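(* Let $-\infty\le a<b\le\infty$ and let $\varrho,\varsigma,\chi$ be locally finite complex Borel measures on $(a,b)$ with $\operatorname{supp}(\varsigma)=(a,b)$ and $\varsigma(\{x\})\varrho(\{x\})=\varsigma(\{x\})\chi(\{x\})=0$ for all $x\in(a,b)$. Suppose $\tau$ is regular at $a$, i.e. $|\varrho|((a,c])$, $|\varsigma|((a,c])$, $|\chi|((a,c])$ are finite for some (equivalently all) $c\in(a,b)$. Let $z\in\mathbb{C}$ and $g\in L^1_{loc}((a,b);|\varrho|)$ with $g\in L^1((a,c);|\varrho|)$ for each $c\in(a,b)$. Then for every solution $f\in\mathfrak{D}_\tau$ of $(\tau-z)f=g$ the limits $f(a):=\lim_{x\downarrow a}f(x)$ and $f^{[1]}(a):=\lim_{x\downarrow a}f^{[1]}(x)$ exist and are finite. For each $d_1,d_2\in\mathbb{C}$ there is a unique solution $f$ of $(\tau-z)f=g$ with $f(a)=d_1$ and $f^{[1]}(a)=d_2$. If moreover the measures are real-valued and $g,d_1,d_2,z$ are real, then this solution is real. The analogous statements hold at the endpoint $b$.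
   Context: For a locally finite complex Borel measure $\mu$ on $(a,b)$: $\int_c^x h\,d\mu=\int_{[c,x)}h\,d\mu$ if $x>c$, $0$ if $x=c$, $-\int_{[x,c)}h\,d\mu$ if $x<c$. $AC_{loc}((a,b);\mu)$ is the set of functions $f(x)=f(c)+\int_c^x h\,d\mu$ with $h\in L^1_{loc}((a,b);|\mu|)$, $h=\frac{df}{d\mu}$. $\mathfrak{D}_\tau$ is the set of $f\in AC_{loc}((a,b);\varsigma)$ for which there is $F\in AC_{loc}((a,b);\varrho)$ with $F(x)=-\frac{df}{d\varsigma}(x)+\int_c^x f\,d\chi$ for $|\varsigma|$-a.e. $x$; $F$ is unique, $\tau f:=\frac{dF}{d\varrho}$, and $f^{[1]}(x):=\int_c^x f\,d\chi-F(x)$. "$(\tau-z)f=g$" means $\tau f-zf=g$ $|\varrho|$-a.e. *)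

theory Defs
  imports "HOL-Analysis.Analysis"
begin

text \<open>A locally finite complex Borel measure mu on (a,b) is represented by its polar
  decomposition: a pair (nu, phi) where nu = |mu| is a positive locally finite Borel
  measure concentrated on (a,b) and phi is a Borel function with |phi| = 1, so that
  d mu = phi d nu.\<close>

type_synonym cmeasure = "real measure \<times> (real \<Rightarrow> complex)"

definition ival :: "ereal \<Rightarrow> ereal \<Rightarrow> real set" where
  "ival a b = {x. a < ereal x \<and> ereal x < b}"

definition lfcm :: "ereal \<Rightarrow> ereal \<Rightarrow> cmeasure \<Rightarrow> bool" where
  "lfcm a b \<mu> \<longleftrightarrow> sets (fst \<mu>) = sets borel
     \<and> emeasure (fst \<mu>) (UNIV - ival a b) = 0
     \<and> (\<forall>c d. {c..d} \<subseteq> ival a b \<longrightarrow> emeasure (fst \<mu>) {c..d} < \<infinity>)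
     \<and> snd \<mu> \<in> borel_measurable borel
     \<and> (\<forall>x. cmod (snd \<mu> x) = 1)"

definition cvar :: "cmeasure \<Rightarrow> real measure" where
  "cvar \<mu> = fst \<mu>"

text \<open>Value mu(A) for Borel A relatively compact in (a,b).\<close>
definition cmeas :: "cmeasure \<Rightarrow> real set \<Rightarrow> complex" where
  "cmeas \<mu> A = set_lebesgue_integral (cvar \<mu>) A (snd \<mu>)"

definition csupp :: "ereal \<Rightarrow> ereal \<Rightarrow> cmeasure \<Rightarrow> real set" where
  "csupp a b \<mu> = {x \<in> ival a b. \<forall>e>0. emeasure (cvar \<mu>) (ball x e) \<noteq> 0}"

definition real_cm :: "ereal \<Rightarrow> ereal \<Rightarrow> cmeasure \<Rightarrow> bool" where
  "real_cm a b \<mu> \<longleftrightarrow> (\<forall>A \<in> sets borel. (\<exists>c d. A \<subseteq> {c..d} \<and> {c..d} \<subseteq> ival a b)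
      \<longrightarrow> cmeas \<mu> A \<in> \<real>)"

definition locL1 :: "ereal \<Rightarrow> ereal \<Rightarrow> cmeasure \<Rightarrow> (real \<Rightarrow> complex) \<Rightarrow> bool" where
  "locL1 a b \<mu> h \<longleftrightarrow> (\<forall>c d. {c..d} \<subseteq> ival a b \<longrightarrow> set_integrable (cvar \<mu>) {c..d} h)"

definition cint :: "cmeasure \<Rightarrow> real \<Rightarrow> real \<Rightarrow> (real \<Rightarrow> complex) \<Rightarrow> complex" where
  "cint \<mu> c x h =
     (if c < x then set_lebesgue_integral (cvar \<mu>) {c..<x} (\<lambda>t. h t * snd \<mu> t)
      else if x = c then 0
      else - set_lebesgue_integral (cvar \<mu>) {x..<c} (\<lambda>t. h t * snd \<mu> t))"

definition is_rn_deriv ::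
  "ereal \<Rightarrow> ereal \<Rightarrow> cmeasure \<Rightarrow> real \<Rightarrow> (real \<Rightarrow> complex) \<Rightarrow> (real \<Rightarrow> complex) \<Rightarrow> bool" where
  "is_rn_deriv a b \<mu> c f h \<longleftrightarrow> locL1 a b \<mu> h \<and> (\<forall>x \<in> ival a b. f x = f c + cint \<mu> c x h)"

definition ACloc :: "ereal \<Rightarrow> ereal \<Rightarrow> cmeasure \<Rightarrow> real \<Rightarrow> (real \<Rightarrow> complex) \<Rightarrow> bool" where
  "ACloc a b \<mu> c f \<longleftrightarrow> (\<exists>h. is_rn_deriv a b \<mu> c f h)"

text \<open>F is the function attached to f in the definition of D_tau (normalised to be 0
  outside (a,b), so that it is unique as a HOL function).\<close>
definition qd_rel ::
  "ereal \<Rightarrow> ereal \<Rightarrow> cmeasure \<Rightarrow> cmeasure \<Rightarrow> cmeasure \<Rightarrow> real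
     \<Rightarrow> (real \<Rightarrow> complex) \<Rightarrow> (real \<Rightarrow> complex) \<Rightarrow> bool" where
  "qd_rel a b \<rho> \<sigma> chi c f F \<longleftrightarrow>
     ACloc a b \<sigma> c f \<and> ACloc a b \<rho> c F \<and> (\<forall>x. x \<notin> ival a b \<longrightarrow> F x = 0)
     \<and> (\<exists>h. is_rn_deriv a b \<sigma> c f h
            \<and> (AE x in cvar \<sigma>. F x = - h x + cint chi c x f))"

definition Dtau :: "ereal \<Rightarrow> ereal \<Rightarrow> cmeasure \<Rightarrow> cmeasure \<Rightarrow> cmeasure \<Rightarrow> real
     \<Rightarrow> (real \<Rightarrow> complex) set" where
  "Dtau a b \<rho> \<sigma> chi c = {f. \<exists>F. qd_rel a b \<rho> \<sigma> chi c f F}"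

definition quasiF :: "ereal \<Rightarrow> ereal \<Rightarrow> cmeasure \<Rightarrow> cmeasure \<Rightarrow> cmeasure \<Rightarrow> real
     \<Rightarrow> (real \<Rightarrow> complex) \<Rightarrow> (real \<Rightarrow> complex)" where
  "quasiF a b \<rho> \<sigma> chi c f = (THE F. qd_rel a b \<rho> \<sigma> chi c f F)"

definition qd1 :: "ereal \<Rightarrow> ereal \<Rightarrow> cmeasure \<Rightarrow> cmeasure \<Rightarrow> cmeasure \<Rightarrow> real
     \<Rightarrow> (real \<Rightarrow> complex) \<Rightarrow> real \<Rightarrow> complex" where
  "qd1 a b \<rho> \<sigma> chi c f x = cint chi c x f - quasiF a b \<rho> \<sigma> chi c f x"

definition tau_solves :: "ereal \<Rightarrow> ereal \<Rightarrow> cmeasure \<Rightarrow> cmeasure \<Rightarrow> cmeasure \<Rightarrow> real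
     \<Rightarrow> complex \<Rightarrow> (real \<Rightarrow> complex) \<Rightarrow> (real \<Rightarrow> complex) \<Rightarrow> bool" where
  "tau_solves a b \<rho> \<sigma> chi c z g f \<longleftrightarrow> f \<in> Dtau a b \<rho> \<sigma> chi c
     \<and> (\<exists>H. is_rn_deriv a b \<rho> c (quasiF a b \<rho> \<sigma> chi c f) H
            \<and> (AE x in cvar \<rho>. H x - z * f x = g x))"

definition left_end :: "ereal \<Rightarrow> real filter" where
  "left_end a = (if a = -\<infinity> then at_bot else at_right (real_of_ereal a))"

definition right_end :: "ereal \<Rightarrow> real filter" where
  "right_end b = (if b = \<infinity> then at_top else at_left (real_of_ereal b))"

definition regular_left :: "ereal \<Rightarrow> ereal \<Rightarrow> cmeasure \<Rightarrow> cmeasure \<Rightarrow> cmeasure \<Rightarrow> bool" where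
  "regular_left a b \<rho> \<sigma> chi \<longleftrightarrow> (\<exists>c \<in> ival a b.
     emeasure (cvar \<rho>) {x. a < ereal x \<and> x \<le> c} < \<infinity>
     \<and> emeasure (cvar \<sigma>) {x. a < ereal x \<and> x \<le> c} < \<infinity>
     \<and> emeasure (cvar chi) {x. a < ereal x \<and> x \<le> c} < \<infinity>)"

definition regular_right :: "ereal \<Rightarrow> ereal \<Rightarrow> cmeasure \<Rightarrow> cmeasure \<Rightarrow> cmeasure \<Rightarrow> bool" where
  "regular_right a b \<rho> \<sigma> chi \<longleftrightarrow> (\<exists>c \<in> ival a b.
     emeasure (cvar \<rho>) {x. c \<le> x \<and> ereal x < b} < \<infinity>
     \<and> emeasure (cvar \<sigma>) {x. c \<le> x \<and> ereal x < b} < \<infinity>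
     \<and> emeasure (cvar chi) {x. c \<le> x \<and> ereal x < b} < \<infinity>)"

end

theory Submission
  imports Defs
begin

text \<open>Writing \<open>p\<close> for the quasi-derivative, \<open>(\<tau> - z) f = g\<close> is the system \<open>df = p d\<sigma>\<close>,
  \<open>dp = f d\<chi> - (z f + g) d\<rho>\<close>. Near a regular left endpoint every solution is bounded, because the
  measures of short intervals \<open>(a, e)\<close> are small; hence it has limits at \<open>a\<close>. With prescribed
  limits the system is a Volterra equation in which only values at \<open>t < x\<close> enter at \<open>x\<close>, so its Picard
  iterates converge at a factorial rate, atoms notwithstanding. Conjugating a solution with real data
  yields another one, so uniqueness forces it to be real.

  At the right endpoint the integrals over \<open>[x, b)\<close> include the atom at \<open>x\<close>. Since \<open>\<sigma>\<close> has no atom in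
  common with \<open>\<rho>\<close> and \<open>\<chi>\<close>, the right-continuous versions of \<open>f\<close> and \<open>p\<close> solve the same system with
  \<open>(x, y]\<close> in place of \<open>[x, y)\<close>, and the reflection \<open>x \<mapsto> -x\<close>, \<open>p \<mapsto> -p\<close> turns this into
  the problem at a left endpoint.\<close>

subsection \<open>Integrals against a complex measure on an interval\<close>

text \<open>The pair \<open>(f, p)\<close> is used because \<open>p\<close>, unlike the derivative
  of \<open>f\<close>, has a value at every point. Stating the system for all increments with
  \<open>x \<le> y\<close>, not from the base point \<open>c\<close>, frees it from the sign
  convention of \<open>cint\<close> and lets it pass to the reflected interval.

  The two endpoints differ as follows. Run forwards, the value at \<open>x\<close> is explicit in
  values at \<open>t < x\<close>. Run backwards, the integral over \<open>[x, y)\<close> contains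
  the unknown value at \<open>x\<close>, so identity plus an atom matrix has to be inverted; its
  only entries are the off-diagonal masses at \<open>x\<close> of \<open>\<sigma>\<close> and of
  \<open>chi\<close> minus \<open>z\<close> times \<open>\<rho>\<close>. The hypothesis on common
  atoms makes one entry vanish, hence the matrix squares to zero. Adding and subtracting jumps is
  this inversion.

  Fixed points are unique only among functions bounded up to \<open>a\<close>, which local absolute
  continuity does not include. So boundedness must be proved for an arbitrary solution, from
  increments over compact intervals, before integrals starting at \<open>a\<close> can be written
  down for it.\<close>

lemma ival_eq_einterval: "ival a b = einterval a b"
  by (simp add: ival_def einterval_def)

lemma ival_borel [measurable]: "ival a b \<in> sets borel"
  by (simp add: ival_eq_einterval)

lemma ival_Icc_subset: "x \<in> ival a b \<Longrightarrow> y \<in> ival a b \<Longrightarrow> {x..y} \<subseteq> ival a b"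
  unfolding ival_def
  by (auto intro: less_le_trans[of a "ereal x"] le_less_trans[of _ "ereal y"])

lemma ival_Icc_subset_iff: "{x..y} \<subseteq> ival a b \<longleftrightarrow> y < x \<or> x \<in> ival a b \<and> y \<in> ival a b"
  using ival_Icc_subset[of x a b y] by (auto simp: subset_eq)

lemma ival_mem_between: "x \<in> ival a b \<Longrightarrow> y \<in> ival a b \<Longrightarrow> x \<le> t \<Longrightarrow> t \<le> y \<Longrightarrow> t \<in> ival a b"
  using ival_Icc_subset[of x a b y] by auto

text \<open>Exhaustion by compact intervals whose endpoints stay inside. It reduces statements about
  locally finite measures and locally integrable functions to countably many compacts.\<close>

lemma ival_approx:
  assumes "a < b"
  obtains l u :: "nat \<Rightarrow> real" where "ival a b = (\<Union>i. {l i..u i})" "incseq u" "decseq l"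
    "\<And>i. l i \<in> ival a b" "\<And>i. u i \<in> ival a b"
proof -
  obtain u l :: "nat \<Rightarrow> real" where ul: "einterval a b = (\<Union>i. {l i .. u i})"
    "incseq u" "decseq l" "\<And>i. l i < u i" "\<And>i. a < l i" "\<And>i. u i < b"
    "l \<longlonglongrightarrow> a" "u \<longlonglongrightarrow> b"
    by (rule einterval_Icc_approximation[OF assms]) (rule that; assumption)
  show thesis
  proof (rule that)
    show "ival a b = (\<Union>i. {l i..u i})" using ul(1) by (simp add: ival_eq_einterval)
    have mem: "ereal (l i) < ereal (u i)" for i using ul(4) by simp
    show "l i \<in> ival a b" "u i \<in> ival a b" for i
      using ul(5,6)[of i] less_trans[OF mem ul(6)] less_trans[OF ul(5) mem] by (auto simp: ival_def)
  qed fact+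
qed

lemma ival_less: "x \<in> ival a b \<Longrightarrow> a < b"
  by (auto simp: ival_def)

text \<open>Integral over a set against the complex measure. Sets can be split, restricted and
  reflected without the case distinction on the base point that \<open>cint\<close> carries.\<close>

definition cmint :: "cmeasure \<Rightarrow> real set \<Rightarrow> (real \<Rightarrow> complex) \<Rightarrow> complex" where
  "cmint \<mu> A h = (LINT t:A|cvar \<mu>. h t * snd \<mu> t)"

lemma cmeas_eq_cmint: "cmeas \<mu> A = cmint \<mu> A (\<lambda>_. 1)"
  by (simp add: cmeas_def cmint_def)

lemma cint_eq_cmint:
  "cint \<mu> c x h = (if c < x then cmint \<mu> {c..<x} h else if x = c then 0 else - cmint \<mu> {x..<c} h)"
  by (simp add: cint_def cmint_def)

lemma lfcm_sets: "lfcm a b \<mu> \<Longrightarrow> sets (cvar \<mu>) = sets borel"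
  by (simp add: lfcm_def cvar_def)

lemma lfcm_space: "lfcm a b \<mu> \<Longrightarrow> space (cvar \<mu>) = UNIV"
  using sets_eq_imp_space_eq[OF lfcm_sets] by simp

lemma lfcm_phase_measurable:
  "lfcm a b \<mu> \<Longrightarrow> snd \<mu> \<in> borel_measurable borel"
  by (simp add: lfcm_def)

lemma lfcm_norm_phase: "lfcm a b \<mu> \<Longrightarrow> cmod (snd \<mu> x) = 1"
  by (simp add: lfcm_def)

lemma lfcm_finite_Icc: "lfcm a b \<mu> \<Longrightarrow> {x..y} \<subseteq> ival a b \<Longrightarrow> emeasure (cvar \<mu>) {x..y} < \<infinity>"
  by (simp add: lfcm_def cvar_def)

lemma lfcm_AE_ival:
  assumes "lfcm a b \<mu>" shows "AE x in cvar \<mu>. x \<in> ival a b"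
proof (rule AE_I[where N="UNIV - ival a b"])
  show "emeasure (cvar \<mu>) (UNIV - ival a b) = 0"
    using assms by (simp add: lfcm_def cvar_def)
  show "UNIV - ival a b \<in> sets (cvar \<mu>)"
    unfolding lfcm_sets[OF assms] by (auto simp: Compl_eq_Diff_UNIV[symmetric])
qed auto

text \<open>The measure lives on the whole line, so the null complement of the interval has to join
  the exhausting compacts in the cover by sets of finite measure.\<close>

lemma lfcm_sigma_finite:
  assumes "lfcm a b \<mu>" "a < b"
  shows "sigma_finite_measure (cvar \<mu>)"
proof
  obtain l u :: "nat \<Rightarrow> real" where lu: "ival a b = (\<Union>i. {l i..u i})"
    "incseq u" "decseq l"
    "\<And>i. l i \<in> ival a b" "\<And>i. u i \<in> ival a b"
    by (rule ival_approx[OF assms(2)]) (rule that; assumption)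
  let ?A = "insert (UNIV - ival a b) (range (\<lambda>i. {l i..u i}))"
  have "?A \<subseteq> sets (cvar \<mu>)"
    unfolding lfcm_sets[OF assms(1)] by (auto simp: Compl_eq_Diff_UNIV[symmetric])
  moreover have "\<Union>?A = space (cvar \<mu>)"
    using lu(1) lfcm_space[OF assms(1)] by auto
  moreover have "\<forall>A\<in>?A. emeasure (cvar \<mu>) A \<noteq> \<infinity>"
    using lfcm_finite_Icc[OF assms(1) ival_Icc_subset[OF lu(4,5)]] assms(1)
    by (auto simp: lfcm_def cvar_def less_top[symmetric])
  ultimately show "\<exists>A. countable A \<and> A \<subseteq> sets (cvar \<mu>) \<and> \<Union> A = space (cvar \<mu>) \<and> (\<forall>a\<in>A. emeasure (cvar \<mu>) a \<noteq> \<infinity>)"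
    by (intro exI[of _ ?A]) auto
qed

lemma set_borel_measurable_ival_subset:
  fixes h :: "real \<Rightarrow> complex"
  assumes "set_borel_measurable borel (ival a b) h" "A \<in> sets borel" "A \<subseteq> ival a b" "lfcm a b \<mu>"
  shows "set_borel_measurable (cvar \<mu>) A h"
  using set_borel_measurable_subset[OF assms(1-3)] lfcm_sets[OF assms(4)]
  by (simp add: set_borel_measurable_def cong: measurable_cong_sets)

lemma set_integrable_bounded:
  fixes h :: "real \<Rightarrow> complex"
  assumes \<mu>: "lfcm a b \<mu>" and h: "set_borel_measurable borel (ival a b) h"
    and A: "A \<in> sets borel" "A \<subseteq> ival a b" "emeasure (cvar \<mu>) A < \<infinity>"
    and C: "\<And>t. t \<in> A \<Longrightarrow> norm (h t) \<le> C"
  shows "set_integrable (cvar \<mu>) A h"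
  unfolding set_integrable_def
proof (rule integrableI_bounded_set[where A=A and B=C])
  show "A \<in> sets (cvar \<mu>)" using A lfcm_sets[OF \<mu>] by simp
  show "(\<lambda>x. indicat_real A x *\<^sub>R h x) \<in> borel_measurable (cvar \<mu>)"
    using set_borel_measurable_ival_subset[OF h A(1,2) \<mu>] by (simp add: set_borel_measurable_def)
  show "AE x in cvar \<mu>. x \<in> A \<longrightarrow> norm (indicat_real A x *\<^sub>R h x) \<le> C" using C by simp
qed (use A in \<open>auto simp: indicator_def\<close>)

lemma set_integrable_phase:
  assumes \<mu>: "lfcm a b \<mu>" and h: "set_integrable (cvar \<mu>) A h"
  shows "set_integrable (cvar \<mu>) A (\<lambda>t. h t * snd \<mu> t :: complex)"
proof -
  have [measurable]: "snd \<mu> \<in> borel_measurable (cvar \<mu>)"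
    using lfcm_phase_measurable[OF \<mu>] lfcm_sets[OF \<mu>] by (simp cong: measurable_cong_sets)
  have [measurable]: "(\<lambda>x. indicat_real A x *\<^sub>R h x) \<in> borel_measurable (cvar \<mu>)"
    using h by (auto simp: set_integrable_def)
  have "integrable (cvar \<mu>) (\<lambda>x. (indicat_real A x *\<^sub>R h x) * snd \<mu> x)"
  proof (rule Bochner_Integration.integrable_bound[OF h[unfolded set_integrable_def]])
    show "(\<lambda>x. (indicat_real A x *\<^sub>R h x) * snd \<mu> x) \<in> borel_measurable (cvar \<mu>)"
      by measurable
  qed (simp add: norm_mult lfcm_norm_phase[OF \<mu>])
  moreover have "(\<lambda>x. (indicat_real A x *\<^sub>R h x) * snd \<mu> x) = (\<lambda>x. indicat_real A x *\<^sub>R (h x * snd \<mu> x))"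
    by auto
  ultimately show ?thesis unfolding set_integrable_def by metis
qed

lemma cmint_norm_le:
  assumes "lfcm a b \<mu>"
  shows "cmod (cmint \<mu> A h) \<le> (LINT t:A|cvar \<mu>. cmod (h t))"
proof -
  have "cmod (cmint \<mu> A h) \<le> (LINT t|cvar \<mu>. cmod (indicat_real A t *\<^sub>R (h t * snd \<mu> t)))"
    unfolding cmint_def set_lebesgue_integral_def by (rule integral_norm_bound)
  also have "\<dots> = (LINT t:A|cvar \<mu>. cmod (h t))"
    unfolding set_lebesgue_integral_def
    by (intro Bochner_Integration.integral_cong) (auto simp: norm_mult lfcm_norm_phase[OF assms])
  finally show ?thesis .
qed

lemma set_integrable_norm_complex:
  fixes h :: "real \<Rightarrow> complex"
  assumes "set_integrable M A h" shows "set_integrable M A (\<lambda>t. norm (h t))"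
  using integrable_norm[OF assms[unfolded set_integrable_def]] by (simp add: set_integrable_def)

lemma set_integral_norm_mono_set:
  fixes h :: "real \<Rightarrow> complex"
  assumes "set_integrable M B h" "A \<in> sets M" "A \<subseteq> B"
  shows "(LINT t:A|M. norm (h t)) \<le> (LINT t:B|M. norm (h t))"
proof -
  have "set_integrable M A h" using assms by (rule set_integrable_subset)
  then have "integrable M (\<lambda>t. indicat_real A t *\<^sub>R norm (h t))"
    "integrable M (\<lambda>t. indicat_real B t *\<^sub>R norm (h t))"
    using set_integrable_norm_complex assms(1) unfolding set_integrable_def by blast+
  then show ?thesis
    unfolding set_lebesgue_integral_def
    by (rule integral_mono) (use assms in \<open>auto simp: indicator_def\<close>)
qed

lemma cmint_norm_le_mono:
  assumes "lfcm a b \<mu>" "set_integrable (cvar \<mu>) B h" "A \<in> sets borel" "A \<subseteq> B"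
  shows "cmod (cmint \<mu> A h) \<le> (LINT t:B|cvar \<mu>. cmod (h t))"
  by (rule order_trans[OF cmint_norm_le[OF assms(1)] set_integral_norm_mono_set[OF assms(2)]])
    (use assms(3,4) lfcm_sets[OF assms(1)] in auto)

lemma set_integral_norm_le_const:
  fixes h :: "real \<Rightarrow> complex"
  assumes "set_integrable M A h" "A \<in> sets M" "emeasure M A < \<infinity>" "\<And>t. t \<in> A \<Longrightarrow> norm (h t) \<le> C"
  shows "(LINT t:A|M. norm (h t)) \<le> C * measure M A"
proof -
  have "(LINT t:A|M. norm (h t)) \<le> (LINT t:A|M. C)"
  proof (rule set_integral_mono)
    show "set_integrable M A (\<lambda>t. norm (h t))"
      by (rule set_integrable_norm_complex[OF assms(1)])
    show "set_integrable M A (\<lambda>t. C)"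
      unfolding set_integrable_def using assms by auto
  qed (use assms in auto)
  also have "\<dots> = C * measure M A"
    using assms by (simp add: set_lebesgue_integral_def measure_def)
  finally show ?thesis .
qed

lemma cmint_norm_le_const:
  assumes "lfcm a b \<mu>" "set_integrable (cvar \<mu>) A h" "A \<in> sets borel" "emeasure (cvar \<mu>) A < \<infinity>"
    "\<And>t. t \<in> A \<Longrightarrow> cmod (h t) \<le> C"
  shows "cmod (cmint \<mu> A h) \<le> C * measure (cvar \<mu>) A"
  by (rule order_trans[OF cmint_norm_le[OF assms(1)] set_integral_norm_le_const[OF assms(2)]])
    (use assms(3-5) lfcm_sets[OF assms(1)] in auto)

text \<open>The bound by a nonnegative integral is the form that allows replacing
  \<open>cvar \<mu>\<close> by a larger measure with no integrability to check.\<close>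

lemma cmint_norm_le_nn:
  assumes "lfcm a b \<mu>" "set_integrable (cvar \<mu>) A h"
  shows "ennreal (cmod (cmint \<mu> A h)) \<le> (\<integral>\<^sup>+t\<in>A. ennreal (cmod (h t)) \<partial>cvar \<mu>)"
proof -
  have "ennreal (cmod (cmint \<mu> A h)) \<le> (\<integral>\<^sup>+t. ennreal (cmod (indicat_real A t *\<^sub>R (h t * snd \<mu> t))) \<partial>cvar \<mu>)"
    unfolding cmint_def set_lebesgue_integral_def
    by (rule integral_norm_bound_ennreal) (use set_integrable_phase[OF assms] in \<open>simp add: set_integrable_def\<close>)
  also have "\<dots> = (\<integral>\<^sup>+t\<in>A. ennreal (cmod (h t)) \<partial>cvar \<mu>)"
    by (intro nn_integral_cong) (auto simp: norm_mult lfcm_norm_phase[OF assms(1)] indicator_def)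
  finally show ?thesis .
qed

lemma cmint_add:
  assumes "lfcm a b \<mu>" "set_integrable (cvar \<mu>) A h" "set_integrable (cvar \<mu>) A k"
  shows "cmint \<mu> A (\<lambda>t. h t + k t) = cmint \<mu> A h + cmint \<mu> A k"
  using set_integral_add(2)[OF set_integrable_phase[OF assms(1,2)] set_integrable_phase[OF assms(1,3)]]
  by (simp add: cmint_def ring_distribs)

lemma cmint_diff:
  assumes "lfcm a b \<mu>" "set_integrable (cvar \<mu>) A h" "set_integrable (cvar \<mu>) A k"
  shows "cmint \<mu> A (\<lambda>t. h t - k t) = cmint \<mu> A h - cmint \<mu> A k"
  using set_integral_diff(2)[OF set_integrable_phase[OF assms(1,2)] set_integrable_phase[OF assms(1,3)]]
  by (simp add: cmint_def ring_distribs)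

lemma cmint_cmult: "cmint \<mu> A (\<lambda>t. z * h t) = z * cmint \<mu> A h"
  by (simp add: cmint_def mult.assoc)

lemma cmint_minus: "cmint \<mu> A (\<lambda>t. - h t) = - cmint \<mu> A h"
  using cmint_cmult[of \<mu> A "-1" h] by simp

lemma cmint_Un:
  assumes "lfcm a b \<mu>" "set_integrable (cvar \<mu>) A h" "set_integrable (cvar \<mu>) B h" "A \<inter> B = {}"
  shows "cmint \<mu> (A \<union> B) h = cmint \<mu> A h + cmint \<mu> B h"
  unfolding cmint_def
  by (rule set_integral_Un[OF assms(4) set_integrable_phase[OF assms(1,2)] set_integrable_phase[OF assms(1,3)]])

lemma cmint_empty [simp]: "cmint \<mu> {} h = 0"
  by (simp add: cmint_def set_lebesgue_integral_def)

lemma cmint_cong: "A \<in> sets borel \<Longrightarrow> lfcm a b \<mu> \<Longrightarrow> (\<And>t. t \<in> A \<Longrightarrow> h t = k t) \<Longrightarrow> cmint \<mu> A h = cmint \<mu> A k"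
  unfolding cmint_def by (intro set_lebesgue_integral_cong) (auto simp: lfcm_sets)

lemma cmint_cong_AE:
  assumes "lfcm a b \<mu>" "set_integrable (cvar \<mu>) A h" "set_integrable (cvar \<mu>) A k"
    "AE t in cvar \<mu>. t \<in> A \<longrightarrow> h t = k t"
  shows "cmint \<mu> A h = cmint \<mu> A k"
  unfolding cmint_def set_lebesgue_integral_def
proof (rule integral_cong_AE)
  show "AE t in cvar \<mu>. indicat_real A t *\<^sub>R (h t * snd \<mu> t) = indicat_real A t *\<^sub>R (k t * snd \<mu> t)"
    using assms(4) by eventually_elim (auto simp: indicator_def)
qed (use set_integrable_phase[OF assms(1,2)] set_integrable_phase[OF assms(1,3)] in \<open>auto simp: set_integrable_def\<close>)

lemma cmint_singleton:
  assumes "lfcm a b \<mu>" "x \<in> ival a b"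
  shows "cmint \<mu> {x} h = h x * snd \<mu> x * measure (cvar \<mu>) {x}"
proof -
  have "emeasure (cvar \<mu>) {x} < \<infinity>"
    using lfcm_finite_Icc[OF assms(1), of x x] assms(2) by (simp add: less_top)
  moreover have "(\<lambda>t. indicat_real {x} t *\<^sub>R (h t * snd \<mu> t)) = (\<lambda>t. indicat_real {x} t *\<^sub>R (h x * snd \<mu> x))"
    by (auto simp: indicator_def)
  ultimately show ?thesis
    using lfcm_sets[OF assms(1)] unfolding cmint_def set_lebesgue_integral_def
    by (simp add: measure_def scaleR_conv_of_real[where 'a=complex] mult_ac)
qed

lemma locL1_subset:
  assumes "locL1 a b \<mu> h" "lfcm a b \<mu>" "x \<in> ival a b" "y \<in> ival a b" "A \<subseteq> {x..y}" "A \<in> sets borel"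
  shows "set_integrable (cvar \<mu>) A h"
  by (rule set_integrable_subset[OF _ _ assms(5)])
    (use assms(1,6) ival_Icc_subset[OF assms(3,4)] lfcm_sets[OF assms(2)] in \<open>auto simp: locL1_def\<close>)

text \<open>Truncations of \<open>h\<close> to the exhausting compacts are Borel, because
  \<open>cvar \<mu>\<close> is defined on exactly the Borel sets, and they converge
  pointwise.\<close>

lemma locL1_set_borel_measurable:
  assumes "locL1 a b \<mu> h" "lfcm a b \<mu>" "a < b"
  shows "set_borel_measurable borel (ival a b) h"
proof -
  obtain l u :: "nat \<Rightarrow> real" where lu: "ival a b = (\<Union>i. {l i..u i})" "incseq u" "decseq l"
    "\<And>i. l i \<in> ival a b" "\<And>i. u i \<in> ival a b"
    by (rule ival_approx[OF assms(3)]) (rule that; assumption)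
  show ?thesis
    unfolding set_borel_measurable_def
  proof (rule borel_measurable_LIMSEQ_metric)
    fix i
    have "set_integrable (cvar \<mu>) {l i..u i} h"
      by (rule locL1_subset[OF assms(1,2) lu(4,5)]) auto
    then have "(\<lambda>x. indicat_real {l i..u i} x *\<^sub>R h x) \<in> borel_measurable (cvar \<mu>)"
      unfolding set_integrable_def by auto
    then show "(\<lambda>x. indicat_real {l i..u i} x *\<^sub>R h x) \<in> borel_measurable borel"
      using lfcm_sets[OF assms(2)] by (simp cong: measurable_cong_sets)
  next
    fix x
    show "(\<lambda>i. indicat_real {l i..u i} x *\<^sub>R h x) \<longlonglongrightarrow> indicat_real (ival a b) x *\<^sub>R h x"
    proof (cases "x \<in> ival a b")
      case True
      then obtain j where j: "x \<in> {l j..u j}" using lu(1) by auto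
      have "\<forall>i\<ge>j. x \<in> {l i..u i}"
        using j lu(2,3) unfolding incseq_def decseq_def by (meson atLeastAtMost_iff order_trans)
      then have "eventually (\<lambda>i. indicat_real {l i..u i} x *\<^sub>R h x = h x) sequentially"
        unfolding eventually_sequentially by (intro exI[of _ j]) auto
      then show ?thesis using True by (simp add: tendsto_eventually)
    next
      case False
      then have "x \<notin> {l i..u i}" for i using lu(1) by auto
      then have "(\<lambda>i. indicat_real {l i..u i} x *\<^sub>R h x) = (\<lambda>_. 0)" by (auto simp: fun_eq_iff indicator_def)
      then show ?thesis using False by simp
    qed
  qed
qed

text \<open>Measurability of parameter integrals over a \<sigma>-finite measure. A general predicate
  \<open>P\<close> covers the integrals up to \<open>x\<close>, from \<open>x\<close>, and over the
  single point \<open>x\<close>.\<close>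

lemma cmint_param_measurable:
  assumes \<mu>: "lfcm a b \<mu>" and "a < b" and h: "set_borel_measurable borel (ival a b) h"
    and P: "Measurable.pred (borel \<Otimes>\<^sub>M borel) (\<lambda>(x,t). P x t)"
    and sub: "\<And>x t. P x t \<Longrightarrow> t \<in> ival a b"
  shows "(\<lambda>x. cmint \<mu> {t. P x t} h) \<in> borel_measurable borel"
proof -
  interpret sigma_finite_measure "cvar \<mu>" by (rule lfcm_sigma_finite) fact+
  have [measurable_cong]: "sets (cvar \<mu>) = sets borel" by (rule lfcm_sets[OF \<mu>])
  have [measurable]: "snd \<mu> \<in> borel_measurable borel" by (rule lfcm_phase_measurable[OF \<mu>])
  \<comment> \<open>\<open>h\<close> is Borel only on the interval. Cutting it off outside changes
    nothing, since \<open>P x t\<close> forces \<open>t\<close> into the interval.\<close>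
  have [measurable]: "(\<lambda>x. indicat_real (ival a b) x *\<^sub>R h x) \<in> borel_measurable borel"
    using h by (simp add: set_borel_measurable_def)
  have [measurable]: "Measurable.pred (borel \<Otimes>\<^sub>M borel) (\<lambda>w. P (fst w) (snd w))"
    using P by (simp add: case_prod_beta')
  have "(\<lambda>x. LINT t|cvar \<mu>. (if P (fst (x,t)) (snd (x,t)) then (indicat_real (ival a b) t *\<^sub>R h t) * snd \<mu> t else 0)) \<in> borel_measurable borel"
    by (rule borel_measurable_lebesgue_integral) measurable
  also have "(\<lambda>x. LINT t|cvar \<mu>. (if P (fst (x,t)) (snd (x,t)) then (indicat_real (ival a b) t *\<^sub>R h t) * snd \<mu> t else 0)) = (\<lambda>x. cmint \<mu> {t. P x t} h)"
    unfolding cmint_def set_lebesgue_integral_def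
    by (intro ext Bochner_Integration.integral_cong) (auto simp: indicator_def dest: sub)
  finally show ?thesis .
qed

subsection \<open>Volterra equations with respect to a measure with atoms\<close>

text \<open>\<open>iter_int M n x\<close> is the product measure of the chains of \<open>n\<close>
  points that descend strictly from below \<open>x\<close>, the analogue of the volume of a simplex.
  The case distinction on \<open>t < x\<close>, in place of an integral over \<open>{..<x}\<close>,
  keeps the integrand jointly measurable in \<open>x\<close> and \<open>t\<close>.\<close>

primrec iter_int :: "real measure \<Rightarrow> nat \<Rightarrow> real \<Rightarrow> ennreal" where
  "iter_int M 0 x = 1"
| "iter_int M (Suc n) x = (\<integral>\<^sup>+t. (if t < x then iter_int M n t else 0) \<partial>M)"

lemma iter_int_measurable:
  assumes "finite_measure M" and s: "sets M = sets borel"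
  shows "iter_int M n \<in> borel_measurable borel"
proof (induction n)
  case (Suc n)
  interpret finite_measure M by fact
  note [measurable_cong] = s
  note Suc.IH [measurable]
  have "(\<lambda>x. \<integral>\<^sup>+t. (if t < x then iter_int M n t else 0) \<partial>M) \<in> borel_measurable borel"
    by measurable
  also have "(\<lambda>x. \<integral>\<^sup>+t. (if t < x then iter_int M n t else 0) \<partial>M) = iter_int M (Suc n)"
    by (auto simp: fun_eq_iff)
  finally show ?case .
qed (simp add: measurable_const cong: measurable_cong)

text \<open>With \<open>K x = M {..<x}\<close> and \<open>E = iter_int M\<close>, split
  \<open>K x = K t + M {t..<x}\<close> under the integral defining \<open>E (n + 1) x\<close>: the first part is estimated by the
  induction hypothesis, the second one by Fubini. Atoms only help.\<close>

lemma iter_int_Suc_le: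
  assumes M: "finite_measure M" and s: "sets M = sets borel"
  shows "of_nat (Suc n) * iter_int M (Suc n) x \<le> emeasure M {..<x} * iter_int M n x"
proof (induction n arbitrary: x)
  case 0
  have "(\<integral>\<^sup>+t. (if t < x then 1 else 0) \<partial>M) = (\<integral>\<^sup>+t. indicator {..<x} t \<partial>M)"
    by (intro nn_integral_cong) (auto simp: indicator_def)
  then show ?case using s by (simp cong: if_cong)
next
  case (Suc n)
  interpret finite_measure M by fact
  interpret pair_sigma_finite M M ..
  note [measurable_cong] = s
  note iter_int_measurable[OF M s, measurable]
  let ?K = "\<lambda>x. emeasure M {..<x}" and ?E = "iter_int M n"
  have K_meas [measurable]: "?K \<in> borel_measurable borel"
  proof -
    have "iter_int M 1 = ?K"
    proof
      fix x
      have "(\<integral>\<^sup>+t. (if t < x then 1 else 0) \<partial>M) = (\<integral>\<^sup>+t. indicator {..<x} t \<partial>M)"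
        by (intro nn_integral_cong) (auto simp: indicator_def)
      then show "iter_int M 1 x = ?K x" using s by (simp cong: if_cong)
    qed
    then show ?thesis using iter_int_measurable[OF M s, of 1] by simp
  qed
  have co: "(\<integral>\<^sup>+s. (if t \<le> s \<and> s < x then 1 else 0) \<partial>M) = emeasure M {t..<x}" for t
  proof -
    have "(\<integral>\<^sup>+s. (if t \<le> s \<and> s < x then 1 else 0) \<partial>M) = (\<integral>\<^sup>+s. indicator {t..<x} s \<partial>M)"
      by (intro nn_integral_cong) (auto simp: indicator_def)
    then show ?thesis using s by simp
  qed
  have "of_nat (Suc n) * iter_int M (Suc (Suc n)) x
      = (\<integral>\<^sup>+t. (if t < x then of_nat (Suc n) * iter_int M (Suc n) t else 0) \<partial>M)"
    by (subst iter_int.simps(2), subst nn_integral_cmult[symmetric])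
      (auto intro!: nn_integral_cong simp del: iter_int.simps of_nat_Suc)
  also have "\<dots> \<le> (\<integral>\<^sup>+t. (if t < x then ?K t * ?E t else 0) \<partial>M)"
    using Suc.IH by (intro nn_integral_mono) (auto simp del: iter_int.simps of_nat_Suc)
  finally have lower: "of_nat (Suc n) * iter_int M (Suc (Suc n)) x \<le> \<dots>" .
  have "iter_int M (Suc (Suc n)) x
      = (\<integral>\<^sup>+s. (\<integral>\<^sup>+t. (if s < x \<and> t < s then ?E t else 0) \<partial>M) \<partial>M)"
    by (auto intro!: nn_integral_cong)
  \<comment> \<open>Admitting the diagonal \<open>t = s\<close> turns the inner measure after the
    swap into that of \<open>{t..<x}\<close>, exactly what \<open>{..<t}\<close> misses in
    \<open>{..<x}\<close>. This is the only place where atoms make the estimate lossy on this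
    side.\<close>
  also have "\<dots> \<le> (\<integral>\<^sup>+s. (\<integral>\<^sup>+t. (if s < x \<and> t \<le> s then ?E t else 0) \<partial>M) \<partial>M)"
    by (intro nn_integral_mono) auto
  also have "\<dots> = (\<integral>\<^sup>+t. (\<integral>\<^sup>+s. (if s < x \<and> t \<le> s then ?E t else 0) \<partial>M) \<partial>M)"
    by (rule Fubini'[symmetric]) measurable
  also have "\<dots> = (\<integral>\<^sup>+t. (if t < x then emeasure M {t..<x} * ?E t else 0) \<partial>M)"
  proof (intro nn_integral_cong)
    fix t
    have "(\<integral>\<^sup>+s. (if s < x \<and> t \<le> s then ?E t else 0) \<partial>M)
        = (\<integral>\<^sup>+s. ?E t * (if t \<le> s \<and> s < x then 1 else 0) \<partial>M)"
      by (intro nn_integral_cong) auto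
    also have "\<dots> = ?E t * emeasure M {t..<x}"
      by (subst nn_integral_cmult) (auto simp: co)
    finally show "(\<integral>\<^sup>+s. (if s < x \<and> t \<le> s then ?E t else 0) \<partial>M)
        = (if t < x then emeasure M {t..<x} * ?E t else 0)"
      by (auto simp: mult.commute)
  qed
  finally have upper: "iter_int M (Suc (Suc n)) x \<le> \<dots>" .
  have "of_nat (Suc (Suc n)) * iter_int M (Suc (Suc n)) x
      = of_nat (Suc n) * iter_int M (Suc (Suc n)) x + iter_int M (Suc (Suc n)) x"
    by (simp add: ring_distribs add.commute)
  also have "\<dots> \<le> (\<integral>\<^sup>+t. (if t < x then ?K t * ?E t else 0) \<partial>M)
      + (\<integral>\<^sup>+t. (if t < x then emeasure M {t..<x} * ?E t else 0) \<partial>M)"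
    by (rule add_mono[OF lower upper])
  also have "\<dots>
      = (\<integral>\<^sup>+t. (if t < x then ?K t * ?E t else 0) + (if t < x then emeasure M {t..<x} * ?E t else 0) \<partial>M)"
  proof (rule nn_integral_add[symmetric])
    have "(\<lambda>t. \<integral>\<^sup>+s. (if t \<le> s \<and> s < x then 1 else 0) \<partial>M) \<in> borel_measurable borel"
      by measurable
    then have [measurable]: "(\<lambda>t. emeasure M {t..<x}) \<in> borel_measurable borel" by (simp add: co)
    show "(\<lambda>t. if t < x then emeasure M {t..<x} * ?E t else 0) \<in> borel_measurable M" by measurable
  qed measurable
  also have "\<dots> = (\<integral>\<^sup>+t. ?K x * (if t < x then ?E t else 0) \<partial>M)"
  proof (intro nn_integral_cong)
    fix t
    show "(if t < x then ?K t * ?E t else 0) + (if t < x then emeasure M {t..<x} * ?E t else 0)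
       = ?K x * (if t < x then ?E t else 0)"
    proof (cases "t < x")
      case True
      have "{..<t} \<union> {t..<x} = {..<x}" using True by auto
      then have "?K x = ?K t + emeasure M {t..<x}"
        using plus_emeasure[of "{..<t}" M "{t..<x}"] s by (simp add: ivl_disj_int)
      then show ?thesis by (simp add: distrib_right)
    qed simp
  qed
  also have "\<dots> = ?K x * iter_int M (Suc n) x"
    by (subst nn_integral_cmult) auto
  finally show ?case .
qed

lemma iter_int_le:
  assumes M: "finite_measure M" and s: "sets M = sets borel"
  shows "of_nat (fact n) * iter_int M n x \<le> emeasure M {..<x} ^ n"
proof (induction n)
  case (Suc n)
  have "of_nat (fact (Suc n)) * iter_int M (Suc n) x = of_nat (fact n) * (of_nat (Suc n) * iter_int M (Suc n) x)"
    by (simp only: fact_Suc of_nat_mult of_nat_id mult.assoc mult.left_commute)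
  also have "\<dots> \<le> of_nat (fact n) * (emeasure M {..<x} * iter_int M n x)"
    by (intro mult_left_mono iter_int_Suc_le[OF M s]) simp
  also have "\<dots> = emeasure M {..<x} * (of_nat (fact n) * iter_int M n x)"
    by (simp only: mult_ac)
  also have "\<dots> \<le> emeasure M {..<x} * emeasure M {..<x} ^ n"
    by (intro mult_left_mono Suc.IH) simp
  finally show ?case by simp
qed simp

text \<open>Division by the factorial is postponed to this point, where the mass is finite and real
  arithmetic is available. The bound no longer depends on \<open>x\<close>.\<close>

lemma iter_int_le_real:
  assumes M: "finite_measure M" and s: "sets M = sets borel"
  shows "iter_int M n x \<le> ennreal (measure M UNIV ^ n / fact n)"
proof -
  interpret finite_measure M by fact
  have "of_nat (fact n) * iter_int M n x \<le> emeasure M UNIV ^ n"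
    using iter_int_le[OF M s, of n x] power_mono[OF emeasure_mono[of "{..<x}" UNIV M], of n] s
    by (auto intro: order_trans)
  also have "\<dots> = ennreal (measure M UNIV ^ n)"
    by (simp add: emeasure_eq_measure ennreal_power)
  finally have "ennreal (1 / fact n) * (of_nat (fact n) * iter_int M n x) \<le> ennreal (1 / fact n) * ennreal (measure M UNIV ^ n)"
    by (rule mult_left_mono) simp
  moreover have "ennreal (1 / fact n) * of_nat (fact n) = 1"
    by (simp flip: ennreal_of_nat_eq_real_of_nat ennreal_mult' add: ennreal_of_nat_eq_real_of_nat)
  ultimately show ?thesis
    by (simp add: ennreal_mult'[symmetric] mult.assoc[symmetric])
qed

section \<open>Picard iteration for an abstract Volterra operator\<close>

definition left_bdd :: "real set \<Rightarrow> (real \<Rightarrow> 'a::real_normed_vector) \<Rightarrow> bool" where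
  "left_bdd D u \<longleftrightarrow> u \<in> borel_measurable borel \<and> (\<forall>x\<in>D. \<exists>C. \<forall>t\<le>x. norm (u t) \<le> C)"

text \<open>The integral in the Lipschitz condition runs over \<open>t < x\<close> strictly, so an
  atom of \<open>\<omega>\<close> at \<open>x\<close> does not feed back into \<open>T u x\<close>.
  Requiring the value 0 off \<open>D\<close> makes fixed points unique as functions on the whole
  line. The class \<open>left_bdd\<close> asks for bounds on half-lines ending in \<open>D\<close>;
  for an interval this means bounded up to its left end, with no demand at its right end.\<close>

locale volterra =
  fixes D :: "real set" and \<omega> :: "real measure" and q :: real
    and T :: "(real \<Rightarrow> 'a :: {banach, second_countable_topology}) \<Rightarrow> real \<Rightarrow> 'a"
  assumes sets_\<omega>: "sets \<omega> = sets borel"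
    and finite_\<omega>: "x \<in> D \<Longrightarrow> emeasure \<omega> {..<x} < \<infinity>"
    and q_nonneg: "0 \<le> q"
    and T_left_bdd: "left_bdd D u \<Longrightarrow> left_bdd D (T u)"
    and T_outside: "x \<notin> D \<Longrightarrow> T u x = 0"
    and T_lipschitz: "\<lbrakk>left_bdd D u; left_bdd D v; x \<in> D\<rbrakk> \<Longrightarrow>
      ennreal (norm (T u x - T v x)) \<le> ennreal q * (\<integral>\<^sup>+t. (if t < x then ennreal (norm (u t - v t)) else 0) \<partial>\<omega>)"
begin

lemma iterate_left_bdd: "left_bdd D u \<Longrightarrow> left_bdd D ((T ^^ n) u)"
  by (induction n) (auto intro: T_left_bdd)

text \<open>Iterating the Lipschitz condition produces precisely the iterated integrals
  \<open>iter_int\<close>. The constants depend on \<open>x\<close> but are uniform in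
  \<open>n\<close> and in \<open>t \<le> x\<close>, as the limit argument for the iterates
  requires.\<close>

lemma iterate_diff_bound:
  assumes u: "left_bdd D u" and v: "left_bdd D v" and x: "x \<in> D"
  obtains C m where "C \<ge> 0" "m \<ge> 0"
    "\<And>n t. t \<le> x \<Longrightarrow> norm ((T ^^ n) u t - (T ^^ n) v t) \<le> C * (m ^ n / fact n)"
proof -
  \<comment> \<open>\<open>\<omega>\<close> may have infinite total mass. Its restriction to
    \<open>{..<x}\<close> is finite and gives the same integrals at all
    \<open>t \<le> x\<close>.\<close>
  define M where "M = density \<omega> (indicator {..<x})"
  have s [simp]: "sets M = sets borel" by (simp add: M_def sets_\<omega>)
  have [simp]: "space M = UNIV" using sets_eq_imp_space_eq[OF s] by simp
  have Mx: "emeasure M UNIV = emeasure \<omega> {..<x}"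
    unfolding M_def using sets_\<omega> sets_eq_imp_space_eq[OF sets_\<omega>] by (subst emeasure_density) auto
  have M: "finite_measure M"
    by (rule finite_measureI) (use finite_\<omega>[OF x] Mx in auto)
  note iter_int_measurable[OF M s, measurable]
  note [measurable_cong] = sets_\<omega>
  obtain Cu Cv where Cu: "\<And>t. t \<le> x \<Longrightarrow> norm (u t) \<le> Cu" and Cv: "\<And>t. t \<le> x \<Longrightarrow> norm (v t) \<le> Cv"
    using u v x unfolding left_bdd_def by blast
  define C where "C = Cu + Cv"
  have "0 \<le> Cu" "0 \<le> Cv" using Cu[of x] Cv[of x] by (auto intro: order_trans[OF norm_ge_zero])
  then have C0: "C \<ge> 0" by (simp add: C_def)
  have key: "ennreal (norm ((T ^^ n) u t - (T ^^ n) v t)) \<le> ennreal C * ennreal q ^ n * iter_int M n t" if "t \<le> x" for n t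
    using that
  proof (induction n arbitrary: t)
    case 0
    then show ?case using Cu[of t] Cv[of t] norm_triangle_ineq4[of "u t" "v t"] by (simp add: C_def ennreal_leI)
  next
    case (Suc n)
    show ?case
    proof (cases "t \<in> D")
      case True
      have "ennreal (norm (T ((T ^^ n) u) t - T ((T ^^ n) v) t))
        \<le> ennreal q * (\<integral>\<^sup>+s. (if s < t then ennreal (norm ((T ^^ n) u s - (T ^^ n) v s)) else 0) \<partial>\<omega>)"
        by (intro T_lipschitz iterate_left_bdd u v True)
      also have "\<dots> \<le> ennreal q * (\<integral>\<^sup>+s. (if s < t then ennreal C * ennreal q ^ n * iter_int M n s else 0) \<partial>\<omega>)"
        using Suc by (intro mult_left_mono nn_integral_mono) auto
      also have "(\<integral>\<^sup>+s. (if s < t then ennreal C * ennreal q ^ n * iter_int M n s else 0) \<partial>\<omega>)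
         = (\<integral>\<^sup>+s. indicator {..<x} s * (ennreal C * ennreal q ^ n * (if s < t then iter_int M n s else 0)) \<partial>\<omega>)"
        using Suc.prems by (intro nn_integral_cong) (auto simp: indicator_def)
      also have "\<dots> = (\<integral>\<^sup>+s. (ennreal C * ennreal q ^ n * (if s < t then iter_int M n s else 0)) \<partial>M)"
        (is "nn_integral \<omega> (\<lambda>s. _ * ?h s) = _")
      proof -
        have "?h \<in> borel_measurable \<omega>" by measurable
        then show ?thesis by (subst (2) M_def, subst nn_integral_density) (auto simp: sets_\<omega>)
      qed
      also have "\<dots> = ennreal C * ennreal q ^ n * iter_int M (Suc n) t"
        by (subst nn_integral_cmult) (auto cong: measurable_cong_sets)
      finally show ?thesis by (simp add: mult_ac)
    next
      case False
      then show ?thesis by (simp add: T_outside)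
    qed
  qed
  show thesis
  proof (rule that)
    show "0 \<le> C" "0 \<le> q * measure M UNIV" using C0 q_nonneg by auto
    fix n t assume "t \<le> x"
    have "ennreal (norm ((T ^^ n) u t - (T ^^ n) v t)) \<le> ennreal C * ennreal q ^ n * iter_int M n t"
      by (rule key) fact
    also have "\<dots> \<le> ennreal C * ennreal q ^ n * ennreal (measure M UNIV ^ n / fact n)"
      by (intro mult_left_mono iter_int_le_real[OF M s]) simp
    also have "\<dots> = ennreal (C * ((q * measure M UNIV) ^ n / fact n))"
      using C0 q_nonneg by (simp add: ennreal_power ennreal_mult'[symmetric] power_mult_distrib mult.assoc)
    finally show "norm ((T ^^ n) u t - (T ^^ n) v t) \<le> C * ((q * measure M UNIV) ^ n / fact n)"
      using C0 q_nonneg by (subst (asm) ennreal_le_iff) auto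
  qed
qed

lemma summable_exp_bound: "summable (\<lambda>n. C * (m ^ n / fact n :: real))"
  using summable_exp[of m] by (intro summable_mult) (simp add: field_simps)

text \<open>Fixed points equal all their iterates, so their distance lies below every term of an
  exponential series, and these terms tend to 0.\<close>

lemma fixpoint_unique:
  assumes u: "left_bdd D u" "T u = u" and v: "left_bdd D v" "T v = v"
  shows "u = v"
proof
  fix x
  show "u x = v x"
  proof (cases "x \<in> D")
    case True
    obtain C m where Cm: "C \<ge> 0" "m \<ge> 0"
      "\<And>n t. t \<le> x \<Longrightarrow> norm ((T ^^ n) u t - (T ^^ n) v t) \<le> C * (m ^ n / fact n)"
      by (rule iterate_diff_bound[OF u(1) v(1) True]) (rule that; assumption)
    have "(T ^^ n) u = u" "(T ^^ n) v = v" for n by (induction n) (simp_all add: u v)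
    then have "norm (u x - v x) \<le> C * (m ^ n / fact n)" for n using Cm(3)[of x n] by simp
    moreover have "(\<lambda>n. C * (m ^ n / fact n)) \<longlonglongrightarrow> 0"
      by (rule summable_LIMSEQ_zero[OF summable_exp_bound])
    ultimately have "norm (u x - v x) \<le> 0" by (intro LIMSEQ_le_const) auto
    then show ?thesis by simp
  next
    case False
    then show ?thesis using T_outside[OF False, of u] T_outside[OF False, of v] u v by simp
  qed
qed

lemma fixpoint_exists:
  obtains u where "left_bdd D u" "T u = u"
proof -
  have z: "left_bdd D (\<lambda>_. 0 :: 'a)" by (auto simp: left_bdd_def)
  define U where "U n = (T ^^ n) (\<lambda>_. 0)" for n
  have U_bdd: "left_bdd D (U n)" for n unfolding U_def by (rule iterate_left_bdd[OF z])
  have U_Suc: "U (Suc n) = T (U n)" for n by (simp add: U_def)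
  \<comment> \<open>The \<open>U n\<close> are the partial sums of \<open>W\<close>, and
    \<open>W n\<close> is the difference of the \<open>n\<close>-th iterates started at the image of
    0 under \<open>T\<close> and at 0. The general bound thus makes the series summable.\<close>
  define W where "W n t = U (Suc n) t - U n t" for n t
  have W_bound: "\<exists>C m. \<forall>n t. t \<le> x \<longrightarrow> norm (W n t) \<le> C * (m ^ n / fact n)" if x: "x \<in> D" for x
  proof -
    obtain C m where "C \<ge> 0" "m \<ge> 0" and Cm:
      "\<And>n t. t \<le> x \<Longrightarrow> norm ((T ^^ n) (T (\<lambda>_. 0)) t - (T ^^ n) (\<lambda>_. 0) t) \<le> C * (m ^ n / fact n)"
      by (rule iterate_diff_bound[OF T_left_bdd[OF z] z x]) (rule that; assumption)
    have "W n t = (T ^^ n) (T (\<lambda>_. 0)) t - (T ^^ n) (\<lambda>_. 0) t" for n t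
      unfolding W_def U_def by (simp add: funpow_swap1)
    with Cm show ?thesis by auto
  qed
  define u where "u t = (\<Sum>n. W n t)" for t
  have U_sum: "U n t = (\<Sum>k<n. W k t)" for n t
    unfolding W_def by (induction n) (auto simp: U_def)
  have W_out: "W n t = 0" if "t \<notin> D" for n t
    unfolding W_def U_Suc using that by (cases n) (auto simp: T_outside U_def)
  \<comment> \<open>Pointwise convergence is not enough: the Lipschitz condition at \<open>x\<close>
    integrates the error over all \<open>t < x\<close>, so the remainder must be uniform
    there.\<close>
  have unif: "\<exists>r. r \<longlonglongrightarrow> 0 \<and> (\<forall>n t. t \<le> x \<longrightarrow> norm (u t - U n t) \<le> r n)" if x: "x \<in> D" for x
  proof -
    obtain C m where Cm: "\<And>n t. t \<le> x \<Longrightarrow> norm (W n t) \<le> C * (m ^ n / fact n)"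
      using W_bound[OF x] by blast
    let ?a = "\<lambda>n. C * (m ^ n / fact n)"
    have "norm (u t - U n t) \<le> (\<Sum>k. ?a (k + n))" if t: "t \<le> x" for n t
    proof -
      have sn: "summable (\<lambda>k. norm (W k t))"
        by (rule summable_comparison_test'[OF summable_exp_bound[of C m]]) (use Cm[OF t] in simp)
      then have sW: "summable (\<lambda>k. W k t)" by (rule summable_norm_cancel)
      have "u t - U n t = (\<Sum>k. W (k + n) t)"
        unfolding u_def U_sum using suminf_minus_initial_segment[OF sW, of n] by simp
      also have "norm \<dots> \<le> (\<Sum>k. norm (W (k + n) t))"
        by (rule summable_norm) (rule summable_ignore_initial_segment[OF sn])
      also have "\<dots> \<le> (\<Sum>k. ?a (k + n))"
        by (intro suminf_le Cm[OF t]) (rule summable_ignore_initial_segment[OF sn] summable_ignore_initial_segment[OF summable_exp_bound])+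
      finally show ?thesis .
    qed
    moreover have "(\<lambda>n. \<Sum>k. ?a (k + n)) \<longlonglongrightarrow> 0"
      by (rule suminf_exist_split2[OF summable_exp_bound])
    ultimately show ?thesis by (intro exI[of _ "\<lambda>n. \<Sum>k. ?a (k + n)"]) auto
  qed
  have lim: "(\<lambda>n. U n t) \<longlonglongrightarrow> u t" for t
  proof (cases "t \<in> D")
    case True
    from unif[OF this] obtain r where r: "r \<longlonglongrightarrow> 0" "\<And>n. norm (u t - U n t) \<le> r n" by auto
    show ?thesis
    proof (rule LIM_zero_cancel, rule Lim_null_comparison[OF _ r(1)])
      show "\<forall>\<^sub>F n in sequentially. norm (U n t - u t) \<le> r n"
        using r(2) by (simp add: norm_minus_commute)
    qed
  next
    case False
    then show ?thesis by (simp add: U_sum u_def W_out)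
  qed
  have u_bdd: "left_bdd D u"
    unfolding left_bdd_def
  proof (intro conjI ballI)
    show "u \<in> borel_measurable borel"
      by (rule borel_measurable_LIMSEQ_metric[OF _ lim]) (use U_bdd in \<open>auto simp: left_bdd_def\<close>)
    fix x assume "x \<in> D"
    from unif[OF this] obtain r where r: "\<And>n t. t \<le> x \<Longrightarrow> norm (u t - U n t) \<le> r n" by auto
    have "norm (u t) \<le> r 0" if "t \<le> x" for t using r[OF that, of 0] by (simp add: U_def)
    then show "\<exists>C. \<forall>t\<le>x. norm (u t) \<le> C" by auto
  qed
  have "T u x = u x" for x
  proof (cases "x \<in> D")
    case True
    from unif[OF this] obtain r where r: "r \<longlonglongrightarrow> 0" "\<And>n t. t \<le> x \<Longrightarrow> norm (u t - U n t) \<le> r n" by auto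
    define K where "K = measure \<omega> {..<x}"
    have K: "emeasure \<omega> {..<x} = ennreal K"
      using finite_\<omega>[OF True] by (simp add: K_def emeasure_eq_ennreal_measure)
    have r0: "0 \<le> r n" for n using r(2)[of x n] by (auto intro: order_trans[OF norm_ge_zero])
    \<comment> \<open>\<open>U (Suc n)\<close> is \<open>T (U n)\<close>, so the uniform error
      \<open>r n\<close> is integrated over the finite mass \<open>K\<close> below
      \<open>x\<close>.\<close>
    have "norm (T u x - U (Suc n) x) \<le> q * (r n * K)" for n
    proof -
      have "ennreal (norm (T u x - T (U n) x)) \<le> ennreal q * (\<integral>\<^sup>+t. (if t < x then ennreal (norm (u t - U n t)) else 0) \<partial>\<omega>)"
        by (rule T_lipschitz[OF u_bdd U_bdd True])
      also have "\<dots> \<le> ennreal q * (\<integral>\<^sup>+t. ennreal (r n) * indicator {..<x} t \<partial>\<omega>)"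
        by (intro mult_left_mono nn_integral_mono) (auto intro!: ennreal_leI r(2))
      also have "\<dots> = ennreal (q * (r n * K))"
        using r0 q_nonneg by (subst nn_integral_cmult_indicator)
          (auto simp: sets_\<omega> K ennreal_mult' K_def)
      finally show ?thesis
        unfolding U_Suc using r0 q_nonneg by (subst (asm) ennreal_le_iff) (auto simp: K_def)
    qed
    then have "\<forall>\<^sub>F n in sequentially. norm (U (Suc n) x - T u x) \<le> q * (r n * K)"
      by (simp add: norm_minus_commute)
    moreover have "(\<lambda>n. q * (r n * K)) \<longlonglongrightarrow> 0"
      using tendsto_mult_right_zero[OF tendsto_mult_left_zero[OF r(1)]] by simp
    ultimately have "(\<lambda>n. U (Suc n) x - T u x) \<longlonglongrightarrow> 0"
      by (rule Lim_null_comparison)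
    then have "(\<lambda>n. U (Suc n) x) \<longlonglongrightarrow> T u x"
      by (rule LIM_zero_cancel)
    then show ?thesis using LIMSEQ_Suc[OF lim[of x]] by (rule LIMSEQ_unique)
  next
    case False
    then show ?thesis by (simp add: T_outside u_def W_out)
  qed
  then have "T u = u" by auto
  with u_bdd that show thesis by blast
qed

end

subsection \<open>The first order system\<close>

text \<open>Local boundedness is the one condition that gives local integrability against all three
  measures at once. Functions of the form constant plus \<open>cint\<close> have it.\<close>

definition loc_bdd :: "ereal \<Rightarrow> ereal \<Rightarrow> (real \<Rightarrow> complex) \<Rightarrow> bool" where
  "loc_bdd a b f \<longleftrightarrow> set_borel_measurable borel (ival a b) f
     \<and> (\<forall>x\<in>ival a b. \<forall>y\<in>ival a b. \<exists>C. \<forall>t\<in>{x..y}. cmod (f t) \<le> C)"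

lemma loc_bdd_locL1:
  assumes "loc_bdd a b f" "lfcm a b \<mu>"
  shows "locL1 a b \<mu> f"
  unfolding locL1_def
proof (intro allI impI)
  fix x y assume xy: "{x..y} \<subseteq> ival a b"
  obtain C where C: "\<forall>t\<in>{x..y}. cmod (f t) \<le> C"
    using xy assms(1) unfolding loc_bdd_def ival_Icc_subset_iff by (metis atLeastAtMost_iff not_le order_trans)
  show "set_integrable (cvar \<mu>) {x..y} f"
    by (rule set_integrable_bounded[OF assms(2), where C=C])
      (use assms(1) C xy lfcm_finite_Icc[OF assms(2) xy] in \<open>auto simp: loc_bdd_def\<close>)
qed

lemma set_borel_measurable_combine:
  fixes f g :: "real \<Rightarrow> complex"
  assumes f: "set_borel_measurable borel A f" and g: "set_borel_measurable borel A g"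
  shows set_borel_measurable_add: "set_borel_measurable borel A (\<lambda>x. f x + g x)"
    and set_borel_measurable_diff: "set_borel_measurable borel A (\<lambda>x. f x - g x)"
    and set_borel_measurable_cmult: "set_borel_measurable borel A (\<lambda>x. z * f x)"
    and set_borel_measurable_cnj: "set_borel_measurable borel A (\<lambda>x. cnj (f x))"
proof -
  note m = f[unfolded set_borel_measurable_def] g[unfolded set_borel_measurable_def]
  have "(\<lambda>x. indicat_real A x *\<^sub>R f x + indicat_real A x *\<^sub>R g x) \<in> borel_measurable borel"
     "(\<lambda>x. indicat_real A x *\<^sub>R f x - indicat_real A x *\<^sub>R g x) \<in> borel_measurable borel"
     "(\<lambda>x. z * (indicat_real A x *\<^sub>R f x)) \<in> borel_measurable borel"
     "(\<lambda>x. cnj (indicat_real A x *\<^sub>R f x)) \<in> borel_measurable borel"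
    by (intro borel_measurable_add borel_measurable_diff borel_measurable_times m borel_measurable_const
       borel_measurable_continuous_on[OF _ m(1)] continuous_intros)+
  then show "set_borel_measurable borel A (\<lambda>x. f x + g x)"
    "set_borel_measurable borel A (\<lambda>x. f x - g x)" "set_borel_measurable borel A (\<lambda>x. z * f x)"
    "set_borel_measurable borel A (\<lambda>x. cnj (f x))"
    unfolding set_borel_measurable_def by (simp_all add: algebra_simps)
qed

lemma loc_bdd_combine:
  assumes f: "loc_bdd a b f" and g: "loc_bdd a b g"
  shows loc_bdd_add: "loc_bdd a b (\<lambda>x. f x + g x)"
    and loc_bdd_diff: "loc_bdd a b (\<lambda>x. f x - g x)"
    and loc_bdd_cmult: "loc_bdd a b (\<lambda>x. z * f x)"
    and loc_bdd_cnj: "loc_bdd a b (\<lambda>x. cnj (f x))"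
proof -
  note m = set_borel_measurable_combine
  have bd: "\<exists>C1 C2. \<forall>t\<in>{x..y}. cmod (f t) \<le> C1 \<and> cmod (g t) \<le> C2" if "x \<in> ival a b" "y \<in> ival a b" for x y
    using f g that unfolding loc_bdd_def by meson
  show "loc_bdd a b (\<lambda>x. f x + g x)"
    unfolding loc_bdd_def
  proof (intro conjI ballI)
    fix x y assume "x \<in> ival a b" "y \<in> ival a b"
    from bd[OF this] obtain C1 C2 where "\<forall>t\<in>{x..y}. cmod (f t) \<le> C1 \<and> cmod (g t) \<le> C2" by auto
    then show "\<exists>C. \<forall>t\<in>{x..y}. cmod (f t + g t) \<le> C"
      by (intro exI[of _ "C1 + C2"]) (auto intro: norm_add_rule_thm)
  qed (use f g m in \<open>auto simp: loc_bdd_def\<close>)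
  show "loc_bdd a b (\<lambda>x. f x - g x)"
    unfolding loc_bdd_def
  proof (intro conjI ballI)
    fix x y assume "x \<in> ival a b" "y \<in> ival a b"
    from bd[OF this] obtain C1 C2 where "\<forall>t\<in>{x..y}. cmod (f t) \<le> C1 \<and> cmod (g t) \<le> C2" by auto
    then show "\<exists>C. \<forall>t\<in>{x..y}. cmod (f t - g t) \<le> C"
      by (intro exI[of _ "C1 + C2"]) (auto intro: order_trans[OF norm_triangle_ineq4 add_mono])
  qed (use f g m in \<open>auto simp: loc_bdd_def\<close>)
  show "loc_bdd a b (\<lambda>x. z * f x)"
    unfolding loc_bdd_def
  proof (intro conjI ballI)
    fix x y assume "x \<in> ival a b" "y \<in> ival a b"
    from bd[OF this] obtain C1 C2 where "\<forall>t\<in>{x..y}. cmod (f t) \<le> C1 \<and> cmod (g t) \<le> C2" by auto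
    then show "\<exists>C. \<forall>t\<in>{x..y}. cmod (z * f t) \<le> C"
      by (intro exI[of _ "cmod z * C1"]) (auto simp: norm_mult intro: mult_left_mono)
  qed (use f g m in \<open>auto simp: loc_bdd_def\<close>)
  show "loc_bdd a b (\<lambda>x. cnj (f x))"
    using f m(4)[of "ival a b" f f] unfolding loc_bdd_def by auto
qed

lemma loc_bdd_const: "loc_bdd a b (\<lambda>_. k)"
  by (auto simp: loc_bdd_def set_borel_measurable_def)

lemma loc_bdd_cong:
  assumes "\<And>x. x \<in> ival a b \<Longrightarrow> f x = g x"
  shows "loc_bdd a b f \<longleftrightarrow> loc_bdd a b g"
proof -
  have "(\<lambda>x. indicat_real (ival a b) x *\<^sub>R f x) = (\<lambda>x. indicat_real (ival a b) x *\<^sub>R g x)"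
    using assms by (auto simp: fun_eq_iff indicator_def)
  moreover have "(\<forall>t\<in>{x..y}. cmod (f t) \<le> C) \<longleftrightarrow> (\<forall>t\<in>{x..y}. cmod (g t) \<le> C)"
    if "x \<in> ival a b" "y \<in> ival a b" for x y C
    using assms ival_Icc_subset[OF that] by (metis subsetD)
  ultimately show ?thesis
    unfolding loc_bdd_def set_borel_measurable_def by simp
qed

text \<open>The equation \<open>(\<tau> - z) f = g\<close> for the pair \<open>(f, p)\<close> with \<open>p\<close> the quasi-derivative,
  in integrated form. With \<open>I x y = {x..<y}\<close> the solutions are left-continuous, as in the definition
  of \<open>cint\<close>; \<open>I x y = {x<..y}\<close> gives their right-continuous versions.\<close>

definition isys :: "(real \<Rightarrow> real \<Rightarrow> real set) \<Rightarrow> ereal \<Rightarrow> ereal \<Rightarrow> cmeasure \<Rightarrow> cmeasure \<Rightarrow> cmeasure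
     \<Rightarrow> complex \<Rightarrow> (real \<Rightarrow> complex) \<Rightarrow> (real \<Rightarrow> complex) \<Rightarrow> (real \<Rightarrow> complex) \<Rightarrow> bool" where
  "isys I a b \<rho> \<sigma> chi z g f p \<longleftrightarrow> loc_bdd a b f \<and> loc_bdd a b p
     \<and> (\<forall>x\<in>ival a b. \<forall>y\<in>ival a b. x \<le> y \<longrightarrow>
          f y - f x = cmint \<sigma> (I x y) p
        \<and> p y - p x = cmint chi (I x y) f - cmint \<rho> (I x y) (\<lambda>t. z * f t + g t))"

subsection \<open>The left endpoint\<close>

lemma eventually_left_end:
  assumes "x0 \<in> ival a b"
  shows "eventually (\<lambda>x. x \<in> ival a b \<and> x < x0) (left_end a)"
proof (cases a)
  case (real r)
  have "eventually (\<lambda>x. x < x0) (at_right r)"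
    using assms real by (auto simp: ival_def eventually_at_right_field intro!: exI[of _ x0])
  moreover have "eventually (\<lambda>x. r < x) (at_right r)"
    by (simp add: eventually_at_right_less)
  ultimately have "eventually (\<lambda>x. x \<in> ival a b \<and> x < x0) (at_right r)"
    by eventually_elim (use assms real in \<open>auto simp: ival_def intro: less_trans[of _ "ereal x0"]\<close>)
  then show ?thesis by (simp add: left_end_def real)
next
  case MInf
  have "eventually (\<lambda>x. x < x0) at_bot" by (rule eventually_gt_at_bot)
  then have "eventually (\<lambda>x. x \<in> ival a b \<and> x < x0) at_bot"
    by eventually_elim (use assms MInf in \<open>auto simp: ival_def intro: less_trans[of _ "ereal x0"]\<close>)
  then show ?thesis by (simp add: left_end_def MInf)
qed (use assms in \<open>auto simp: ival_def\<close>)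

lemma left_end_neq_bot: "left_end a \<noteq> bot"
  by (simp add: left_end_def)

definition left_part :: "ereal \<Rightarrow> ereal \<Rightarrow> real \<Rightarrow> real set" where
  "left_part a b x = ival a b \<inter> {..<x}"

lemma left_part_borel [measurable]: "left_part a b x \<in> sets borel"
  by (simp add: left_part_def)

lemma left_part_subset: "left_part a b x \<subseteq> ival a b" "x \<le> y \<Longrightarrow> left_part a b x \<subseteq> left_part a b y"
  by (auto simp: left_part_def)

lemma left_part_split:
  "x \<in> ival a b \<Longrightarrow> y \<in> ival a b \<Longrightarrow> x \<le> y \<Longrightarrow> left_part a b y = left_part a b x \<union> {x..<y}"
  using ival_Icc_subset[of x a b y] by (auto simp: left_part_def)

text \<open>Continuity from above of the finite measure with density \<open>cmod (h t)\<close>,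
  along intervals \<open>(a, e i)\<close> that shrink to the empty set. Monotonicity in
  \<open>x\<close> passes from the sequence to the filter \<open>left_end a\<close>.\<close>

lemma left_tail_norm:
  assumes \<mu>: "lfcm a b \<mu>" and d: "d \<in> ival a b" and h: "set_integrable (cvar \<mu>) (left_part a b d) h"
  shows "((\<lambda>x. LINT t:left_part a b x|cvar \<mu>. cmod (h t)) \<longlongrightarrow> 0) (left_end a)"
proof -
  note s = lfcm_sets[OF \<mu>]
  obtain l u :: "nat \<Rightarrow> real" where lu: "ival a b = (\<Union>i. {l i..u i})" "incseq u" "decseq l"
    "\<And>i. l i \<in> ival a b" "\<And>i. u i \<in> ival a b"
    by (rule ival_approx[OF ival_less[OF d]]) (rule that; assumption)
  \<comment> \<open>The minimum with \<open>d\<close> keeps all intervals within the one on which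
    \<open>h\<close> is integrable.\<close>
  define e where "e i = min d (l i)" for i
  have eD: "e i \<in> ival a b" for i using d lu(4)[of i] by (auto simp: e_def min_def)
  have dec: "decseq (\<lambda>i. left_part a b (e i))"
    unfolding decseq_def
    by (intro allI impI left_part_subset) (use lu(3) in \<open>auto simp: decseq_def e_def intro: min.coboundedI2\<close>)
  have empty: "(\<Inter>i. left_part a b (e i)) = {}"
  proof -
    have "\<exists>i. \<not> t < l i" if "t \<in> ival a b" for t
      using that unfolding lu(1) by (meson UN_E atLeastAtMost_iff not_less)
    then show ?thesis by (fastforce simp: left_part_def e_def)
  qed
  have "(\<lambda>i. LINT t:left_part a b (e i)|cvar \<mu>. cmod (h t)) \<longlonglongrightarrow> (LINT t:(\<Inter>i. left_part a b (e i))|cvar \<mu>. cmod (h t))"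
  proof (rule set_integral_cont_down[OF _ dec])
    show "set_integrable (cvar \<mu>) (left_part a b (e 0)) (\<lambda>t. cmod (h t))"
      by (rule set_integrable_norm_complex, rule set_integrable_subset[OF h])
        (auto simp: s left_part_def e_def)
  qed (simp add: s)
  then have lim: "(\<lambda>i. LINT t:left_part a b (e i)|cvar \<mu>. cmod (h t)) \<longlonglongrightarrow> 0"
    unfolding empty by (simp add: set_lebesgue_integral_def)
  show ?thesis
  proof (rule tendstoI)
    fix \<epsilon> :: real assume "0 < \<epsilon>"
    from order_tendstoD(2)[OF lim this] obtain i where i: "(LINT t:left_part a b (e i)|cvar \<mu>. cmod (h t)) < \<epsilon>"
      by (auto simp: eventually_sequentially)
    have "eventually (\<lambda>x. x \<in> ival a b \<and> x < e i) (left_end a)"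
      by (rule eventually_left_end[OF eD])
    then show "eventually (\<lambda>x. dist (LINT t:left_part a b x|cvar \<mu>. cmod (h t)) 0 < \<epsilon>) (left_end a)"
    proof eventually_elim
      case (elim x)
      have "0 \<le> (LINT t:left_part a b x|cvar \<mu>. cmod (h t))"
        by (simp add: set_lebesgue_integral_def)
      moreover have "(LINT t:left_part a b x|cvar \<mu>. cmod (h t)) \<le> (LINT t:left_part a b (e i)|cvar \<mu>. cmod (h t))"
        by (rule set_integral_norm_mono_set, rule set_integrable_subset[OF h])
          (use elim in \<open>auto simp: s left_part_def e_def\<close>)
      ultimately show ?case using i by (simp add: dist_real_def)
    qed
  qed
qed

lemma left_tail:
  assumes "lfcm a b \<mu>" "d \<in> ival a b" "set_integrable (cvar \<mu>) (left_part a b d) h"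
  shows "((\<lambda>x. cmint \<mu> (left_part a b x) h) \<longlongrightarrow> 0) (left_end a)"
  by (rule Lim_null_comparison[OF _ left_tail_norm[OF assms]])
    (auto intro!: always_eventually cmint_norm_le[OF assms(1)])

text \<open>Regularity at \<open>a\<close> for a single measure, already in the form "for every
  point"; the passage from "for some point" is made once, at the end.\<close>

definition lfin :: "ereal \<Rightarrow> ereal \<Rightarrow> cmeasure \<Rightarrow> bool" where
  "lfin a b \<mu> \<longleftrightarrow> lfcm a b \<mu> \<and> (\<forall>x\<in>ival a b. emeasure (cvar \<mu>) (left_part a b x) < \<infinity>)"

lemma lfin_emeasure_lessThan:
  assumes "lfin a b \<mu>" "x \<in> ival a b"
  shows "emeasure (cvar \<mu>) {..<x} < \<infinity>"
proof -
  have \<mu>: "lfcm a b \<mu>" using assms by (simp add: lfin_def)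
  have "emeasure (cvar \<mu>) {..<x} = emeasure (cvar \<mu>) (left_part a b x)"
    by (rule emeasure_eq_AE)
      (use lfcm_AE_ival[OF \<mu>] in \<open>auto simp: left_part_def lfcm_sets[OF \<mu>]\<close>)
  then show ?thesis using assms by (simp add: lfin_def)
qed

lemma lfin_integrable:
  assumes "lfin a b \<mu>" "x \<in> ival a b" "set_borel_measurable borel (ival a b) h"
    "\<And>t. t \<in> left_part a b x \<Longrightarrow> cmod (h t) \<le> C"
  shows "set_integrable (cvar \<mu>) (left_part a b x) h"
  by (rule set_integrable_bounded[where C=C])
    (use assms left_part_subset(1)[of a b x] in \<open>auto simp: lfin_def\<close>)

lemma left_tail_measure:
  assumes "lfin a b \<mu>" "d \<in> ival a b"
  shows "((\<lambda>x. measure (cvar \<mu>) (left_part a b x)) \<longlongrightarrow> 0) (left_end a)"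
proof -
  have \<mu>: "lfcm a b \<mu>" using assms by (simp add: lfin_def)
  have "((\<lambda>x. LINT t:left_part a b x|cvar \<mu>. cmod 1) \<longlongrightarrow> 0) (left_end a)"
    by (rule left_tail_norm[OF \<mu> assms(2)], rule lfin_integrable[OF assms, where C=1])
      (auto simp: set_borel_measurable_def)
  then show ?thesis
    by (simp add: set_lebesgue_integral_def lfcm_sets[OF \<mu>] lfcm_space[OF \<mu>])
qed

text \<open>The supremum of two measures evaluates \<open>X\<close> by splitting it in two and
  measuring each piece with one of them; each piece is then enlarged to \<open>X\<close>.\<close>

lemma emeasure_sup_le_add:
  assumes "sets A = sets borel" "sets B = sets borel"
  shows "emeasure (sup A B) X \<le> emeasure A X + emeasure B X"
proof (cases "X \<in> sets borel")
  case True
  have *: "sup A B = sup_measure' A B"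
    using assms sets_eq_imp_space_eq[OF assms(1)] sets_eq_imp_space_eq[OF assms(2)]
    by (simp add: sup_measure_def sup_lexord1)
  show ?thesis
    unfolding * by (subst emeasure_sup_measure')
      (use True assms in \<open>auto intro!: SUP_least add_mono emeasure_mono\<close>)
next
  case False
  then show ?thesis using sets_sup[of A borel B] assms by (simp add: emeasure_notin_sets)
qed

section \<open>The Volterra operator for prescribed limits at the left endpoint\<close>

locale left_regular =
  fixes a b :: ereal and \<rho> \<sigma> chi :: cmeasure and z :: complex and g :: "real \<Rightarrow> complex"
  assumes ab: "a < b" and \<rho>: "lfin a b \<rho>" and \<sigma>: "lfin a b \<sigma>" and chi: "lfin a b chi"
    and g_loc: "locL1 a b \<rho> g"
    and g: "d \<in> ival a b \<Longrightarrow> set_integrable (cvar \<rho>) (left_part a b d) g"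
begin

abbreviation "D \<equiv> ival a b"
abbreviation "L \<equiv> left_part a b"

lemma lfcms: "lfcm a b \<rho>" "lfcm a b \<sigma>" "lfcm a b chi"
  using \<rho> \<sigma> chi by (simp_all add: lfin_def)

lemma g_measurable: "set_borel_measurable borel D g"
  by (rule locL1_set_borel_measurable[OF g_loc lfcms(1) ab])

text \<open>The system integrated from \<open>a\<close> with \<open>d1\<close> and \<open>d2\<close>
  as boundary values. Taking pairs as values makes it one equation in a Banach space, and the value
  0 off \<open>D\<close> is the one the abstract setting prescribes.\<close>

definition volterra_op :: "complex \<Rightarrow> complex \<Rightarrow> (real \<Rightarrow> complex \<times> complex) \<Rightarrow> real \<Rightarrow> complex \<times> complex" where
  "volterra_op d1 d2 u x = (if x \<in> D then (d1 + cmint \<sigma> (L x) (\<lambda>t. snd (u t)),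
     d2 + cmint chi (L x) (\<lambda>t. fst (u t)) - cmint \<rho> (L x) (\<lambda>t. z * fst (u t) + g t)) else 0)"

lemma left_bdd_components:
  fixes u :: "real \<Rightarrow> complex \<times> complex"
  assumes "left_bdd D u"
  shows "set_borel_measurable borel D (\<lambda>t. fst (u t))"
    "set_borel_measurable borel D (\<lambda>t. snd (u t))"
    "x \<in> D \<Longrightarrow> \<exists>C. \<forall>t\<le>x. cmod (fst (u t)) \<le> C \<and> cmod (snd (u t)) \<le> C"
proof -
  have u: "u \<in> borel_measurable borel" using assms by (simp add: left_bdd_def)
  have "(\<lambda>t. fst (u t)) \<in> borel_measurable borel" "(\<lambda>t. snd (u t)) \<in> borel_measurable borel"
    by (rule borel_measurable_continuous_on[OF _ u]; intro continuous_intros)+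
  then show "set_borel_measurable borel D (\<lambda>t. fst (u t))" "set_borel_measurable borel D (\<lambda>t. snd (u t))"
    unfolding set_borel_measurable_def by measurable
  show "\<exists>C. \<forall>t\<le>x. cmod (fst (u t)) \<le> C \<and> cmod (snd (u t)) \<le> C" if "x \<in> D"
  proof -
    obtain C where C: "\<And>t. t \<le> x \<Longrightarrow> norm (u t) \<le> C"
      using assms \<open>x \<in> D\<close> unfolding left_bdd_def by blast
    have "cmod (fst (u t)) \<le> C \<and> cmod (snd (u t)) \<le> C" if "t \<le> x" for t
      using C[OF that] norm_fst_le[of "fst (u t)" "snd (u t)"] norm_snd_le[of "snd (u t)" "fst (u t)"] by simp
    then show ?thesis by auto
  qed
qed

lemma left_bdd_integrable:
  fixes u :: "real \<Rightarrow> complex \<times> complex"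
  assumes "left_bdd D u" "x \<in> D" "lfin a b \<mu>"
  shows "set_integrable (cvar \<mu>) (L x) (\<lambda>t. fst (u t))"
    "set_integrable (cvar \<mu>) (L x) (\<lambda>t. snd (u t))"
proof -
  obtain C where C: "\<forall>t\<le>x. cmod (fst (u t)) \<le> C \<and> cmod (snd (u t)) \<le> C"
    using left_bdd_components(3)[OF assms(1,2)] by auto
  show "set_integrable (cvar \<mu>) (L x) (\<lambda>t. fst (u t))" "set_integrable (cvar \<mu>) (L x) (\<lambda>t. snd (u t))"
    by (rule lfin_integrable[OF assms(3,2), where C=C];
        use C left_bdd_components(1,2)[OF assms(1)] in \<open>auto simp: left_part_def\<close>)+
qed

lemma left_bdd_rhs_integrable:
  fixes u :: "real \<Rightarrow> complex \<times> complex"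
  assumes "left_bdd D u" "x \<in> D"
  shows "set_integrable (cvar \<rho>) (L x) (\<lambda>t. z * fst (u t) + g t)"
  using left_bdd_integrable(1)[OF assms \<rho>] g[OF assms(2)] by auto

lemma left_part_pred: "Measurable.pred (borel \<Otimes>\<^sub>M borel) (\<lambda>(x,t). t \<in> D \<and> t < (x::real))"
  by measurable

lemma left_part_Collect: "L x = {t. t \<in> D \<and> t < x}"
  by (auto simp: left_part_def)

lemma cmint_left_measurable:
  assumes "lfcm a b \<mu>" "set_borel_measurable borel D h"
  shows "(\<lambda>x. cmint \<mu> (L x) h) \<in> borel_measurable borel"
  unfolding left_part_Collect
  by (rule cmint_param_measurable[OF assms(1) ab assms(2) left_part_pred]) auto

lemma volterra_op_left_bdd:
  fixes u :: "real \<Rightarrow> complex \<times> complex"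
  assumes u: "left_bdd D u"
  shows "left_bdd D (volterra_op d1 d2 u)"
  unfolding left_bdd_def
proof (intro conjI ballI)
  note c = left_bdd_components(1,2)[OF u]
  have [measurable]: "(\<lambda>x. cmint \<sigma> (L x) (\<lambda>t. snd (u t))) \<in> borel_measurable borel"
     "(\<lambda>x. cmint chi (L x) (\<lambda>t. fst (u t))) \<in> borel_measurable borel"
     "(\<lambda>x. cmint \<rho> (L x) (\<lambda>t. z * fst (u t) + g t)) \<in> borel_measurable borel"
    by (rule cmint_left_measurable[OF lfcms(2) c(2)] cmint_left_measurable[OF lfcms(3) c(1)]
      cmint_left_measurable[OF lfcms(1) set_borel_measurable_add[OF set_borel_measurable_cmult[OF c(1) c(1)] g_measurable]])+
  have "(\<lambda>x. if x \<in> D then (d1 + cmint \<sigma> (L x) (\<lambda>t. snd (u t)),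
     d2 + cmint chi (L x) (\<lambda>t. fst (u t)) - cmint \<rho> (L x) (\<lambda>t. z * fst (u t) + g t)) else 0) \<in> borel_measurable borel"
    by measurable
  then show "volterra_op d1 d2 u \<in> borel_measurable borel"
    by (simp add: volterra_op_def[abs_def])
  fix x assume x: "x \<in> D"
  \<comment> \<open>Integrals of the norms over all of \<open>L x\<close> dominate the integrals
    over \<open>L t\<close> for every \<open>t \<le> x\<close> at once.\<close>
  define C where "C = (cmod d1 + (LINT t:L x|cvar \<sigma>. cmod (snd (u t)))) + (cmod d2
    + (LINT t:L x|cvar chi. cmod (fst (u t))) + (LINT t:L x|cvar \<rho>. cmod (z * fst (u t) + g t)))"
  have "norm (volterra_op d1 d2 u t) \<le> C" if t: "t \<le> x" for t
  proof (cases "t \<in> D")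
    case True
    have b: "cmod (cmint \<mu> (L t) h) \<le> (LINT t:L x|cvar \<mu>. cmod (h t))"
      if "lfcm a b \<mu>" "set_integrable (cvar \<mu>) (L x) h" for \<mu> h
      by (rule cmint_norm_le_mono[OF that]) (use t left_part_subset in auto)
    have "norm (volterra_op d1 d2 u t) \<le> cmod (d1 + cmint \<sigma> (L t) (\<lambda>t. snd (u t))) +
       cmod (d2 + cmint chi (L t) (\<lambda>t. fst (u t)) - cmint \<rho> (L t) (\<lambda>t. z * fst (u t) + g t))"
      using True by (simp add: volterra_op_def norm_Pair_le)
    also have "\<dots> \<le> C"
      unfolding C_def
      by (intro add_mono order_trans[OF norm_triangle_ineq] order_trans[OF norm_triangle_ineq4] order_refl
         b lfcms left_bdd_integrable u x \<sigma> chi left_bdd_rhs_integrable)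
    finally show ?thesis .
  next
    case False
    have "0 \<le> C" unfolding C_def set_lebesgue_integral_def by (intro add_nonneg_nonneg integral_nonneg) auto
    then show ?thesis using False by (simp add: volterra_op_def)
  qed
  then show "\<exists>C. \<forall>t\<le>x. norm (volterra_op d1 d2 u t) \<le> C" by auto
qed

text \<open>A single measure dominating all three variations, so that one scalar iteration controls
  both components. Near \<open>a\<close> it is finite because it lies below their sum.\<close>

definition \<omega> :: "real measure" where
  "\<omega> = sup (cvar \<sigma>) (sup (cvar chi) (cvar \<rho>))"

lemma sets_cvar: "sets (cvar \<rho>) = sets borel" "sets (cvar \<sigma>) = sets borel" "sets (cvar chi) = sets borel"
  by (rule lfcm_sets, rule lfcms)+

lemma sets_inner_sup: "sets (sup (cvar chi) (cvar \<rho>)) = sets borel"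
  by (rule sets_sup) (simp_all add: sets_cvar)

lemma sets_\<omega>: "sets \<omega> = sets borel"
  unfolding \<omega>_def by (rule sets_sup) (simp_all add: sets_cvar sets_inner_sup)

lemma finite_\<omega>:
  assumes "x \<in> D" shows "emeasure \<omega> {..<x} < \<infinity>"
proof -
  have "emeasure \<omega> {..<x} \<le> emeasure (cvar \<sigma>) {..<x} + (emeasure (cvar chi) {..<x} + emeasure (cvar \<rho>) {..<x})"
    unfolding \<omega>_def
    by (intro order_trans[OF emeasure_sup_le_add] add_mono order_refl emeasure_sup_le_add)
      (simp_all add: sets_cvar sets_inner_sup)
  also have "\<dots> < \<infinity>"
    using lfin_emeasure_lessThan[OF \<rho> assms] lfin_emeasure_lessThan[OF \<sigma> assms] lfin_emeasure_lessThan[OF chi assms]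
    by simp
  finally show ?thesis .
qed

lemma nn_integral_le_\<omega>:
  "(\<integral>\<^sup>+t. h t \<partial>cvar \<sigma>) \<le> (\<integral>\<^sup>+t. h t \<partial>\<omega>)"
  "(\<integral>\<^sup>+t. h t \<partial>cvar chi) \<le> (\<integral>\<^sup>+t. h t \<partial>\<omega>)"
  "(\<integral>\<^sup>+t. h t \<partial>cvar \<rho>) \<le> (\<integral>\<^sup>+t. h t \<partial>\<omega>)"
  by (rule nn_integral_mono_measure;
      (simp only: sets_\<omega> sets_cvar | (simp add: \<omega>_def le_supI2)))+

text \<open>The inhomogeneity \<open>g\<close> and the boundary values cancel in the difference.
  What remains is one integral each against \<open>\<sigma>\<close> and \<open>chi\<close> and
  \<open>z\<close> times one against \<open>\<rho>\<close>, which gives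
  \<open>2 + cmod z\<close>.\<close>

lemma volterra_op_lipschitz:
  assumes u: "left_bdd D u" and v: "left_bdd D v" and x: "x \<in> D"
  shows "ennreal (norm (volterra_op d1 d2 u x - volterra_op d1 d2 v x))
    \<le> ennreal (2 + cmod z) * (\<integral>\<^sup>+t. (if t < x then ennreal (norm (u t - v t)) else 0) \<partial>\<omega>)"
proof -
  let ?N = "\<integral>\<^sup>+t. (if t < x then ennreal (norm (u t - v t)) else 0) \<partial>\<omega>"
  let ?f = "\<lambda>t. fst (u t) - fst (v t)" and ?p = "\<lambda>t. snd (u t) - snd (v t)"
  note i = left_bdd_integrable[OF u x] left_bdd_integrable[OF v x]
  have pw: "cmod (?f t) \<le> norm (u t - v t)" "cmod (?p t) \<le> norm (u t - v t)" for t
    using norm_fst_le[of "fst (u t - v t)" "snd (u t - v t)"] norm_snd_le[of "snd (u t - v t)" "fst (u t - v t)"]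
    unfolding prod.collapse by simp_all
  have nn: "ennreal (cmod (cmint \<mu> (L x) h)) \<le> ?N"
    if "lfcm a b \<mu>" "set_integrable (cvar \<mu>) (L x) h" "\<And>t. cmod (h t) \<le> norm (u t - v t)"
      "\<And>k. (\<integral>\<^sup>+t. k t \<partial>cvar \<mu>) \<le> (\<integral>\<^sup>+t. k t \<partial>\<omega>)" for \<mu> h
  proof -
    have "ennreal (cmod (cmint \<mu> (L x) h)) \<le> (\<integral>\<^sup>+t\<in>L x. ennreal (cmod (h t)) \<partial>cvar \<mu>)"
      by (rule cmint_norm_le_nn[OF that(1,2)])
    also have "\<dots> \<le> (\<integral>\<^sup>+t. (if t < x then ennreal (norm (u t - v t)) else 0) \<partial>cvar \<mu>)"
      by (intro nn_integral_mono) (auto simp: left_part_def indicator_def that(3) ennreal_leI)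
    also have "\<dots> \<le> ?N" by (rule that(4))
    finally show ?thesis .
  qed
  have e1: "cmint \<sigma> (L x) (\<lambda>t. snd (u t)) - cmint \<sigma> (L x) (\<lambda>t. snd (v t)) = cmint \<sigma> (L x) ?p"
    by (rule cmint_diff[OF lfcms(2) i(2)[OF \<sigma>] i(4)[OF \<sigma>], symmetric])
  have e2: "cmint chi (L x) (\<lambda>t. fst (u t)) - cmint chi (L x) (\<lambda>t. fst (v t)) = cmint chi (L x) ?f"
    by (rule cmint_diff[OF lfcms(3) i(1)[OF chi] i(3)[OF chi], symmetric])
  have e3: "cmint \<rho> (L x) (\<lambda>t. z * fst (u t) + g t) - cmint \<rho> (L x) (\<lambda>t. z * fst (v t) + g t) = z * cmint \<rho> (L x) ?f"
    by (subst cmint_diff[OF lfcms(1) left_bdd_rhs_integrable[OF u x] left_bdd_rhs_integrable[OF v x], symmetric])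
      (simp add: cmint_cmult[symmetric] algebra_simps)
  have "volterra_op d1 d2 u x - volterra_op d1 d2 v x = (cmint \<sigma> (L x) ?p, cmint chi (L x) ?f - z * cmint \<rho> (L x) ?f)"
    using x by (simp add: volterra_op_def e1[symmetric] e2[symmetric] e3[symmetric])
  then have "norm (volterra_op d1 d2 u x - volterra_op d1 d2 v x)
      \<le> cmod (cmint \<sigma> (L x) ?p) + (cmod (cmint chi (L x) ?f) + cmod z * cmod (cmint \<rho> (L x) ?f))"
    using norm_Pair_le[of "cmint \<sigma> (L x) ?p" "cmint chi (L x) ?f - z * cmint \<rho> (L x) ?f"]
      norm_triangle_ineq4[of "cmint chi (L x) ?f" "z * cmint \<rho> (L x) ?f"] by (simp add: norm_mult)
  then have "ennreal (norm (volterra_op d1 d2 u x - volterra_op d1 d2 v x))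
      \<le> ennreal (cmod (cmint \<sigma> (L x) ?p)) + (ennreal (cmod (cmint chi (L x) ?f)) + ennreal (cmod z) * ennreal (cmod (cmint \<rho> (L x) ?f)))"
    by (simp add: ennreal_leI ennreal_plus[symmetric] ennreal_mult'[symmetric] del: ennreal_plus)
  also have "\<dots> \<le> ?N + (?N + ennreal (cmod z) * ?N)"
    by (intro add_mono mult_left_mono nn lfcms set_integral_diff(1) i \<sigma> chi \<rho> pw nn_integral_le_\<omega>) auto
  also have "\<dots> = ennreal (2 + cmod z) * ?N"
    by (simp add: ennreal_plus distrib_right algebra_simps mult_2[symmetric])
  finally show ?thesis .
qed

sublocale volterra D \<omega> "2 + cmod z" "volterra_op d1 d2" for d1 d2
proof
  fix u v :: "real \<Rightarrow> complex \<times> complex" and x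
  assume "left_bdd D u" "left_bdd D v" "x \<in> D"
  then show "ennreal (norm (volterra_op d1 d2 u x - volterra_op d1 d2 v x))
    \<le> ennreal (2 + cmod z) * (\<integral>\<^sup>+t. (if t < x then ennreal (norm (u t - v t)) else 0) \<partial>\<omega>)"
    by (rule volterra_op_lipschitz)
qed (use sets_\<omega> finite_\<omega> volterra_op_left_bdd in \<open>auto simp: volterra_op_def[abs_def]\<close>)

end

section \<open>Solutions of the system as fixed points: boundedness, limits, uniqueness\<close>

context left_regular begin

abbreviation "lsys \<equiv> isys atLeastLessThan a b \<rho> \<sigma> chi z g"

text \<open>The system constrains \<open>f\<close> and \<open>p\<close> only on \<open>D\<close>;
  the cut-off selects the representative that can be a fixed point of
  \<open>volterra_op\<close>.\<close>

definition pair_on :: "(real \<Rightarrow> complex) \<Rightarrow> (real \<Rightarrow> complex) \<Rightarrow> real \<Rightarrow> complex \<times> complex" where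
  "pair_on f p x = (if x \<in> D then (f x, p x) else 0)"

lemma left_split_diff:
  assumes "lfcm a b \<mu>" "x \<in> D" "y \<in> D" "x \<le> y" "set_integrable (cvar \<mu>) (L y) h"
  shows "cmint \<mu> {x..<y} h = cmint \<mu> (L y) h - cmint \<mu> (L x) h"
proof -
  have L: "L y = L x \<union> {x..<y}" by (rule left_part_split) fact+
  have "cmint \<mu> (L y) h = cmint \<mu> (L x) h + cmint \<mu> {x..<y} h"
    unfolding L
  proof (rule cmint_Un[OF assms(1)])
    show "set_integrable (cvar \<mu>) (L x) h" "set_integrable (cvar \<mu>) {x..<y} h"
      by (rule set_integrable_subset[OF assms(5)]; use L lfcm_sets[OF assms(1)] in simp)+
  qed (auto simp: left_part_def)
  then show ?thesis by simp
qed

lemma eventually_left_end_le: "x0 \<in> D \<Longrightarrow> eventually (\<lambda>x. x \<in> D \<and> x \<le> x0) (left_end a)"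
  by (rule eventually_mono[OF eventually_left_end]) auto

lemma fixpoint_isys:
  assumes u: "left_bdd D u" and fp: "volterra_op d1 d2 u = u"
  shows "lsys (\<lambda>x. fst (u x)) (\<lambda>x. snd (u x))"
    "((\<lambda>x. fst (u x)) \<longlongrightarrow> d1) (left_end a)" "((\<lambda>x. snd (u x)) \<longlongrightarrow> d2) (left_end a)"
proof -
  note c = left_bdd_components[OF u] and i = left_bdd_integrable[OF u] and ri = left_bdd_rhs_integrable[OF u]
  have f: "fst (u x) = d1 + cmint \<sigma> (L x) (\<lambda>t. snd (u t))"
    and p: "snd (u x) = d2 + cmint chi (L x) (\<lambda>t. fst (u t)) - cmint \<rho> (L x) (\<lambda>t. z * fst (u t) + g t)"
    if "x \<in> D" for x
    using that fun_cong[OF fp, of x] by (auto simp: volterra_op_def prod_eq_iff)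
  show "lsys (\<lambda>x. fst (u x)) (\<lambda>x. snd (u x))"
    unfolding isys_def
  proof (intro conjI ballI impI)
    have "\<exists>C. \<forall>t\<in>{x..y}. cmod (fst (u t)) \<le> C" "\<exists>C. \<forall>t\<in>{x..y}. cmod (snd (u t)) \<le> C" if "y \<in> D" for x y
      using c(3)[OF that] by (meson atLeastAtMost_iff)+
    then show "loc_bdd a b (\<lambda>x. fst (u x))" "loc_bdd a b (\<lambda>x. snd (u x))"
      using c(1,2) by (auto simp: loc_bdd_def)
    fix x y assume x: "x \<in> D" and y: "y \<in> D" and xy: "x \<le> y"
    show "fst (u y) - fst (u x) = cmint \<sigma> {x..<y} (\<lambda>x. snd (u x))"
      using left_split_diff[OF lfcms(2) x y xy i(2)[OF y \<sigma>]] by (simp add: f[OF x] f[OF y])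
    show "snd (u y) - snd (u x) = cmint chi {x..<y} (\<lambda>x. fst (u x)) - cmint \<rho> {x..<y} (\<lambda>t. z * fst (u t) + g t)"
      using left_split_diff[OF lfcms(3) x y xy i(1)[OF y chi]] left_split_diff[OF lfcms(1) x y xy ri[OF y]]
      by (simp add: p[OF x] p[OF y])
  qed
  obtain e where e: "e \<in> D" using einterval_nonempty[OF ab] by (auto simp: ival_eq_einterval)
  note D_ev = eventually_left_end_le[OF e]
  have "((\<lambda>x. d1 + cmint \<sigma> (L x) (\<lambda>t. snd (u t))) \<longlongrightarrow> d1 + 0) (left_end a)"
    by (intro tendsto_add tendsto_const left_tail[OF lfcms(2) e i(2)[OF e \<sigma>]])
  then show "((\<lambda>x. fst (u x)) \<longlongrightarrow> d1) (left_end a)"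
    unfolding add_0_right
    by (rule Lim_transform_eventually) (use D_ev f in \<open>auto elim: eventually_mono\<close>)
  have "((\<lambda>x. d2 + cmint chi (L x) (\<lambda>t. fst (u t)) - cmint \<rho> (L x) (\<lambda>t. z * fst (u t) + g t)) \<longlongrightarrow> d2 + 0 - 0) (left_end a)"
    by (intro tendsto_add tendsto_diff tendsto_const left_tail[OF lfcms(3) e i(1)[OF e chi]] left_tail[OF lfcms(1) e ri[OF e]])
  then show "((\<lambda>x. snd (u x)) \<longlongrightarrow> d2) (left_end a)"
    unfolding add_0_right diff_0_right
    by (rule Lim_transform_eventually) (use D_ev p in \<open>auto elim: eventually_mono\<close>)
qed

theorem isys_exists:
  "\<exists>f p. lsys f p \<and> (f \<longlongrightarrow> d1) (left_end a) \<and> (p \<longlongrightarrow> d2) (left_end a)"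
proof -
  obtain u where "left_bdd D u" "volterra_op d1 d2 u = u" by (rule fixpoint_exists)
  from fixpoint_isys[OF this] show ?thesis by blast
qed

text \<open>Close to \<open>a\<close> all three measures are so small that the increments of \<open>(f, p)\<close> over
  \<open>[x, e)\<close> are at most half of its supremum over \<open>[x, e]\<close>, up to a constant.\<close>

lemma isys_bounded_at_left:
  assumes s: "lsys f p"
  shows "\<exists>e\<in>D. \<exists>C. \<forall>x\<in>D. x \<le> e \<longrightarrow> cmod (f x) + cmod (p x) \<le> C"
proof -
  obtain e0 where e0: "e0 \<in> D" using einterval_nonempty[OF ab] by (auto simp: ival_eq_einterval)
  let ?m = "\<lambda>\<mu> x. measure (cvar \<mu>) (L x)"
  \<comment> \<open>Three integrals involve the solution itself, and each may contribute at most a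
    sixth of the supremum, together one half. The factor \<open>1 + cmod z\<close> covers the
    coefficient \<open>z\<close> and stays positive for \<open>z = 0\<close>.\<close>
  have z3: "(1 + cmod z) * t < 1/6 \<longleftrightarrow> t < 1 / (6 * (1 + cmod z))" for t :: real
    by (simp add: field_simps add_pos_nonneg)
  have "eventually (\<lambda>x. ?m \<sigma> x < 1/6) (left_end a)" "eventually (\<lambda>x. ?m chi x < 1/6) (left_end a)"
    "eventually (\<lambda>x. ?m \<rho> x < 1 / (6 * (1 + cmod z))) (left_end a)"
    by (rule order_tendstoD(2)[OF left_tail_measure[OF _ e0]]; simp add: \<rho> \<sigma> chi add_pos_nonneg)+
  with eventually_left_end_le[OF e0] have "eventually (\<lambda>x. (x \<in> D \<and> x \<le> e0) \<and> ?m \<sigma> x < 1/6 \<and> ?m chi x < 1/6 \<and> (1 + cmod z) * ?m \<rho> x < 1/6) (left_end a)"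
    unfolding z3 by eventually_elim auto
  from eventually_happens'[OF left_end_neq_bot this]
  obtain e where e: "e \<in> D" "?m \<sigma> e < 1/6" "?m chi e < 1/6" "(1 + cmod z) * ?m \<rho> e < 1/6" by auto
  define G where "G = (LINT t:L e|cvar \<rho>. cmod (g t))"
  define A where "A = cmod (f e) + cmod (p e) + G"
  have "cmod (f x) + cmod (p x) \<le> 2 * A" if x: "x \<in> D" "x \<le> e" for x
  proof -
    let ?h = "\<lambda>t. cmod (f t) + cmod (p t)"
    have lb: "loc_bdd a b f" "loc_bdd a b p" using s by (simp_all add: isys_def)
    have bdd: "bdd_above (?h ` {x..e})"
    proof -
      obtain C1 C2 where "\<forall>t\<in>{x..e}. cmod (f t) \<le> C1" "\<forall>t\<in>{x..e}. cmod (p t) \<le> C2"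
        using lb x e(1) unfolding loc_bdd_def by meson
      then show ?thesis by (intro bdd_aboveI2[where M="C1 + C2"] add_mono) auto
    qed
    \<comment> \<open>\<open>S\<close> is finite because \<open>[x, e]\<close> is a compact part of
      the interval, so \<open>S \<le> A + S / 2\<close> can be solved for \<open>S\<close>. The
      resulting bound \<open>2 * A\<close> does not depend on \<open>x\<close>.\<close>
    define S where "S = (SUP t\<in>{x..e}. ?h t)"
    have hS: "?h t \<le> S" if "t \<in> {x..e}" for t unfolding S_def by (rule cSUP_upper[OF that bdd])
    have S0: "0 \<le> S"
    proof -
      have "?h x \<le> S" using hS[of x] x(2) by simp
      then show ?thesis using norm_ge_zero[of "f x"] norm_ge_zero[of "p x"] by linarith
    qed
    have "?h t \<le> A + S / 2" if t: "t \<in> {x..e}" for t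
    proof -
      have tD: "t \<in> D" using ival_mem_between[OF x(1) e(1)] t by auto
      have sub: "{t..<e} \<subseteq> L e" using ival_Icc_subset[OF tD e(1)] by (auto simp: left_part_def)
      have bnd: "cmod (cmint \<mu> {t..<e} h) \<le> S * ?m \<mu> e"
        if \<mu>: "lfin a b \<mu>" and h: "loc_bdd a b h" and hS': "\<And>r. r \<in> {x..e} \<Longrightarrow> cmod (h r) \<le> S" for \<mu> h
      proof -
        have \<mu>': "lfcm a b \<mu>" using \<mu> by (simp add: lfin_def)
        have fin: "emeasure (cvar \<mu>) (L e) < \<infinity>" using \<mu> e(1) by (simp add: lfin_def)
        have fin': "emeasure (cvar \<mu>) {t..<e} < \<infinity>"
          using emeasure_mono[OF sub, of "cvar \<mu>"] fin by (auto simp: lfcm_sets[OF \<mu>'] intro: le_less_trans)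
        have "set_integrable (cvar \<mu>) {t..<e} h"
          by (rule locL1_subset[OF loc_bdd_locL1[OF h \<mu>'] \<mu>' tD e(1)]) auto
        then have "cmod (cmint \<mu> {t..<e} h) \<le> S * measure (cvar \<mu>) {t..<e}"
          by (rule cmint_norm_le_const[OF \<mu>']) (use fin' hS' t in auto)
        also have "\<dots> \<le> S * ?m \<mu> e"
          by (intro mult_left_mono measure_mono_fmeasurable sub S0)
            (use fin in \<open>auto simp: lfcm_sets[OF \<mu>'] fmeasurable_def\<close>)
        finally show ?thesis .
      qed
      have hf: "cmod (f r) \<le> S" "cmod (p r) \<le> S" if "r \<in> {x..e}" for r
        using hS[OF that] norm_ge_zero[of "f r"] norm_ge_zero[of "p r"] by linarith+
      have b1: "cmod (cmint \<sigma> {t..<e} p) \<le> S * ?m \<sigma> e" by (intro bnd \<sigma> lb hf)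
      have b2: "cmod (cmint chi {t..<e} f) \<le> S * ?m chi e" by (intro bnd chi lb hf)
      have b3: "cmod (cmint \<rho> {t..<e} f) \<le> S * ?m \<rho> e" by (intro bnd \<rho> lb hf)
      have b4: "cmod (cmint \<rho> {t..<e} g) \<le> G"
        unfolding G_def by (rule cmint_norm_le_mono[OF lfcms(1) g[OF e(1)] _ sub]) simp
      have te: "t \<le> e" using t by simp
      have iL: "set_integrable (cvar \<rho>) {t..<e} h" if "locL1 a b \<rho> h" for h
        by (rule locL1_subset[OF that lfcms(1) tD e(1)]) auto
      have eq1: "f e - f t = cmint \<sigma> {t..<e} p"
        and eq2: "p e - p t = cmint chi {t..<e} f - cmint \<rho> {t..<e} (\<lambda>t. z * f t + g t)"
        using s tD e(1) te unfolding isys_def by blast+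
      have eq3: "cmint \<rho> {t..<e} (\<lambda>t. z * f t + g t) = z * cmint \<rho> {t..<e} f + cmint \<rho> {t..<e} g"
        using iL[OF loc_bdd_locL1[OF lb(1) lfcms(1)]] iL[OF g_loc]
        by (subst cmint_add[OF lfcms(1)]) (auto simp: cmint_cmult)
      have "cmod (f t) \<le> cmod (f e) + cmod (f e - f t)"
        using norm_triangle_ineq4[of "f e" "f e - f t"] by simp
      then have "cmod (f t) \<le> cmod (f e) + S * ?m \<sigma> e"
        using b1 unfolding eq1 by linarith
      moreover have "cmod (p t) \<le> cmod (p e) + (S * ?m chi e + (cmod z * (S * ?m \<rho> e) + G))"
      proof -
        have "cmod (p t) \<le> cmod (p e) + cmod (p e - p t)"
          using norm_triangle_ineq4[of "p e" "p e - p t"] by simp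
        also have "cmod (p e - p t) \<le> cmod (cmint chi {t..<e} f) + cmod (z * cmint \<rho> {t..<e} f + cmint \<rho> {t..<e} g)"
          unfolding eq2 eq3 by (rule norm_triangle_ineq4)
        also have "\<dots> \<le> S * ?m chi e + (cmod z * (S * ?m \<rho> e) + G)"
          by (intro add_mono b2 order_trans[OF norm_triangle_ineq] b4)
            (simp add: norm_mult mult_left_mono b3)
        finally show ?thesis by simp
      qed
      moreover have "S * ?m \<sigma> e \<le> S * (1/6)" "S * ?m chi e \<le> S * (1/6)" "S * ((1 + cmod z) * ?m \<rho> e) \<le> S * (1/6)"
        using e S0 by (intro mult_left_mono; simp)+
      moreover have "cmod z * (S * ?m \<rho> e) \<le> S * ((1 + cmod z) * ?m \<rho> e)"
        using S0 by (simp add: algebra_simps)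
      ultimately show ?thesis unfolding A_def by linarith
    qed
    then have "S \<le> A + S / 2" unfolding S_def using x(2) by (intro cSUP_least) auto
    moreover have "?h x \<le> S" using hS[of x] x(2) by simp
    ultimately show ?thesis by linarith
  qed
  with e(1) show ?thesis by blast
qed

text \<open>The bound near \<open>a\<close> and the local bound on \<open>[e, x]\<close> together
  place every solution in the class where fixed points are unique. In particular its integrals from
  \<open>a\<close> converge.\<close>

lemma isys_left_bdd:
  assumes s: "lsys f p"
  shows "left_bdd D (pair_on f p)"
  unfolding left_bdd_def
proof (intro conjI ballI)
  have lb: "loc_bdd a b f" "loc_bdd a b p" using s by (simp_all add: isys_def)
  then have "(\<lambda>x. (indicat_real D x *\<^sub>R f x, indicat_real D x *\<^sub>R p x)) \<in> borel_measurable borel"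
    by (intro borel_measurable_Pair) (auto simp: loc_bdd_def set_borel_measurable_def)
  moreover have "pair_on f p = (\<lambda>x. (indicat_real D x *\<^sub>R f x, indicat_real D x *\<^sub>R p x))"
    by (auto simp: pair_on_def indicator_def fun_eq_iff zero_prod_def)
  ultimately show "pair_on f p \<in> borel_measurable borel" by simp
  obtain e C where e: "e \<in> D" and C: "\<And>x. x \<in> D \<Longrightarrow> x \<le> e \<Longrightarrow> cmod (f x) + cmod (p x) \<le> C"
    using isys_bounded_at_left[OF s] by blast
  fix x assume x: "x \<in> D"
  obtain C1 C2 where C1: "\<forall>t\<in>{e..x}. cmod (f t) \<le> C1" and C2: "\<forall>t\<in>{e..x}. cmod (p t) \<le> C2"
    using lb x e unfolding loc_bdd_def by meson
  have "norm (pair_on f p t) \<le> max 0 (max C (C1 + C2))" if "t \<le> x" for t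
  proof (cases "t \<in> D")
    case True
    then have "norm (pair_on f p t) \<le> cmod (f t) + cmod (p t)" by (simp add: pair_on_def norm_Pair_le)
    moreover have "cmod (f t) + cmod (p t) \<le> C1 + C2" if "e \<le> t"
      using that C1 C2 \<open>t \<le> x\<close> by (intro add_mono) auto
    ultimately show ?thesis using C[OF True] by (cases "t \<le> e") auto
  qed (simp add: pair_on_def)
  then show "\<exists>C. \<forall>t\<le>x. norm (pair_on f p t) \<le> C" by blast
qed

lemma cmint_pair_on:
  assumes "lfcm a b \<mu>" "A \<subseteq> D" "A \<in> sets borel"
  shows "cmint \<mu> A (\<lambda>t. fst (pair_on f p t)) = cmint \<mu> A f" "cmint \<mu> A (\<lambda>t. snd (pair_on f p t)) = cmint \<mu> A p"
    "cmint \<mu> A (\<lambda>t. z * fst (pair_on f p t) + g t) = cmint \<mu> A (\<lambda>t. z * f t + g t)"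
  by (rule cmint_cong[OF assms(3,1)]; use assms(2) in \<open>auto simp: pair_on_def\<close>)+

lemma isys_diff_left_part:
  assumes s: "lsys f p" and x: "x \<in> D" and y: "y \<in> D" and xy: "x \<le> y"
  shows "f y - f x = cmint \<sigma> (L y) p - cmint \<sigma> (L x) p"
    "p y - p x = (cmint chi (L y) f - cmint \<rho> (L y) (\<lambda>t. z * f t + g t)) - (cmint chi (L x) f - cmint \<rho> (L x) (\<lambda>t. z * f t + g t))"
proof -
  note u = isys_left_bdd[OF s]
  note i = left_bdd_integrable[OF u y] left_bdd_rhs_integrable[OF u y]
  have sub: "{x..<y} \<subseteq> D" using ival_Icc_subset[OF x y] by auto
  note c = cmint_pair_on[OF _ sub] cmint_pair_on[OF _ left_part_subset(1)]
  have "f y - f x = cmint \<sigma> {x..<y} p"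
    and "p y - p x = cmint chi {x..<y} f - cmint \<rho> {x..<y} (\<lambda>t. z * f t + g t)"
    using s x y xy unfolding isys_def by blast+
  moreover have "cmint \<sigma> {x..<y} p = cmint \<sigma> (L y) p - cmint \<sigma> (L x) p"
    using left_split_diff[OF lfcms(2) x y xy i(2)[OF \<sigma>]] by (simp add: c[OF lfcms(2)])
  moreover have "cmint chi {x..<y} f = cmint chi (L y) f - cmint chi (L x) f"
    using left_split_diff[OF lfcms(3) x y xy i(1)[OF chi]] by (simp add: c[OF lfcms(3)])
  moreover have "cmint \<rho> {x..<y} (\<lambda>t. z * f t + g t) = cmint \<rho> (L y) (\<lambda>t. z * f t + g t) - cmint \<rho> (L x) (\<lambda>t. z * f t + g t)"
    using left_split_diff[OF lfcms(1) x y xy i(3)] by (simp add: c[OF lfcms(1)])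
  ultimately show "f y - f x = cmint \<sigma> (L y) p - cmint \<sigma> (L x) p"
    "p y - p x = (cmint chi (L y) f - cmint \<rho> (L y) (\<lambda>t. z * f t + g t)) - (cmint chi (L x) f - cmint \<rho> (L x) (\<lambda>t. z * f t + g t))"
    by simp_all
qed

text \<open>Increments are now differences of integrals from \<open>a\<close>, and the integral over
  \<open>(a, x)\<close> tends to 0. The explicit value of the limit matters: it is the fixed point
  equation at \<open>y\<close>, solved for the boundary value.\<close>

lemma isys_limits_at:
  assumes s: "lsys f p" and y: "y \<in> D"
  shows "(f \<longlongrightarrow> f y - cmint \<sigma> (L y) p) (left_end a)"
    "(p \<longlongrightarrow> p y - (cmint chi (L y) f - cmint \<rho> (L y) (\<lambda>t. z * f t + g t))) (left_end a)"
proof -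
  note u = isys_left_bdd[OF s]
  note i = left_bdd_integrable[OF u y] left_bdd_rhs_integrable[OF u y]
  note c = cmint_pair_on[OF _ left_part_subset(1) left_part_borel]
  have t: "((\<lambda>x. cmint \<sigma> (L x) p) \<longlongrightarrow> 0) (left_end a)" "((\<lambda>x. cmint chi (L x) f) \<longlongrightarrow> 0) (left_end a)"
    "((\<lambda>x. cmint \<rho> (L x) (\<lambda>t. z * f t + g t)) \<longlongrightarrow> 0) (left_end a)"
    using left_tail[OF lfcms(2) y i(2)[OF \<sigma>]] left_tail[OF lfcms(3) y i(1)[OF chi]] left_tail[OF lfcms(1) y i(3)]
    by (simp_all add: c[OF lfcms(1)] c[OF lfcms(2)] c[OF lfcms(3)])
  have "((\<lambda>x. f y - (cmint \<sigma> (L y) p - cmint \<sigma> (L x) p)) \<longlongrightarrow> f y - (cmint \<sigma> (L y) p - 0)) (left_end a)"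
    by (intro tendsto_intros t)
  then show "(f \<longlongrightarrow> f y - cmint \<sigma> (L y) p) (left_end a)"
    unfolding diff_0_right
    by (rule Lim_transform_eventually)
      (rule eventually_mono[OF eventually_left_end_le[OF y]], use isys_diff_left_part(1)[OF s _ y] in \<open>force simp: algebra_simps\<close>)
  have "((\<lambda>x. p y - ((cmint chi (L y) f - cmint \<rho> (L y) (\<lambda>t. z * f t + g t))
      - (cmint chi (L x) f - cmint \<rho> (L x) (\<lambda>t. z * f t + g t)))) \<longlongrightarrow>
       p y - ((cmint chi (L y) f - cmint \<rho> (L y) (\<lambda>t. z * f t + g t)) - (0 - 0))) (left_end a)"
    by (intro tendsto_diff tendsto_const t)
  then show "(p \<longlongrightarrow> p y - (cmint chi (L y) f - cmint \<rho> (L y) (\<lambda>t. z * f t + g t))) (left_end a)"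
    unfolding diff_0_right
    by (rule Lim_transform_eventually)
      (rule eventually_mono[OF eventually_left_end_le[OF y]], use isys_diff_left_part(2)[OF s _ y] in \<open>force simp: algebra_simps\<close>)
qed

theorem isys_limits:
  assumes "lsys f p"
  shows "\<exists>d1. (f \<longlongrightarrow> d1) (left_end a)" "\<exists>d2. (p \<longlongrightarrow> d2) (left_end a)"
proof -
  obtain e where "e \<in> D" using einterval_nonempty[OF ab] by (auto simp: ival_eq_einterval)
  from isys_limits_at[OF assms this] show "\<exists>d1. (f \<longlongrightarrow> d1) (left_end a)" "\<exists>d2. (p \<longlongrightarrow> d2) (left_end a)"
    by blast+
qed

text \<open>Limits are unique, so the prescribed \<open>d1\<close> and \<open>d2\<close> coincide
  with the explicit values computed at each \<open>x\<close>.\<close>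

lemma isys_fixpoint:
  assumes s: "lsys f p" and f: "(f \<longlongrightarrow> d1) (left_end a)" and p: "(p \<longlongrightarrow> d2) (left_end a)"
  shows "volterra_op d1 d2 (pair_on f p) = pair_on f p"
proof
  fix x
  note c = cmint_pair_on[OF _ left_part_subset(1) left_part_borel]
  have "d1 = f x - cmint \<sigma> (L x) p"
    "d2 = p x - (cmint chi (L x) f - cmint \<rho> (L x) (\<lambda>t. z * f t + g t))" if "x \<in> D"
    using tendsto_unique[OF left_end_neq_bot f isys_limits_at(1)[OF s that]]
      tendsto_unique[OF left_end_neq_bot p isys_limits_at(2)[OF s that]] .
  then show "volterra_op d1 d2 (pair_on f p) x = pair_on f p x"
    by (cases "x \<in> D") (simp_all add: volterra_op_def c[OF lfcms(1)] c[OF lfcms(2)] c[OF lfcms(3)], simp_all add: pair_on_def)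
qed

theorem isys_unique:
  assumes s: "lsys f p" "(f \<longlongrightarrow> d1) (left_end a)" "(p \<longlongrightarrow> d2) (left_end a)"
    and s': "lsys f' p'" "(f' \<longlongrightarrow> d1) (left_end a)" "(p' \<longlongrightarrow> d2) (left_end a)"
    and x: "x \<in> D"
  shows "f x = f' x" "p x = p' x"
proof -
  have "pair_on f p = pair_on f' p'"
    by (rule fixpoint_unique[OF isys_left_bdd[OF s(1)] isys_fixpoint[OF s] isys_left_bdd[OF s'(1)] isys_fixpoint[OF s']])
  from fun_cong[OF this, of x] show "f x = f' x" "p x = p' x" using x by (auto simp: pair_on_def)
qed

end

subsection \<open>Real data\<close>

lemma AE_ival_compacts:
  assumes "lfcm a b \<mu>" "a < b"
    and "\<And>x y. x \<in> ival a b \<Longrightarrow> y \<in> ival a b \<Longrightarrow> AE t in cvar \<mu>. t \<in> {x..y} \<longrightarrow> P t"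
  shows "AE t in cvar \<mu>. P t"
proof -
  obtain l u :: "nat \<Rightarrow> real" where lu: "ival a b = (\<Union>i. {l i..u i})" "incseq u" "decseq l"
    "\<And>i. l i \<in> ival a b" "\<And>i. u i \<in> ival a b"
    by (rule ival_approx[OF assms(2)]) (rule that; assumption)
  have "AE t in cvar \<mu>. \<forall>i. t \<in> {l i..u i} \<longrightarrow> P t"
    unfolding AE_all_countable using assms(3) lu(4,5) by blast
  with lfcm_AE_ival[OF assms(1)] show ?thesis
    by eventually_elim (use lu(1) in auto)
qed

text \<open>On the part of a compact interval where the imaginary part of the phase has a fixed
  sign, the imaginary part of the measure is the integral of a function of one sign. Since it
  vanishes, so does that function almost everywhere.\<close>

lemma real_cm_AE_phase:
  assumes \<mu>: "lfcm a b \<mu>" and "a < b" and re: "real_cm a b \<mu>"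
  shows "AE t in cvar \<mu>. snd \<mu> t \<in> \<real>"
proof (rule AE_ival_compacts[OF \<mu> \<open>a < b\<close>])
  fix x y assume xy: "x \<in> ival a b" "y \<in> ival a b"
  note s = lfcm_sets[OF \<mu>]
  note [measurable] = lfcm_phase_measurable[OF \<mu>]
  note [measurable_cong] = s
  \<comment> \<open>The factor \<open>c\<close> is later taken as 1 and -1, to treat both signs at
    once.\<close>
  have part: "AE t in cvar \<mu>. t \<in> {x..y} \<longrightarrow> \<not> 0 < c * Im (snd \<mu> t)" for c :: real
  proof -
    define A where "A = {x..y} \<inter> {t. 0 < c * Im (snd \<mu> t)}"
    have A: "A \<in> sets borel" unfolding A_def by measurable
    have int: "set_integrable (cvar \<mu>) A (snd \<mu>)"
      by (rule set_integrable_subset[OF set_integrable_bounded[OF \<mu>, where C=1 and A="{x..y}"]])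
        (use A ival_Icc_subset[OF xy] lfcm_finite_Icc[OF \<mu> ival_Icc_subset[OF xy]] in
          \<open>auto simp: s lfcm_norm_phase[OF \<mu>] set_borel_measurable_def A_def\<close>)
    then have i2: "integrable (cvar \<mu>) (\<lambda>t. c * Im (indicat_real A t *\<^sub>R snd \<mu> t))"
      unfolding set_integrable_def by (intro integrable_mult_right integrable_Im)
    have "cmeas \<mu> A \<in> \<real>"
      using re A xy ival_Icc_subset[OF xy] unfolding real_cm_def A_def by blast
    then have "Im (cmeas \<mu> A) = 0" by (simp add: complex_is_Real_iff)
    then have "(LINT t|cvar \<mu>. Im (indicat_real A t *\<^sub>R snd \<mu> t)) = 0"
      using int unfolding cmeas_def set_lebesgue_integral_def set_integrable_def by (subst integral_Im) auto
    then have "(LINT t|cvar \<mu>. c * Im (indicat_real A t *\<^sub>R snd \<mu> t)) = 0" by simp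
    moreover have "AE t in cvar \<mu>. 0 \<le> c * Im (indicat_real A t *\<^sub>R snd \<mu> t)"
      by (auto simp: A_def indicator_def)
    ultimately have "AE t in cvar \<mu>. c * Im (indicat_real A t *\<^sub>R snd \<mu> t) = 0"
      using integral_nonneg_eq_0_iff_AE[OF i2] by simp
    then show ?thesis by eventually_elim (auto simp: A_def indicator_def)
  qed
  from part[of 1] part[of "-1"] show "AE t in cvar \<mu>. t \<in> {x..y} \<longrightarrow> snd \<mu> t \<in> \<real>"
    by eventually_elim (auto simp: complex_is_Real_iff)
qed

lemma cmint_cnj:
  assumes \<mu>: "lfcm a b \<mu>" and re: "AE t in cvar \<mu>. snd \<mu> t \<in> \<real>"
    and h: "set_integrable (cvar \<mu>) A h" and k: "set_integrable (cvar \<mu>) A k"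
    and kh: "AE t in cvar \<mu>. t \<in> A \<longrightarrow> k t = cnj (h t)"
  shows "cmint \<mu> A k = cnj (cmint \<mu> A h)"
proof -
  have "cmint \<mu> A k = (LINT t|cvar \<mu>. cnj (indicat_real A t *\<^sub>R (h t * snd \<mu> t)))"
    unfolding cmint_def set_lebesgue_integral_def
  proof (rule integral_cong_AE)
    show "AE t in cvar \<mu>. indicat_real A t *\<^sub>R (k t * snd \<mu> t) = cnj (indicat_real A t *\<^sub>R (h t * snd \<mu> t))"
      using re kh by eventually_elim (auto simp: indicator_def Reals_cnj_iff)
    show "(\<lambda>t. cnj (indicat_real A t *\<^sub>R (h t * snd \<mu> t))) \<in> borel_measurable (cvar \<mu>)"
      using set_integrable_phase[OF \<mu> h] unfolding set_integrable_def
      by (intro borel_measurable_integrable integrable_cnj)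
  qed (use set_integrable_phase[OF \<mu> k] in \<open>simp add: set_integrable_def borel_measurable_integrable\<close>)
  also have "\<dots> = cnj (cmint \<mu> A h)"
    unfolding cmint_def set_lebesgue_integral_def by (rule Bochner_Integration.integral_cnj)
  finally show ?thesis .
qed

lemma isys_rhs_locL1:
  assumes "loc_bdd a b f" "locL1 a b \<rho> g" "lfcm a b \<rho>"
  shows "locL1 a b \<rho> (\<lambda>t. z * f t + g t)"
  using loc_bdd_locL1[OF loc_bdd_cmult[OF assms(1,1)] assms(3), of z] assms(2)
  unfolding locL1_def by (auto intro: set_integral_add)

text \<open>Reality of the measures in the almost everywhere form, under which conjugation commutes
  with integration.\<close>

definition real_data :: "cmeasure \<Rightarrow> cmeasure \<Rightarrow> cmeasure \<Rightarrow> complex \<Rightarrow> (real \<Rightarrow> complex) \<Rightarrow> bool" where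
  "real_data \<rho> \<sigma> chi z g \<longleftrightarrow> z \<in> \<real> \<and> (AE t in cvar \<rho>. g t \<in> \<real>) \<and> (AE t in cvar \<rho>. snd \<rho> t \<in> \<real>)
     \<and> (AE t in cvar \<sigma>. snd \<sigma> t \<in> \<real>) \<and> (AE t in cvar chi. snd chi t \<in> \<real>)"

lemma isys_cnj:
  assumes s: "isys atLeastLessThan a b \<rho> \<sigma> chi z g f p"
    and lfcms: "lfcm a b \<rho>" "lfcm a b \<sigma>" "lfcm a b chi" and g: "locL1 a b \<rho> g" and re: "real_data \<rho> \<sigma> chi z g"
  shows "isys atLeastLessThan a b \<rho> \<sigma> chi z g (\<lambda>x. cnj (f x)) (\<lambda>x. cnj (p x))"
  unfolding isys_def
proof (intro conjI ballI impI)
  have lb: "loc_bdd a b f" "loc_bdd a b p" using s by (simp_all add: isys_def)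
  then show lb': "loc_bdd a b (\<lambda>x. cnj (f x))" "loc_bdd a b (\<lambda>x. cnj (p x))"
    using loc_bdd_cnj by auto
  fix x y assume xy: "x \<in> ival a b" "y \<in> ival a b" "x \<le> y"
  have i: "set_integrable (cvar \<mu>) {x..<y} h" if "locL1 a b \<mu> h" "lfcm a b \<mu>" for \<mu> h
    by (rule locL1_subset[OF that xy(1,2)]) auto
  note L = loc_bdd_locL1[OF lb(1)] loc_bdd_locL1[OF lb(2)] loc_bdd_locL1[OF lb'(1)] loc_bdd_locL1[OF lb'(2)]
  have r: "AE t in cvar \<rho>. snd \<rho> t \<in> \<real>" "AE t in cvar \<sigma>. snd \<sigma> t \<in> \<real>" "AE t in cvar chi. snd chi t \<in> \<real>"
    "AE t in cvar \<rho>. g t \<in> \<real>" "cnj z = z"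
    using re by (auto simp: real_data_def Reals_cnj_iff)
  have "cmint \<sigma> {x..<y} (\<lambda>t. cnj (p t)) = cnj (cmint \<sigma> {x..<y} p)"
    by (rule cmint_cnj[OF lfcms(2) r(2) i[OF L(2)[OF lfcms(2)] lfcms(2)] i[OF L(4)[OF lfcms(2)] lfcms(2)]]) simp
  moreover have "cmint chi {x..<y} (\<lambda>t. cnj (f t)) = cnj (cmint chi {x..<y} f)"
    by (rule cmint_cnj[OF lfcms(3) r(3) i[OF L(1)[OF lfcms(3)] lfcms(3)] i[OF L(3)[OF lfcms(3)] lfcms(3)]]) simp
  moreover have "cmint \<rho> {x..<y} (\<lambda>t. z * cnj (f t) + g t) = cnj (cmint \<rho> {x..<y} (\<lambda>t. z * f t + g t))"
    by (rule cmint_cnj[OF lfcms(1) r(1) i[OF isys_rhs_locL1[OF lb(1) g lfcms(1)] lfcms(1)] i[OF isys_rhs_locL1[OF lb'(1) g lfcms(1)] lfcms(1)]])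
      (use r(4) in \<open>eventually_elim, auto simp: r(5) Reals_cnj_iff\<close>)
  moreover have "f y - f x = cmint \<sigma> {x..<y} p"
    and "p y - p x = cmint chi {x..<y} f - cmint \<rho> {x..<y} (\<lambda>t. z * f t + g t)"
    using s xy unfolding isys_def by blast+
  ultimately show "cnj (f y) - cnj (f x) = cmint \<sigma> {x..<y} (\<lambda>x. cnj (p x))"
    and "cnj (p y) - cnj (p x) = cmint chi {x..<y} (\<lambda>x. cnj (f x)) - cmint \<rho> {x..<y} (\<lambda>t. z * cnj (f t) + g t)"
    by (simp_all flip: complex_cnj_diff)
qed

theorem (in left_regular) isys_real:
  assumes s: "lsys f p" "(f \<longlongrightarrow> d1) (left_end a)" "(p \<longlongrightarrow> d2) (left_end a)"
    and re: "real_data \<rho> \<sigma> chi z g" "d1 \<in> \<real>" "d2 \<in> \<real>" and x: "x \<in> D"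
  shows "f x \<in> \<real>" "p x \<in> \<real>"
proof -
  have c: "lsys (\<lambda>x. cnj (f x)) (\<lambda>x. cnj (p x))"
    by (rule isys_cnj[OF s(1) lfcms g_loc re(1)])
  have t: "((\<lambda>x. cnj (f x)) \<longlongrightarrow> d1) (left_end a)" "((\<lambda>x. cnj (p x)) \<longlongrightarrow> d2) (left_end a)"
    using tendsto_cnj[OF s(2)] tendsto_cnj[OF s(3)] re(2,3) by (simp_all add: Reals_cnj_iff)
  have "cnj (f x) = f x" "cnj (p x) = p x"
    by (rule isys_unique[OF c t s x])+
  then show "f x \<in> \<real>" "p x \<in> \<real>" by (simp_all add: Reals_cnj_iff)
qed

subsection \<open>Reflection\<close>

definition mirror :: "cmeasure \<Rightarrow> cmeasure" where
  "mirror \<mu> = (distr (cvar \<mu>) borel uminus, \<lambda>x. snd \<mu> (- x))"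

lemma cvar_mirror: "cvar (mirror \<mu>) = distr (cvar \<mu>) borel uminus"
  and snd_mirror: "snd (mirror \<mu>) x = snd \<mu> (- x)"
  by (simp_all add: mirror_def cvar_def)

lemma mirror_measurable: "lfcm a b \<mu> \<Longrightarrow> uminus \<in> measurable (cvar \<mu>) borel"
  using lfcm_sets by (simp cong: measurable_cong_sets)

lemma emeasure_mirror:
  assumes "lfcm a b \<mu>" "A \<in> sets borel"
  shows "emeasure (cvar (mirror \<mu>)) A = emeasure (cvar \<mu>) (uminus ` A)"
  unfolding cvar_mirror using assms lfcm_space[OF assms(1)]
  by (subst emeasure_distr[OF mirror_measurable]) (auto simp: image_iff intro!: arg_cong[where f="emeasure _"] bexI[of _ "- _"])

lemma uminus_mem_ival: "- x \<in> ival a b \<longleftrightarrow> x \<in> ival (- b) (- a)"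
  by (auto simp: ival_def ereal_uminus_less_reorder ereal_less_uminus_reorder simp flip: uminus_ereal.simps(1))

lemma uminus_image_ival: "uminus ` ival a b = ival (- b) (- a)"
  using uminus_mem_ival[of _ "-b" "-a"] by (auto simp: image_iff) (metis minus_minus uminus_mem_ival)

lemma lfcm_mirror:
  assumes \<mu>: "lfcm a b \<mu>"
  shows "lfcm (- b) (- a) (mirror \<mu>)"
  unfolding lfcm_def cvar_def[symmetric]
proof (intro conjI allI impI)
  show "sets (cvar (mirror \<mu>)) = sets borel" by (simp add: cvar_mirror)
  have "uminus ` (UNIV - ival (- b) (- a)) = UNIV - ival a b"
    unfolding image_set_diff[OF inj_uminus] uminus_image_ival by simp
  then show "emeasure (cvar (mirror \<mu>)) (UNIV - ival (- b) (- a)) = 0"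
    using \<mu> by (subst emeasure_mirror[OF \<mu>]) (auto simp: Compl_eq_Diff_UNIV[symmetric] lfcm_def cvar_def)
  show "emeasure (cvar (mirror \<mu>)) {c..d} < \<infinity>" if "{c..d} \<subseteq> ival (- b) (- a)" for c d
  proof -
    have "uminus ` {c..d} \<subseteq> ival a b" using image_mono[OF that, of uminus] by (simp add: uminus_image_ival)
    then show ?thesis using lfcm_finite_Icc[OF \<mu>] by (simp add: emeasure_mirror[OF \<mu>])
  qed
  note [measurable] = lfcm_phase_measurable[OF \<mu>]
  show "snd (mirror \<mu>) \<in> borel_measurable borel" by (simp add: mirror_def)
  show "cmod (snd (mirror \<mu>) x) = 1" for x by (simp add: snd_mirror lfcm_norm_phase[OF \<mu>])
qed

text \<open>An equality of the measures themselves, because \<open>lfcm\<close> fixes the Borel sets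
  as domain. One transport lemma then serves in both directions.\<close>

lemma mirror_mirror: "lfcm a b \<mu> \<Longrightarrow> mirror (mirror \<mu>) = \<mu>"
  unfolding mirror_def cvar_def
  by (cases \<mu>) (simp add: distr_distr lfcm_def cvar_def comp_def distr_id2 cong: measurable_cong_sets)

lemma indicator_uminus: "indicat_real A (- x) = indicat_real (uminus ` A) x" for x :: real
  by (auto simp: indicator_def image_iff intro: bexI[of _ "- x"])

lemma set_integrable_mirror:
  fixes h :: "real \<Rightarrow> complex"
  assumes \<mu>: "lfcm a b \<mu>" and h: "set_integrable (cvar \<mu>) A h"
  shows "set_integrable (cvar (mirror \<mu>)) (uminus ` A) (\<lambda>t. h (- t))"
proof -
  have "(\<lambda>t. indicat_real A t *\<^sub>R h t) \<in> borel_measurable borel"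
    using h lfcm_sets[OF \<mu>] by (auto simp: set_integrable_def cong: measurable_cong_sets)
  from measurable_compose[OF borel_measurable_uminus[OF measurable_ident] this]
  have m: "(\<lambda>t. indicat_real (uminus ` A) t *\<^sub>R h (- t)) \<in> borel_measurable borel"
    by (simp add: indicator_uminus)
  show ?thesis
    unfolding set_integrable_def cvar_mirror integrable_distr_eq[OF mirror_measurable[OF \<mu>] m]
    using h by (simp add: set_integrable_def indicator_uminus image_image)
qed

lemma cmint_mirror:
  assumes \<mu>: "lfcm a b \<mu>" and h: "set_integrable (cvar \<mu>) A h"
  shows "cmint (mirror \<mu>) (uminus ` A) (\<lambda>t. h (- t)) = cmint \<mu> A h"
proof -
  have "(\<lambda>t. indicat_real A t *\<^sub>R (h t * snd \<mu> t)) \<in> borel_measurable borel"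
    using set_integrable_phase[OF \<mu> h] lfcm_sets[OF \<mu>] by (auto simp: set_integrable_def cong: measurable_cong_sets)
  from measurable_compose[OF borel_measurable_uminus[OF measurable_ident] this]
  have m: "(\<lambda>t. indicat_real (uminus ` A) t *\<^sub>R (h (- t) * snd \<mu> (- t))) \<in> borel_measurable borel"
    by (simp add: indicator_uminus)
  show ?thesis
    unfolding cmint_def set_lebesgue_integral_def snd_mirror cvar_mirror integral_distr[OF mirror_measurable[OF \<mu>] m]
    by (simp add: indicator_uminus image_image)
qed

lemma locL1_mirror:
  assumes \<mu>: "lfcm a b \<mu>" and h: "locL1 a b \<mu> h"
  shows "locL1 (- b) (- a) (mirror \<mu>) (\<lambda>t. h (- t))"
  unfolding locL1_def
proof (intro allI impI)
  fix c d assume "{c..d} \<subseteq> ival (- b) (- a)"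
  from image_mono[OF this, of uminus] have "{- d..- c} \<subseteq> ival a b" by (simp add: uminus_image_ival)
  then have "set_integrable (cvar \<mu>) {- d..- c} h" using h by (simp add: locL1_def)
  from set_integrable_mirror[OF \<mu> this] show "set_integrable (cvar (mirror \<mu>)) {c..d} (\<lambda>t. h (- t))" by simp
qed

lemma loc_bdd_mirror:
  assumes "loc_bdd a b f" shows "loc_bdd (- b) (- a) (\<lambda>t. f (- t))"
  unfolding loc_bdd_def
proof (intro conjI ballI)
  have "(\<lambda>t. indicat_real (ival a b) t *\<^sub>R f t) \<in> borel_measurable borel"
    using assms by (simp add: loc_bdd_def set_borel_measurable_def)
  from measurable_compose[OF borel_measurable_uminus[OF measurable_ident] this]
  show "set_borel_measurable borel (ival (- b) (- a)) (\<lambda>t. f (- t))"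
    by (simp add: set_borel_measurable_def indicator_uminus uminus_image_ival)
  fix x y assume "x \<in> ival (- b) (- a)" "y \<in> ival (- b) (- a)"
  then have "- x \<in> ival a b" "- y \<in> ival a b" by (simp_all add: uminus_mem_ival)
  then obtain C where "\<forall>t\<in>{- y..- x}. cmod (f t) \<le> C" using assms unfolding loc_bdd_def by blast
  then have "\<forall>t\<in>{x..y}. cmod (f (- t)) \<le> C" by auto
  then show "\<exists>C. \<forall>t\<in>{x..y}. cmod (f (- t)) \<le> C" ..
qed

text \<open>Reflection reverses increments. The sign in front of \<open>p\<close> compensates for
  this in both equations: it appears in the integrand of the first and in the increment of the
  second. The families \<open>I\<close> and \<open>J\<close> record that \<open>[x, y)\<close> and
  \<open>(x, y]\<close> are exchanged.\<close>

lemma isys_mirror: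
  assumes s: "isys I a b \<rho> \<sigma> chi z g f p"
    and lfcms: "lfcm a b \<rho>" "lfcm a b \<sigma>" "lfcm a b chi" and g: "locL1 a b \<rho> g"
    and I: "\<And>x y. I x y \<in> sets borel" "\<And>x y. I x y \<subseteq> {x..y}" "\<And>x y. uminus ` I x y = J (- y) (- x)"
  shows "isys J (- b) (- a) (mirror \<rho>) (mirror \<sigma>) (mirror chi) z (\<lambda>t. g (- t)) (\<lambda>t. f (- t)) (\<lambda>t. - p (- t))"
  unfolding isys_def
proof (intro conjI ballI impI)
  have lb: "loc_bdd a b f" "loc_bdd a b p" using s by (simp_all add: isys_def)
  show "loc_bdd (- b) (- a) (\<lambda>t. f (- t))" "loc_bdd (- b) (- a) (\<lambda>t. - p (- t))"
    using loc_bdd_mirror[OF lb(1)] loc_bdd_mirror[OF lb(2)] loc_bdd_cmult[of "-b" "-a" "\<lambda>t. p (-t)" _ "-1"] by auto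
  fix x y assume xy: "x \<in> ival (- b) (- a)" "y \<in> ival (- b) (- a)" "x \<le> y"
  then have D: "- y \<in> ival a b" "- x \<in> ival a b" "- y \<le> - x" by (simp_all add: uminus_mem_ival)
  have J: "J x y = uminus ` I (- y) (- x)" using I(3)[of "-y" "-x"] by simp
  have i: "set_integrable (cvar \<mu>) (I (- y) (- x)) h" if "locL1 a b \<mu> h" "lfcm a b \<mu>" for \<mu> h
    by (rule locL1_subset[OF that D(1,2) I(2) I(1)])
  have e: "f (- x) - f (- y) = cmint \<sigma> (I (- y) (- x)) p"
    "p (- x) - p (- y) = cmint chi (I (- y) (- x)) f - cmint \<rho> (I (- y) (- x)) (\<lambda>t. z * f t + g t)"
    using s D unfolding isys_def by blast+
  have "cmint (mirror \<sigma>) (J x y) (\<lambda>t. p (- t)) = cmint \<sigma> (I (- y) (- x)) p"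
    unfolding J by (rule cmint_mirror[OF lfcms(2) i[OF loc_bdd_locL1[OF lb(2) lfcms(2)] lfcms(2)]])
  then show "f (- y) - f (- x) = cmint (mirror \<sigma>) (J x y) (\<lambda>t. - p (- t))"
    using e(1) by (simp add: cmint_minus algebra_simps)
  have "cmint (mirror chi) (J x y) (\<lambda>t. f (- t)) = cmint chi (I (- y) (- x)) f"
    unfolding J by (rule cmint_mirror[OF lfcms(3) i[OF loc_bdd_locL1[OF lb(1) lfcms(3)] lfcms(3)]])
  moreover have "cmint (mirror \<rho>) (J x y) (\<lambda>t. z * f (- t) + g (- t)) = cmint \<rho> (I (- y) (- x)) (\<lambda>t. z * f t + g t)"
    unfolding J by (rule cmint_mirror[OF lfcms(1) i[OF isys_rhs_locL1[OF lb(1) g lfcms(1)] lfcms(1)]])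
  ultimately show "- p (- y) - - p (- x) = cmint (mirror chi) (J x y) (\<lambda>t. f (- t)) - cmint (mirror \<rho>) (J x y) (\<lambda>t. z * f (- t) + g (- t))"
    using e(2) by simp
qed

lemma right_end_eq: "right_end b = filtermap uminus (left_end (- b))"
proof (cases b)
  case (real r)
  then show ?thesis by (simp add: right_end_def left_end_def at_left_minus)
next
  case PInf
  then show ?thesis by (simp add: right_end_def left_end_def at_top_mirror)
next
  \<comment> \<open>In this degenerate case \<open>real_of_ereal\<close> returns 0 for both
    infinities, and the identity still holds.\<close>
  case MInf
  then show ?thesis by (simp add: right_end_def left_end_def at_left_minus)
qed

lemma tendsto_right_end: "(f \<longlongrightarrow> l) (right_end b) \<longleftrightarrow> ((\<lambda>x. f (- x)) \<longlongrightarrow> l) (left_end (- b))"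
  by (simp add: right_end_eq filterlim_filtermap)

subsection \<open>Right-continuous versions and the right endpoint\<close>

lemma countable_atoms:
  assumes \<mu>: "lfcm a b \<mu>" and "a < b"
  shows "countable {x \<in> ival a b. measure (cvar \<mu>) {x} \<noteq> 0}"
proof -
  note s = lfcm_sets[OF \<mu>]
  obtain l u :: "nat \<Rightarrow> real" where lu: "ival a b = (\<Union>i. {l i..u i})" "incseq u" "decseq l"
    "\<And>i. l i \<in> ival a b" "\<And>i. u i \<in> ival a b"
    by (rule ival_approx[OF assms(2)]) (rule that; assumption)
  define M where "M i = density (cvar \<mu>) (indicator {l i..u i})" for i
  have em: "emeasure (M i) A = emeasure (cvar \<mu>) ({l i..u i} \<inter> A)" if "A \<in> sets borel" for i A
    unfolding M_def using that s by (subst emeasure_density) (auto simp: indicator_inter_arith[symmetric] Int_commute)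
  have fin: "finite_measure (M i)" for i
  proof (rule finite_measureI)
    have "space (M i) = UNIV" by (simp add: M_def lfcm_space[OF \<mu>])
    then show "emeasure (M i) (space (M i)) \<noteq> \<infinity>"
      using lfcm_finite_Icc[OF \<mu> ival_Icc_subset[OF lu(4)[of i] lu(5)[of i]]] by (simp add: em less_top)
  qed
  have "{x \<in> ival a b. measure (cvar \<mu>) {x} \<noteq> 0} \<subseteq> (\<Union>i. {x. measure (M i) {x} \<noteq> 0})"
  proof
    fix x assume "x \<in> {x \<in> ival a b. measure (cvar \<mu>) {x} \<noteq> 0}"
    then have "x \<in> ival a b" and m: "measure (cvar \<mu>) {x} \<noteq> 0" by simp_all
    then obtain i where "x \<in> {l i..u i}" using lu(1) by blast
    then have "measure (M i) {x} = measure (cvar \<mu>) {x}" using em[of "{x}" i] by (simp add: measure_def)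
    with m show "x \<in> (\<Union>i. {x. measure (M i) {x} \<noteq> 0})" by (intro UN_I[of i]) auto
  qed
  then show ?thesis
    by (rule countable_subset) (intro countable_UN finite_measure.countable_support fin countableI_type)
qed

text \<open>Changing the kind of half-open interval changes an increment by the difference of the
  two end atoms, that is, by the increment of a jump function.\<close>

lemma cmint_Ioc_Ico:
  assumes \<mu>: "lfcm a b \<mu>" and h: "locL1 a b \<mu> h" and xy: "x \<in> ival a b" "y \<in> ival a b" "x \<le> y"
  shows "cmint \<mu> {x<..y} h = cmint \<mu> {x..<y} h + cmint \<mu> {y} h - cmint \<mu> {x} h"
proof -
  have i: "set_integrable (cvar \<mu>) A h" if "A \<subseteq> {x..y}" "A \<in> sets borel" for A
    by (rule locL1_subset[OF h \<mu> xy(1,2) that])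
  have "cmint \<mu> {x..y} h = cmint \<mu> {x..<y} h + cmint \<mu> {y} h"
    by (subst cmint_Un[OF \<mu>, symmetric]) (use xy(3) in \<open>auto intro!: i arg_cong2[where f="cmint \<mu>"]\<close>)
  moreover have "cmint \<mu> {x..y} h = cmint \<mu> {x<..y} h + cmint \<mu> {x} h"
    by (subst cmint_Un[OF \<mu>, symmetric]) (use xy(3) in \<open>auto intro!: i arg_cong2[where f="cmint \<mu>"]\<close>)
  ultimately show ?thesis by (simp add: algebra_simps)
qed

text \<open>A single atom is dominated by the integral of the norm over any compact interval
  containing it.\<close>

lemma loc_bdd_atoms:
  assumes \<mu>: "lfcm a b \<mu>" and h: "locL1 a b \<mu> h" and "a < b"
  shows "loc_bdd a b (\<lambda>x. cmint \<mu> {x} h)"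
proof -
  let ?k = "\<lambda>x. cmint \<mu> {t. t \<in> ival a b \<and> t = x} h"
  have "?k \<in> borel_measurable borel"
    by (rule cmint_param_measurable[OF \<mu> \<open>a < b\<close> locL1_set_borel_measurable[OF h \<mu> \<open>a < b\<close>]]) auto
  then have "set_borel_measurable borel (ival a b) ?k"
    unfolding set_borel_measurable_def by measurable
  moreover have "(\<lambda>x. indicat_real (ival a b) x *\<^sub>R ?k x) = (\<lambda>x. indicat_real (ival a b) x *\<^sub>R cmint \<mu> {x} h)"
  proof
    fix x
    have "x \<in> ival a b \<Longrightarrow> {t. t \<in> ival a b \<and> t = x} = {x}" by auto
    then show "indicat_real (ival a b) x *\<^sub>R ?k x = indicat_real (ival a b) x *\<^sub>R cmint \<mu> {x} h"
      by (cases "x \<in> ival a b") simp_all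
  qed
  ultimately have "set_borel_measurable borel (ival a b) (\<lambda>x. cmint \<mu> {x} h)"
    by (simp add: set_borel_measurable_def)
  moreover have "\<exists>C. \<forall>t\<in>{x..y}. cmod (cmint \<mu> {t} h) \<le> C" if "x \<in> ival a b" "y \<in> ival a b" for x y
  proof (intro exI ballI)
    fix t assume "t \<in> {x..y}"
    then show "cmod (cmint \<mu> {t} h) \<le> (LINT t:{x..y}|cvar \<mu>. cmod (h t))"
      by (intro cmint_norm_le_mono[OF \<mu>] locL1_subset[OF h \<mu> that]) auto
  qed
  ultimately show ?thesis by (simp add: loc_bdd_def)
qed

text \<open>Countably many points of mass 0 form a null set. In the applications \<open>N\<close>
  consists of the atoms of the other measures, where a jump may sit.\<close>

lemma cmint_eq_off_null_atoms:
  assumes \<mu>: "lfcm a b \<mu>" and h: "locL1 a b \<mu> h" and k: "locL1 a b \<mu> k"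
    and N: "countable N" "\<And>x. x \<in> N \<Longrightarrow> x \<in> ival a b \<and> measure (cvar \<mu>) {x} = 0"
    and eq: "\<And>x. x \<in> ival a b \<Longrightarrow> x \<notin> N \<Longrightarrow> h x = k x"
    and A: "A \<in> sets borel" "A \<subseteq> {x..y}" "x \<in> ival a b" "y \<in> ival a b"
  shows "cmint \<mu> A h = cmint \<mu> A k"
proof (rule cmint_cong_AE[OF \<mu> locL1_subset[OF h \<mu> A(3,4,2,1)] locL1_subset[OF k \<mu> A(3,4,2,1)]])
  note s = lfcm_sets[OF \<mu>]
  have "AE t in cvar \<mu>. \<forall>x\<in>N. t \<noteq> x"
  proof (subst AE_ball_countable[OF N(1)], intro ballI)
    fix x assume x: "x \<in> N"
    have "emeasure (cvar \<mu>) {x} < \<infinity>"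
      using lfcm_finite_Icc[OF \<mu>, of x x] N(2)[OF x] by simp
    then have "emeasure (cvar \<mu>) {x} = 0"
      using N(2)[OF x] by (auto simp: measure_def enn2real_eq_0_iff)
    then show "AE t in cvar \<mu>. t \<noteq> x"
      by (intro AE_I[where N="{x}"]) (auto simp: s)
  qed
  with lfcm_AE_ival[OF \<mu>] show "AE t in cvar \<mu>. t \<in> A \<longrightarrow> h t = k t"
    by eventually_elim (use eq in blast)
qed

locale sl_data =
  fixes a b :: ereal and \<rho> \<sigma> chi :: cmeasure and z :: complex and g :: "real \<Rightarrow> complex"
  assumes ab: "a < b" and lfcms: "lfcm a b \<rho>" "lfcm a b \<sigma>" "lfcm a b chi" and g_loc: "locL1 a b \<rho> g"
    and atoms: "x \<in> ival a b \<Longrightarrow>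
      measure (cvar \<sigma>) {x} = 0 \<or> measure (cvar \<rho>) {x} = 0 \<and> measure (cvar chi) {x} = 0"
begin

abbreviation "D \<equiv> ival a b"
abbreviation "sys \<equiv> isys atLeastLessThan a b \<rho> \<sigma> chi z g"
abbreviation "plus_sys \<equiv> isys greaterThanAtMost a b \<rho> \<sigma> chi z g"

text \<open>The right-hand jumps of \<open>f\<close> and \<open>p\<close>. As \<open>\<sigma>\<close> shares no atom with \<open>\<rho>\<close> and \<open>chi\<close>, adding them changes
  neither \<open>p\<close> in the integrals against \<open>\<sigma>\<close> nor \<open>f\<close> in those against \<open>\<rho>\<close> and \<open>chi\<close>.\<close>

definition jump_f :: "(real \<Rightarrow> complex) \<Rightarrow> real \<Rightarrow> complex" where
  "jump_f p x = cmint \<sigma> {x} p"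

definition jump_p :: "(real \<Rightarrow> complex) \<Rightarrow> real \<Rightarrow> complex" where
  "jump_p f x = cmint chi {x} f - cmint \<rho> {x} (\<lambda>t. z * f t + g t)"

lemma loc_bdd_jump_f: "loc_bdd a b p \<Longrightarrow> loc_bdd a b (jump_f p)"
  unfolding jump_f_def[abs_def] by (rule loc_bdd_atoms[OF lfcms(2) loc_bdd_locL1[OF _ lfcms(2)] ab])

lemma loc_bdd_jump_p: "loc_bdd a b f \<Longrightarrow> loc_bdd a b (jump_p f)"
  unfolding jump_p_def[abs_def]
  by (intro loc_bdd_diff loc_bdd_atoms lfcms loc_bdd_locL1 isys_rhs_locL1 g_loc ab)

lemma jump_f_eq_0: "x \<in> D \<Longrightarrow> measure (cvar \<sigma>) {x} = 0 \<Longrightarrow> jump_f p x = 0"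
  by (simp add: jump_f_def cmint_singleton[OF lfcms(2)])

lemma jump_p_eq_0: "x \<in> D \<Longrightarrow> measure (cvar \<rho>) {x} = 0 \<Longrightarrow> measure (cvar chi) {x} = 0 \<Longrightarrow> jump_p f x = 0"
  by (simp add: jump_p_def cmint_singleton[OF lfcms(1)] cmint_singleton[OF lfcms(3)])

lemma cmint_\<sigma>_jump_p:
  assumes "loc_bdd a b p" "loc_bdd a b q"
    and eq: "\<And>x. x \<in> D \<Longrightarrow> measure (cvar \<rho>) {x} = 0 \<Longrightarrow> measure (cvar chi) {x} = 0 \<Longrightarrow> p x = q x"
    and A: "A \<in> sets borel" "A \<subseteq> {x..y}" "x \<in> D" "y \<in> D"
  shows "cmint \<sigma> A p = cmint \<sigma> A q"
proof (rule cmint_eq_off_null_atoms[OF lfcms(2) loc_bdd_locL1[OF assms(1) lfcms(2)] loc_bdd_locL1[OF assms(2) lfcms(2)] _ _ _ A])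
  let ?N = "{x \<in> D. measure (cvar \<rho>) {x} \<noteq> 0} \<union> {x \<in> D. measure (cvar chi) {x} \<noteq> 0}"
  show "countable ?N" using countable_atoms[OF lfcms(1) ab] countable_atoms[OF lfcms(3) ab] by simp
  show "x \<in> D \<and> measure (cvar \<sigma>) {x} = 0" if "x \<in> ?N" for x using that atoms[of x] by auto
  show "p x = q x" if "x \<in> D" "x \<notin> ?N" for x using that eq by auto
qed

lemma cmint_\<rho>chi_jump_f:
  assumes "loc_bdd a b f" "loc_bdd a b k"
    and eq: "\<And>x. x \<in> D \<Longrightarrow> measure (cvar \<sigma>) {x} = 0 \<Longrightarrow> f x = k x"
    and A: "A \<in> sets borel" "A \<subseteq> {x..y}" "x \<in> D" "y \<in> D"
  shows "cmint chi A f = cmint chi A k"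
    "cmint \<rho> A (\<lambda>t. z * f t + g t) = cmint \<rho> A (\<lambda>t. z * k t + g t)"
proof -
  let ?N = "{x \<in> D. measure (cvar \<sigma>) {x} \<noteq> 0}"
  have N: "countable ?N" by (rule countable_atoms[OF lfcms(2) ab])
  show "cmint chi A f = cmint chi A k"
    by (rule cmint_eq_off_null_atoms[OF lfcms(3) loc_bdd_locL1[OF assms(1) lfcms(3)] loc_bdd_locL1[OF assms(2) lfcms(3)] N _ _ A])
      (use eq atoms in auto)
  show "cmint \<rho> A (\<lambda>t. z * f t + g t) = cmint \<rho> A (\<lambda>t. z * k t + g t)"
    by (rule cmint_eq_off_null_atoms[OF lfcms(1) isys_rhs_locL1[OF assms(1) g_loc lfcms(1)]
        isys_rhs_locL1[OF assms(2) g_loc lfcms(1)] N _ _ A])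
      (use eq atoms in auto)
qed

text \<open>The jump of \<open>f\<close> sees \<open>p\<close> only at atoms of
  \<open>\<sigma>\<close>, where \<open>p\<close> does not jump. So it can be computed from the
  right-continuous version as well, and subtracting jumps undoes adding them.\<close>

lemma jump_f_plus: "loc_bdd a b p \<Longrightarrow> loc_bdd a b f \<Longrightarrow> x \<in> D \<Longrightarrow> jump_f (\<lambda>t. p t + jump_p f t) x = jump_f p x"
  unfolding jump_f_def
  by (rule cmint_\<sigma>_jump_p[where x=x and y=x]) (auto intro: loc_bdd_add loc_bdd_jump_p simp: jump_p_eq_0)

lemma jump_p_plus:
  assumes "loc_bdd a b p" "loc_bdd a b f" "x \<in> D"
  shows "jump_p (\<lambda>t. f t + jump_f p t) x = jump_p f x"
  unfolding jump_p_def
  using cmint_\<rho>chi_jump_f[OF loc_bdd_add[OF assms(2) loc_bdd_jump_f[OF assms(1)]] assms(2), where x=x and y=x and A="{x}"] assms(3)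
  by (simp add: jump_f_eq_0)

text \<open>The end atoms gained and lost in passing to \<open>(x, y]\<close> are absorbed by the
  jumps on the left-hand side; inside the integrals the jumps are invisible.\<close>

lemma plus_sys_of_sys:
  assumes s: "sys f p"
  shows "plus_sys (\<lambda>x. f x + jump_f p x) (\<lambda>x. p x + jump_p f x)"
  unfolding isys_def
proof (intro conjI ballI impI)
  have lb: "loc_bdd a b f" "loc_bdd a b p" using s by (simp_all add: isys_def)
  show f': "loc_bdd a b (\<lambda>x. f x + jump_f p x)" and p': "loc_bdd a b (\<lambda>x. p x + jump_p f x)"
    by (intro loc_bdd_add loc_bdd_jump_f loc_bdd_jump_p lb)+
  fix x y assume xy: "x \<in> D" "y \<in> D" "x \<le> y"
  have sub: "{x<..y} \<subseteq> {x..y}" by auto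
  have e: "f y - f x = cmint \<sigma> {x..<y} p"
    "p y - p x = cmint chi {x..<y} f - cmint \<rho> {x..<y} (\<lambda>t. z * f t + g t)"
    using s xy unfolding isys_def by blast+
  have "cmint \<sigma> {x<..y} (\<lambda>x. p x + jump_p f x) = cmint \<sigma> {x<..y} p"
    by (rule cmint_\<sigma>_jump_p[OF p' lb(2) _ _ sub xy(1,2)]) (simp_all add: jump_p_eq_0)
  then show "(f y + jump_f p y) - (f x + jump_f p x) = cmint \<sigma> {x<..y} (\<lambda>x. p x + jump_p f x)"
    using cmint_Ioc_Ico[OF lfcms(2) loc_bdd_locL1[OF lb(2) lfcms(2)] xy] e(1) by (simp add: jump_f_def algebra_simps)
  have "cmint chi {x<..y} (\<lambda>x. f x + jump_f p x) = cmint chi {x<..y} f"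
    "cmint \<rho> {x<..y} (\<lambda>t. z * (f t + jump_f p t) + g t) = cmint \<rho> {x<..y} (\<lambda>t. z * f t + g t)"
    by (rule cmint_\<rho>chi_jump_f[OF f' lb(1) _ _ sub xy(1,2)]; simp add: jump_f_eq_0)+
  then show "(p y + jump_p f y) - (p x + jump_p f x) = cmint chi {x<..y} (\<lambda>x. f x + jump_f p x)
      - cmint \<rho> {x<..y} (\<lambda>t. z * (f t + jump_f p t) + g t)"
    using cmint_Ioc_Ico[OF lfcms(3) loc_bdd_locL1[OF lb(1) lfcms(3)] xy]
      cmint_Ioc_Ico[OF lfcms(1) isys_rhs_locL1[OF lb(1) g_loc lfcms(1)] xy] e(2) by (simp add: jump_p_def)
qed

lemma sys_of_plus_sys:
  assumes s: "plus_sys f p"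
  shows "sys (\<lambda>x. f x - jump_f p x) (\<lambda>x. p x - jump_p f x)"
  unfolding isys_def
proof (intro conjI ballI impI)
  have lb: "loc_bdd a b f" "loc_bdd a b p" using s by (simp_all add: isys_def)
  show f': "loc_bdd a b (\<lambda>x. f x - jump_f p x)" and p': "loc_bdd a b (\<lambda>x. p x - jump_p f x)"
    by (intro loc_bdd_diff loc_bdd_jump_f loc_bdd_jump_p lb)+
  fix x y assume xy: "x \<in> D" "y \<in> D" "x \<le> y"
  have sub: "{x..<y} \<subseteq> {x..y}" by auto
  have e: "f y - f x = cmint \<sigma> {x<..y} p"
    "p y - p x = cmint chi {x<..y} f - cmint \<rho> {x<..y} (\<lambda>t. z * f t + g t)"
    using s xy unfolding isys_def by blast+
  have "cmint \<sigma> {x..<y} (\<lambda>x. p x - jump_p f x) = cmint \<sigma> {x..<y} p"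
    by (rule cmint_\<sigma>_jump_p[OF p' lb(2) _ _ sub xy(1,2)]) (simp_all add: jump_p_eq_0)
  then show "(f y - jump_f p y) - (f x - jump_f p x) = cmint \<sigma> {x..<y} (\<lambda>x. p x - jump_p f x)"
    using cmint_Ioc_Ico[OF lfcms(2) loc_bdd_locL1[OF lb(2) lfcms(2)] xy] e(1) by (simp add: jump_f_def algebra_simps)
  have "cmint chi {x..<y} (\<lambda>x. f x - jump_f p x) = cmint chi {x..<y} f"
    "cmint \<rho> {x..<y} (\<lambda>t. z * (f t - jump_f p t) + g t) = cmint \<rho> {x..<y} (\<lambda>t. z * f t + g t)"
    by (rule cmint_\<rho>chi_jump_f[OF f' lb(1) _ _ sub xy(1,2)]; simp add: jump_f_eq_0)+
  moreover have "(p y - jump_p f y) - (p x - jump_p f x) = cmint chi {x..<y} f - cmint \<rho> {x..<y} (\<lambda>t. z * f t + g t)"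
  proof -
    have "(p y - jump_p f y) - (p x - jump_p f x) = (p y - p x) - jump_p f y + jump_p f x" by simp
    also have "\<dots> = cmint chi {x..<y} f - cmint \<rho> {x..<y} (\<lambda>t. z * f t + g t)"
      unfolding e(2) jump_p_def cmint_Ioc_Ico[OF lfcms(3) loc_bdd_locL1[OF lb(1) lfcms(3)] xy]
        cmint_Ioc_Ico[OF lfcms(1) isys_rhs_locL1[OF lb(1) g_loc lfcms(1)] xy] by simp
    finally show ?thesis .
  qed
  ultimately show "(p y - jump_p f y) - (p x - jump_p f x) = cmint chi {x..<y} (\<lambda>x. f x - jump_f p x)
      - cmint \<rho> {x..<y} (\<lambda>t. z * (f t - jump_f p t) + g t)"
    by (simp only:)
qed

end

lemma left_tail_atom:
  assumes \<mu>: "lfcm a b \<mu>" and d: "d \<in> ival a b" and h: "set_integrable (cvar \<mu>) (left_part a b d) h"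
  shows "((\<lambda>x. cmint \<mu> {x} h) \<longlongrightarrow> 0) (left_end a)"
proof (rule tendstoI)
  fix \<epsilon> :: real assume "0 < \<epsilon>"
  from order_tendstoD(2)[OF left_tail_norm[OF assms] this] eventually_left_end[OF d]
  have "eventually (\<lambda>x. (LINT t:left_part a b x|cvar \<mu>. cmod (h t)) < \<epsilon> \<and> x \<in> ival a b \<and> x < d) (left_end a)"
    by eventually_elim auto
  from eventually_happens'[OF left_end_neq_bot this]
  \<comment> \<open>\<open>left_part a b x\<close> does not contain \<open>x\<close>, so its tail
    says nothing about the atom there. A fixed \<open>e\<close> with a small tail captures the atoms
    at all \<open>x < e\<close>.\<close>
  obtain e where e: "(LINT t:left_part a b e|cvar \<mu>. cmod (h t)) < \<epsilon>" "e \<in> ival a b" "e < d" by auto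
  have he: "set_integrable (cvar \<mu>) (left_part a b e) h"
    by (rule set_integrable_subset[OF h]) (use e(3) lfcm_sets[OF \<mu>] in \<open>auto simp: left_part_def\<close>)
  show "eventually (\<lambda>x. dist (cmint \<mu> {x} h) 0 < \<epsilon>) (left_end a)"
    using eventually_left_end[OF e(2)]
  proof eventually_elim
    case (elim x)
    have "cmod (cmint \<mu> {x} h) \<le> (LINT t:left_part a b e|cvar \<mu>. cmod (h t))"
      by (rule cmint_norm_le_mono[OF \<mu> he]) (use elim in \<open>auto simp: left_part_def\<close>)
    with e(1) show ?case by simp
  qed
qed

section \<open>Transfer of the left endpoint results to the right endpoint\<close>

locale right_regular = sl_data +
  mir: left_regular "- b" "- a" "mirror \<rho>" "mirror \<sigma>" "mirror chi" z "\<lambda>t. g (- t)"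
begin

lemma right_atom_tail:
  assumes \<mu>: "lfcm a b \<mu>" and h: "locL1 a b \<mu> h" and d: "d \<in> ival (- b) (- a)"
    and hm: "set_integrable (cvar (mirror \<mu>)) (left_part (- b) (- a) d) (\<lambda>t. h (- t))"
  shows "((\<lambda>x. cmint \<mu> {x} h) \<longlongrightarrow> 0) (right_end b)"
  unfolding tendsto_right_end
proof (rule Lim_transform_eventually[OF left_tail_atom[OF lfcm_mirror[OF \<mu>] d hm]])
  show "eventually (\<lambda>x. cmint (mirror \<mu>) {x} (\<lambda>t. h (- t)) = cmint \<mu> {- x} h) (left_end (- b))"
    using eventually_left_end[OF d]
  proof eventually_elim
    case (elim x)
    then have x: "- x \<in> D" by (simp add: uminus_mem_ival)
    have "set_integrable (cvar \<mu>) {- x} h"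
      by (rule locL1_subset[OF h \<mu> x x]) auto
    from cmint_mirror[OF \<mu> this] show ?case by simp
  qed
qed

text \<open>The atoms of the three measures tend to 0 and are multiplied by convergent functions.
  The contribution of \<open>g\<close>, which need not be bounded, is handled through its own
  integrability near \<open>b\<close>.\<close>

lemma right_jump_limits:
  assumes f: "(f \<longlongrightarrow> d1) (right_end b)" and p: "(p \<longlongrightarrow> d2) (right_end b)"
  shows "(jump_f p \<longlongrightarrow> 0) (right_end b)" and "(jump_p f \<longlongrightarrow> 0) (right_end b)"
proof -
  obtain d where d: "d \<in> mir.D" using einterval_nonempty[OF mir.ab] by (auto simp: ival_eq_einterval)
  have ev: "eventually (\<lambda>x. x \<in> D) (right_end b)"
    unfolding right_end_eq eventually_filtermap
    using eventually_left_end[OF d] by eventually_elim (simp add: uminus_mem_ival)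
  have one: "((\<lambda>x. cmint \<mu> {x} (\<lambda>_. 1)) \<longlongrightarrow> 0) (right_end b)"
    if "lfcm a b \<mu>" "lfin (- b) (- a) (mirror \<mu>)" for \<mu>
    by (rule right_atom_tail[OF that(1) loc_bdd_locL1[OF loc_bdd_const that(1)] d])
      (rule lfin_integrable[OF that(2) d, where C=1], auto simp: set_borel_measurable_def)
  note t1 = one[OF lfcms(1) mir.\<rho>] one[OF lfcms(2) mir.\<sigma>] one[OF lfcms(3) mir.chi]
  have tg: "((\<lambda>x. cmint \<rho> {x} g) \<longlongrightarrow> 0) (right_end b)"
    by (rule right_atom_tail[OF lfcms(1) g_loc d mir.g[OF d]])
  have "((\<lambda>x. p x * cmint \<sigma> {x} (\<lambda>_. 1)) \<longlongrightarrow> d2 * 0) (right_end b)"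
    by (intro tendsto_mult p t1)
  then show "(jump_f p \<longlongrightarrow> 0) (right_end b)"
    unfolding mult_zero_right
    by (rule Lim_transform_eventually)
      (rule eventually_mono[OF ev], simp add: jump_f_def cmint_singleton[OF lfcms(2)])
  have "((\<lambda>x. f x * cmint chi {x} (\<lambda>_. 1) - (z * f x * cmint \<rho> {x} (\<lambda>_. 1) + cmint \<rho> {x} g))
      \<longlongrightarrow> d1 * 0 - (z * d1 * 0 + 0)) (right_end b)"
    by (intro tendsto_intros f t1 tg)
  then have "((\<lambda>x. f x * cmint chi {x} (\<lambda>_. 1) - (z * f x * cmint \<rho> {x} (\<lambda>_. 1) + cmint \<rho> {x} g))
      \<longlongrightarrow> 0) (right_end b)" by simp
  then show "(jump_p f \<longlongrightarrow> 0) (right_end b)"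
    by (rule Lim_transform_eventually)
      (rule eventually_mono[OF ev], simp add: jump_p_def cmint_singleton[OF lfcms(1)] cmint_singleton[OF lfcms(3)] algebra_simps)
qed

lemma mir_sys_of_plus_sys:
  assumes "plus_sys f p"
  shows "mir.lsys (\<lambda>t. f (- t)) (\<lambda>t. - p (- t))"
  by (rule isys_mirror[OF assms lfcms g_loc]) auto

lemma plus_sys_of_mir:
  assumes "mir.lsys f p"
  shows "plus_sys (\<lambda>t. f (- t)) (\<lambda>t. - p (- t))"
  using isys_mirror[OF assms mir.lfcms mir.g_loc, where J=greaterThanAtMost]
  by (simp add: mirror_mirror[OF lfcms(1)] mirror_mirror[OF lfcms(2)] mirror_mirror[OF lfcms(3)]
    atLeastLessThan_subseteq_atLeastAtMost_iff)

lemma right_plus_limits: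
  assumes "(f \<longlongrightarrow> d1) (right_end b)" "(p \<longlongrightarrow> d2) (right_end b)"
  shows "((\<lambda>x. f x + jump_f p x) \<longlongrightarrow> d1) (right_end b)" "((\<lambda>x. p x + jump_p f x) \<longlongrightarrow> d2) (right_end b)"
    "((\<lambda>x. f x - jump_f p x) \<longlongrightarrow> d1) (right_end b)" "((\<lambda>x. p x - jump_p f x) \<longlongrightarrow> d2) (right_end b)"
  using tendsto_add[OF assms(1) right_jump_limits(1)[OF assms]] tendsto_add[OF assms(2) right_jump_limits(2)[OF assms]]
    tendsto_diff[OF assms(1) right_jump_limits(1)[OF assms]] tendsto_diff[OF assms(2) right_jump_limits(2)[OF assms]]
  by simp_all

theorem right_exists:
  "\<exists>f p. sys f p \<and> (f \<longlongrightarrow> d1) (right_end b) \<and> (p \<longlongrightarrow> d2) (right_end b)"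
proof -
  \<comment> \<open>Reflection changes the sign of the quasi-derivative, hence the limit
    \<open>- d2\<close>.\<close>
  obtain F P where FP: "mir.lsys F P" "(F \<longlongrightarrow> d1) (left_end (- b))" "(P \<longlongrightarrow> - d2) (left_end (- b))"
    using mir.isys_exists by blast
  have "((\<lambda>t. F (- t)) \<longlongrightarrow> d1) (right_end b)" "((\<lambda>t. - P (- t)) \<longlongrightarrow> d2) (right_end b)"
    using FP(2) tendsto_minus[OF FP(3)] by (simp_all add: tendsto_right_end)
  from right_plus_limits(3,4)[OF this] sys_of_plus_sys[OF plus_sys_of_mir[OF FP(1)]] show ?thesis by blast
qed

theorem right_limits:
  assumes s: "sys f p"
  shows "\<exists>d1. (f \<longlongrightarrow> d1) (right_end b)" "\<exists>d2. (p \<longlongrightarrow> d2) (right_end b)"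
proof -
  have lb: "loc_bdd a b f" "loc_bdd a b p" using s by (simp_all add: isys_def)
  let ?f = "\<lambda>x. f x + jump_f p x" and ?p = "\<lambda>x. p x + jump_p f x"
  note m = mir_sys_of_plus_sys[OF plus_sys_of_sys[OF s]]
  obtain d1 d2 where "((\<lambda>t. ?f (- t)) \<longlongrightarrow> d1) (left_end (- b))" "((\<lambda>t. - ?p (- t)) \<longlongrightarrow> d2) (left_end (- b))"
    using mir.isys_limits[OF m] by blast
  from this(1) tendsto_minus[OF this(2)]
  have "(?f \<longlongrightarrow> d1) (right_end b)" "(?p \<longlongrightarrow> - d2) (right_end b)"
    by (simp_all only: tendsto_right_end minus_minus)
  \<comment> \<open>The jumps are known to vanish only for functions already known to converge. So
    the lemma is applied to \<open>?f\<close> and \<open>?p\<close>, and the jumps computed from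
    these are the original ones.\<close>
  note lim = right_plus_limits(3,4)[OF this]
  obtain d where d: "d \<in> mir.D" using einterval_nonempty[OF mir.ab] by (auto simp: ival_eq_einterval)
  have ev: "eventually (\<lambda>x. x \<in> D) (right_end b)"
    unfolding right_end_eq eventually_filtermap
    using eventually_left_end[OF d] by eventually_elim (simp add: uminus_mem_ival)
  have "(f \<longlongrightarrow> d1) (right_end b)"
    by (rule Lim_transform_eventually[OF lim(1)], rule eventually_mono[OF ev]) (simp add: jump_f_plus lb)
  moreover have "(p \<longlongrightarrow> - d2) (right_end b)"
    by (rule Lim_transform_eventually[OF lim(2)], rule eventually_mono[OF ev]) (simp add: jump_p_plus lb)
  ultimately show "\<exists>d1. (f \<longlongrightarrow> d1) (right_end b)" "\<exists>d2. (p \<longlongrightarrow> d2) (right_end b)" by blast+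
qed

theorem right_unique:
  assumes s: "sys f p" "(f \<longlongrightarrow> d1) (right_end b)" "(p \<longlongrightarrow> d2) (right_end b)"
    and s': "sys f' p'" "(f' \<longlongrightarrow> d1) (right_end b)" "(p' \<longlongrightarrow> d2) (right_end b)"
    and x: "x \<in> D"
  shows "f x = f' x" "p x = p' x"
proof -
  have lb: "loc_bdd a b f" "loc_bdd a b p" "loc_bdd a b f'" "loc_bdd a b p'"
    using s(1) s'(1) by (simp_all add: isys_def)
  have lim: "((\<lambda>t. h (- t) + jump_f k (- t)) \<longlongrightarrow> d1) (left_end (- b))" "((\<lambda>t. - (k (- t) + jump_p h (- t))) \<longlongrightarrow> - d2) (left_end (- b))"
    if "(h \<longlongrightarrow> d1) (right_end b)" "(k \<longlongrightarrow> d2) (right_end b)" for h k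
    using right_plus_limits(1)[OF that] tendsto_minus[OF right_plus_limits(2)[OF that, unfolded tendsto_right_end]]
    by (simp_all only: tendsto_right_end)
  have mx: "- x \<in> mir.D" using x by (simp add: uminus_mem_ival)
  have "f x + jump_f p x = f' x + jump_f p' x" "p x + jump_p f x = p' x + jump_p f' x"
    using mir.isys_unique[OF mir_sys_of_plus_sys[OF plus_sys_of_sys[OF s(1)]] lim[OF s(2,3)]
       mir_sys_of_plus_sys[OF plus_sys_of_sys[OF s'(1)]] lim[OF s'(2,3)] mx] by (simp_all only: minus_minus neg_equal_iff_equal)
  \<comment> \<open>A jump at \<open>x\<close> depends only on the value at \<open>x\<close> of the
    right-continuous version, and these values have just been identified.\<close>
  moreover from this have "jump_f p x = jump_f p' x" "jump_p f x = jump_p f' x"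
    using jump_f_plus[OF lb(2,1) x] jump_f_plus[OF lb(4,3) x] jump_p_plus[OF lb(2,1) x] jump_p_plus[OF lb(4,3) x] x
    by (auto simp: jump_f_def jump_p_def cmint_singleton[OF lfcms(1)] cmint_singleton[OF lfcms(2)] cmint_singleton[OF lfcms(3)])
  ultimately show "f x = f' x" "p x = p' x" by simp_all
qed

theorem right_real:
  assumes s: "sys f p" "(f \<longlongrightarrow> d1) (right_end b)" "(p \<longlongrightarrow> d2) (right_end b)"
    and re: "real_data \<rho> \<sigma> chi z g" "d1 \<in> \<real>" "d2 \<in> \<real>" and x: "x \<in> D"
  shows "f x \<in> \<real>" "p x \<in> \<real>"
proof -
  have c: "sys (\<lambda>x. cnj (f x)) (\<lambda>x. cnj (p x))"
    by (rule isys_cnj[OF s(1) lfcms g_loc re(1)])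
  have t: "((\<lambda>x. cnj (f x)) \<longlongrightarrow> d1) (right_end b)" "((\<lambda>x. cnj (p x)) \<longlongrightarrow> d2) (right_end b)"
    using tendsto_cnj[OF s(2)] tendsto_cnj[OF s(3)] re(2,3) by (simp_all add: Reals_cnj_iff)
  have "cnj (f x) = f x" "cnj (p x) = p x"
    by (rule right_unique[OF c t s x])+
  then show "f x \<in> \<real>" "p x \<in> \<real>" by (simp_all add: Reals_cnj_iff)
qed

end

subsection \<open>Solutions of the differential equation\<close>

lemma cint_diff:
  assumes \<mu>: "lfcm a b \<mu>" and h: "locL1 a b \<mu> h"
    and D: "c \<in> ival a b" "x \<in> ival a b" "y \<in> ival a b" and xy: "x \<le> y"
  shows "cint \<mu> c y h - cint \<mu> c x h = cmint \<mu> {x..<y} h"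
proof -
  have i: "set_integrable (cvar \<mu>) {s..<t} h" if "s \<in> ival a b" "t \<in> ival a b" for s t
    by (rule locL1_subset[OF h \<mu> that]) auto
  have split: "cmint \<mu> {r..<t} h = cmint \<mu> {r..<s} h + cmint \<mu> {s..<t} h"
    if "r \<in> ival a b" "s \<in> ival a b" "t \<in> ival a b" "r \<le> s" "s \<le> t" for r s t
  proof -
    have "{r..<t} = {r..<s} \<union> {s..<t}" using that(4,5) by auto
    then show ?thesis by (simp add: cmint_Un[OF \<mu> i[OF that(1,2)] i[OF that(2,3)]])
  qed
  consider "c \<le> x" | "x \<le> c" "c \<le> y" | "y \<le> c" by linarith
  then show ?thesis
  proof cases
    case 1
    then show ?thesis using split[OF D 1 xy] xy by (auto simp: cint_eq_cmint)
  next
    case 2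
    then show ?thesis using split[OF D(2,1,3) 2] by (auto simp: cint_eq_cmint)
  next
    case 3
    then show ?thesis using split[OF D(2,3,1) xy 3] xy by (auto simp: cint_eq_cmint)
  qed
qed

lemma loc_bdd_cint:
  assumes \<mu>: "lfcm a b \<mu>" and h: "locL1 a b \<mu> h" and c: "c \<in> ival a b"
  shows "loc_bdd a b (\<lambda>x. cint \<mu> c x h)"
proof -
  have ab: "a < b" by (rule ival_less[OF c])
  \<comment> \<open>At most one of the two sets is nonempty, so the difference reproduces all three
    cases of \<open>cint\<close> in one measurable expression.\<close>
  let ?k = "\<lambda>x. cmint \<mu> {t. t \<in> ival a b \<and> c \<le> t \<and> t < x} h - cmint \<mu> {t. t \<in> ival a b \<and> x \<le> t \<and> t < c} h"
  have "?k \<in> borel_measurable borel"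
  proof (intro borel_measurable_diff cmint_param_measurable[OF \<mu> ab locL1_set_borel_measurable[OF h \<mu> ab]])
    show "Measurable.pred (borel \<Otimes>\<^sub>M borel) (\<lambda>(x, t). t \<in> ival a b \<and> c \<le> t \<and> t < x)"
      "Measurable.pred (borel \<Otimes>\<^sub>M borel) (\<lambda>(x, t). t \<in> ival a b \<and> x \<le> t \<and> t < c)"
      by measurable
  qed auto
  then have "set_borel_measurable borel (ival a b) ?k"
    unfolding set_borel_measurable_def by measurable
  moreover have "?k x = cint \<mu> c x h" if x: "x \<in> ival a b" for x
  proof -
    have "{t. t \<in> ival a b \<and> c \<le> t \<and> t < x} = {c..<x}" "{t. t \<in> ival a b \<and> x \<le> t \<and> t < c} = {x..<c}"
      using ival_Icc_subset[OF c x] ival_Icc_subset[OF x c] by auto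
    then show ?thesis by (auto simp: cint_eq_cmint)
  qed
  then have "(\<lambda>x. indicat_real (ival a b) x *\<^sub>R ?k x) = (\<lambda>x. indicat_real (ival a b) x *\<^sub>R cint \<mu> c x h)"
    by (intro ext) (auto simp: indicator_def)
  ultimately have m: "set_borel_measurable borel (ival a b) (\<lambda>x. cint \<mu> c x h)"
    by (simp add: set_borel_measurable_def)
  have "\<exists>C. \<forall>t\<in>{x..y}. cmod (cint \<mu> c t h) \<le> C" if xy: "x \<in> ival a b" "y \<in> ival a b" for x y
  proof (intro exI ballI)
    fix t assume t: "t \<in> {x..y}"
    let ?K = "{min c x..max c y}"
    have K: "min c x \<in> ival a b" "max c y \<in> ival a b" using c xy by (auto simp: min_def max_def)
    have iK: "set_integrable (cvar \<mu>) ?K h" by (rule locL1_subset[OF h \<mu> K]) auto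
    have "0 \<le> (LINT t:?K|cvar \<mu>. cmod (h t))" by (simp add: set_lebesgue_integral_def)
    moreover have "{c..<t} \<subseteq> ?K" "{t..<c} \<subseteq> ?K" using t by (auto simp: min_le_iff_disj)
    ultimately show "cmod (cint \<mu> c t h) \<le> (LINT t:?K|cvar \<mu>. cmod (h t))"
      using cmint_norm_le_mono[OF \<mu> iK, of "{c..<t}"] cmint_norm_le_mono[OF \<mu> iK, of "{t..<c}"]
      unfolding cint_eq_cmint by simp
  qed
  with m show ?thesis by (simp add: loc_bdd_def)
qed

lemma is_rn_deriv_loc_bdd:
  assumes "lfcm a b \<mu>" "c \<in> ival a b" "is_rn_deriv a b \<mu> c f h"
  shows "loc_bdd a b f"
proof -
  have "loc_bdd a b (\<lambda>x. f c + cint \<mu> c x h)"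
    by (intro loc_bdd_add loc_bdd_const loc_bdd_cint) (use assms in \<open>auto simp: is_rn_deriv_def\<close>)
  then show ?thesis
    by (rule loc_bdd_cong[THEN iffD1, rotated]) (use assms(3) in \<open>simp add: is_rn_deriv_def\<close>)
qed

lemma is_rn_deriv_diff:
  assumes "lfcm a b \<mu>" "c \<in> ival a b" "is_rn_deriv a b \<mu> c f h" "x \<in> ival a b" "y \<in> ival a b" "x \<le> y"
  shows "f y - f x = cmint \<mu> {x..<y} h"
proof -
  have "f x = f c + cint \<mu> c x h" "f y = f c + cint \<mu> c y h" "locL1 a b \<mu> h"
    using assms unfolding is_rn_deriv_def by blast+
  with cint_diff[OF assms(1) _ assms(2,4-6)] show ?thesis by simp
qed

lemma is_rn_derivI:
  assumes \<mu>: "lfcm a b \<mu>" and c: "c \<in> ival a b" and h: "locL1 a b \<mu> h"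
    and d: "\<And>x y. x \<in> ival a b \<Longrightarrow> y \<in> ival a b \<Longrightarrow> x \<le> y \<Longrightarrow> f y - f x = cmint \<mu> {x..<y} h"
  shows "is_rn_deriv a b \<mu> c f h"
  unfolding is_rn_deriv_def
proof (intro conjI ballI h)
  fix x assume x: "x \<in> ival a b"
  show "f x = f c + cint \<mu> c x h"
    using d[OF x c] d[OF c x] by (cases "x \<le> c") (auto simp: cint_eq_cmint algebra_simps)
qed

text \<open>Half-lines are stable under intersection and generate the Borel sets. The vanishing
  total integral gives closure under complements, so the integral vanishes over every Borel
  set.\<close>

lemma set_integral_Iio_zero_imp_AE_zero:
  fixes k :: "real \<Rightarrow> complex"
  assumes "sigma_finite_measure M" and s: "sets M = sets borel" and k: "integrable M k"
    and "LINT t|M. k t = 0" and Iio: "\<And>x. (LINT t:{..<x}|M. k t) = 0"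
  shows "AE t in M. k t = 0"
proof (rule sigma_finite_measure.density_zero[OF assms(1) k])
  have kA: "set_integrable M A k" if "A \<in> sets borel" for A
    unfolding set_integrable_def by (rule integrable_mult_indicator[OF _ k]) (simp add: s that)
  have sp: "space M = UNIV" using sets_eq_imp_space_eq[OF s] by simp
  fix A assume "A \<in> sets M"
  then have A: "A \<in> sigma_sets UNIV (range lessThan)"
    unfolding s by (simp add: borel_Iio)
  have "Int_stable (range (lessThan :: real \<Rightarrow> real set))"
  proof (rule Int_stableI)
    fix A B assume "A \<in> range (lessThan :: real \<Rightarrow> real set)" "B \<in> range (lessThan :: real \<Rightarrow> real set)"
    then obtain u v :: real where "A = {..<u}" "B = {..<v}" by auto
    then have "A \<inter> B = {..<min u v}" by auto
    then show "A \<inter> B \<in> range lessThan" by blast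
  qed
  moreover have "range (lessThan :: real \<Rightarrow> real set) \<subseteq> Pow UNIV" by simp
  ultimately show "(LINT t:A|M. k t) = 0"
    using A
  proof (induction rule: sigma_sets_induct_disjoint)
    case (compl A)
    have A: "A \<in> sets borel" using compl.hyps by (simp add: borel_Iio)
    have "(LINT t:A \<union> (UNIV - A)|M. k t) = (LINT t:A|M. k t) + (LINT t:UNIV - A|M. k t)"
      by (rule set_integral_Un) (use A in \<open>auto intro!: kA\<close>)
    moreover have "(LINT t:A \<union> (UNIV - A)|M. k t) = 0"
      using assms(4) by (simp add: set_lebesgue_integral_def Un_absorb1)
    ultimately show ?case using compl.IH by simp
  next
    case (union A)
    have A: "A i \<in> sets borel" for i using union.hyps(2) by (auto simp: borel_Iio)
    have "(LINT t:(\<Union>i. A i)|M. k t) = (\<Sum>i. LINT t:A i|M. k t)"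
      by (rule lebesgue_integral_countable_add)
        (use A union.hyps(1) in \<open>auto simp: s disjoint_family_on_def intro!: kA\<close>)
    then show ?case using union.IH by simp
  qed (use Iio in \<open>auto simp: set_lebesgue_integral_def\<close>)
qed

lemma is_rn_deriv_unique:
  assumes \<mu>: "lfcm a b \<mu>" and c: "c \<in> ival a b" and h: "is_rn_deriv a b \<mu> c f h1" "is_rn_deriv a b \<mu> c f h2"
  shows "AE t in cvar \<mu>. h1 t = h2 t"
proof (rule AE_ival_compacts[OF \<mu> ival_less[OF c]])
  fix x y assume x: "x \<in> ival a b" and y: "y \<in> ival a b"
  note s = lfcm_sets[OF \<mu>]
  \<comment> \<open>The known integrals are over \<open>[u, v)\<close>, which misses its right end.
    Moving it past \<open>y\<close> covers a possible atom at \<open>y\<close>.\<close>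
  obtain y' where y': "y < y'" "y' \<in> ival a b"
  proof -
    have "ereal y < b" using y by (simp add: ival_def)
    from ereal_dense2[OF this] obtain r where "ereal y < ereal r" "ereal r < b" by auto
    then show thesis using y that[of r] less_trans[of a "ereal y" "ereal r"] by (auto simp: ival_def)
  qed
  let ?h = "\<lambda>t. h1 t - h2 t"
  have L: "locL1 a b \<mu> h1" "locL1 a b \<mu> h2" using h by (simp_all add: is_rn_deriv_def)
  have i: "set_integrable (cvar \<mu>) {u..<v} h1" "set_integrable (cvar \<mu>) {u..<v} h2"
    if "u \<in> ival a b" "v \<in> ival a b" for u v
    by (rule locL1_subset[OF L(1) \<mu> that] locL1_subset[OF L(2) \<mu> that]; auto)+
  have zero: "cmint \<mu> {u..<v} ?h = 0" if "u \<in> ival a b" "v \<in> ival a b" for u v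
  proof (cases "u \<le> v")
    case True
    then show ?thesis
      using is_rn_deriv_diff[OF \<mu> c h(1) that True] is_rn_deriv_diff[OF \<mu> c h(2) that True]
      by (simp add: cmint_diff[OF \<mu> i[OF that]])
  qed simp
  \<comment> \<open>With this cut-off \<open>k\<close> is integrable on the line, and its half-line
    integrals are integrals over \<open>[x, min y' v)\<close>, hence 0.\<close>
  define k where "k t = indicat_real {x..<y'} t *\<^sub>R (?h t * snd \<mu> t)" for t
  have "AE t in cvar \<mu>. k t = 0"
  proof (rule set_integral_Iio_zero_imp_AE_zero[OF lfcm_sigma_finite[OF \<mu> ival_less[OF c]] s])
    show "integrable (cvar \<mu>) k"
      unfolding k_def[abs_def]
      using set_integrable_phase[OF \<mu> set_integral_diff(1)[OF i[OF x y'(2)]]] by (simp add: set_integrable_def)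
    show "LINT t|cvar \<mu>. k t = 0"
      using zero[OF x y'(2)] by (simp add: k_def cmint_def set_lebesgue_integral_def)
    fix v
    have "(LINT t:{..<v}|cvar \<mu>. k t) = cmint \<mu> ({x..<y'} \<inter> {..<v}) ?h"
      unfolding k_def cmint_def set_lebesgue_integral_def
      by (intro Bochner_Integration.integral_cong) (auto simp: indicator_def)
    also have "{x..<y'} \<inter> {..<v} = {x..<min y' v}" by auto
    also have "cmint \<mu> {x..<min y' v} ?h = 0"
    proof (cases "x \<le> v")
      case True
      have "min y' v \<in> ival a b"
        using True x y'(2) by (cases "y' \<le> v") (auto simp: min_def intro: ival_mem_between[OF x y'(2)])
      then show ?thesis by (rule zero[OF x])
    qed (simp add: min_def)
    finally show "(LINT t:{..<v}|cvar \<mu>. k t) = 0" .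
  qed
  then show "AE t in cvar \<mu>. t \<in> {x..y} \<longrightarrow> h1 t = h2 t"
  proof eventually_elim
    case (elim t)
    have "snd \<mu> t \<noteq> 0" using lfcm_norm_phase[OF \<mu>, of t] by auto
    with elim y'(1) show ?case by (auto simp: k_def)
  qed
qed

section \<open>Equivalence of the differential equation and the system\<close>

locale sl_tau = sl_data +
  fixes c :: real
  assumes supp: "csupp a b \<sigma> = ival a b" and c: "c \<in> ival a b"
begin

abbreviation "solves \<equiv> tau_solves a b \<rho> \<sigma> chi c z g"
abbreviation "quasi_deriv \<equiv> qd1 a b \<rho> \<sigma> chi c"

text \<open>Two candidates agree on a \<open>|\<sigma>|\<close>-conull set, which is dense since \<open>\<sigma>\<close> has full support;
  left continuity then forces equality everywhere.\<close>

lemma qd_rel_unique: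
  assumes F1: "qd_rel a b \<rho> \<sigma> chi c f F1" and F2: "qd_rel a b \<rho> \<sigma> chi c f F2"
  shows "F1 = F2"
proof
  fix x
  show "F1 x = F2 x"
  proof (cases "x \<in> D")
    case False
    then show ?thesis using F1 F2 by (simp add: qd_rel_def)
  next
    case x: True
    obtain h1 h2 where h: "is_rn_deriv a b \<sigma> c f h1" "is_rn_deriv a b \<sigma> c f h2"
      and F: "AE x in cvar \<sigma>. F1 x = - h1 x + cint chi c x f" "AE x in cvar \<sigma>. F2 x = - h2 x + cint chi c x f"
      using F1 F2 by (auto simp: qd_rel_def)
    have AE: "AE t in cvar \<sigma>. F1 t = F2 t"
      using is_rn_deriv_unique[OF lfcms(2) c h] F by eventually_elim simp
    obtain H1 H2 where H: "is_rn_deriv a b \<rho> c F1 H1" "is_rn_deriv a b \<rho> c F2 H2"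
      using F1 F2 by (auto simp: qd_rel_def ACloc_def)
    then have L: "locL1 a b \<rho> H1" "locL1 a b \<rho> H2" by (auto simp: is_rn_deriv_def)
    obtain l where l: "l < x" "l \<in> D"
    proof -
      have "a < ereal x" using x by (simp add: ival_def)
      from ereal_dense2[OF this] obtain r where "a < ereal r" "ereal r < ereal x" by auto
      then show thesis using x that[of r] less_trans[of "ereal r" "ereal x" b] by (auto simp: ival_def)
    qed
    have i: "set_integrable (cvar \<rho>) {t..<x} H1" "set_integrable (cvar \<rho>) {t..<x} H2" if "t \<in> D" for t
      by (rule locL1_subset[OF L(1) lfcms(1) that x] locL1_subset[OF L(2) lfcms(1) that x]; auto)+
    \<comment> \<open>Points increasing to \<open>x\<close>, kept in the interval by
      \<open>l\<close>. If \<open>F1\<close> and \<open>F2\<close> agree somewhere in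
      \<open>(m n, x)\<close>, their difference at \<open>x\<close> is at most an integral over
      \<open>[m n, x)\<close>, and these sets shrink to the empty set.\<close>
    define m where "m n = max l (x - 1 / real (Suc n))" for n
    have m: "l \<le> m n" "m n < x" for n using l(1) by (simp_all add: m_def)
    have mD: "m n \<in> D" for n using ival_mem_between[OF l(2) x] m[of n] by auto
    let ?H = "\<lambda>t. H1 t - H2 t"
    have iH: "set_integrable (cvar \<rho>) {t..<x} ?H" if "t \<in> D" for t using i[OF that] by auto
    have small: "cmod (F1 x - F2 x) \<le> (LINT t:{m n..<x}|cvar \<rho>. cmod (?H t))" for n
    proof -
      \<comment> \<open>The midpoint makes \<open>(m n, x)\<close> a ball around a point of the
        support, so it has positive mass.\<close>
      define y where "y = (m n + x) / 2"
      have yD: "y \<in> D" using ival_mem_between[OF mD x, of n] m(2)[of n] by (simp add: y_def)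
      have ball: "ball y ((x - m n) / 2) = {m n<..<x}"
        by (simp add: ball_eq_greaterThanLessThan y_def field_simps)
      have "y \<in> csupp a b \<sigma>" using yD supp by simp
      then have nz: "emeasure (cvar \<sigma>) {m n<..<x} \<noteq> 0"
        using m(2)[of n] unfolding csupp_def ball[symmetric] by auto
      have "\<exists>t\<in>{m n<..<x}. F1 t = F2 t"
      proof (rule ccontr)
        assume "\<not> ?thesis"
        with AE have "AE t in cvar \<sigma>. t \<notin> {m n<..<x}" by (auto elim: eventually_mono)
        then have "emeasure (cvar \<sigma>) {m n<..<x} = 0"
          by (subst (asm) AE_iff_measurable[where N="{m n<..<x}"]) (auto simp: lfcm_sets[OF lfcms(2)] lfcm_space[OF lfcms(2)])
        with nz show False by simp
      qed
      then obtain t where t: "m n < t" "t < x" "F1 t = F2 t" by auto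
      have tD: "t \<in> D" using ival_mem_between[OF mD x, of n] t by simp
      have "F1 x - F2 x = (F1 x - F1 t) - (F2 x - F2 t)" using t(3) by simp
      also have "\<dots> = cmint \<rho> {t..<x} ?H"
        using is_rn_deriv_diff[OF lfcms(1) c H(1) tD x] is_rn_deriv_diff[OF lfcms(1) c H(2) tD x] t(2)
        by (simp add: cmint_diff[OF lfcms(1) i[OF tD]])
      finally show ?thesis
        using cmint_norm_le_mono[OF lfcms(1) iH[OF mD], of "{t..<x}"] t(1) by simp
    qed
    have "(\<lambda>n. LINT t:{m n..<x}|cvar \<rho>. cmod (?H t)) \<longlonglongrightarrow> (LINT t:(\<Inter>n. {m n..<x})|cvar \<rho>. cmod (?H t))"
    proof (rule set_integral_cont_down)
      show "decseq (\<lambda>n. {m n..<x})"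
        unfolding decseq_def
      proof (intro allI impI)
        fix i j :: nat assume "i \<le> j"
        then have "m i \<le> m j" unfolding m_def by (intro max.mono diff_left_mono divide_left_mono) auto
        then show "{m j..<x} \<subseteq> {m i..<x}" by auto
      qed
      show "set_integrable (cvar \<rho>) {m 0..<x} (\<lambda>t. cmod (?H t))"
        by (rule set_integrable_norm_complex[OF iH[OF mD]])
    qed (simp add: lfcm_sets[OF lfcms(1)])
    also have "(\<Inter>n. {m n..<x}) = {}"
    proof -
      have "\<exists>n. t < m n" if t: "t < x" for t
      proof -
        obtain n where "inverse (real (Suc n)) < x - t" using reals_Archimedean[of "x - t"] t by auto
        then show ?thesis by (intro exI[of _ n]) (simp add: m_def inverse_eq_divide)
      qed
      then show ?thesis by (fastforce simp: not_le[symmetric])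
    qed
    finally have "(\<lambda>n. LINT t:{m n..<x}|cvar \<rho>. cmod (?H t)) \<longlonglongrightarrow> 0"
      by (simp add: set_lebesgue_integral_def)
    then have "cmod (F1 x - F2 x) \<le> 0"
      by (rule LIMSEQ_le_const) (use small in auto)
    then show ?thesis by simp
  qed
qed

lemma quasiF_eq: "qd_rel a b \<rho> \<sigma> chi c f F \<Longrightarrow> quasiF a b \<rho> \<sigma> chi c f = F"
  unfolding quasiF_def by (rule the_equality) (auto intro: qd_rel_unique)

text \<open>The identities behind \<open>\<tau>\<close> hold only almost everywhere, but they are
  used under integrals, so the integrated system holds at every pair of points.\<close>

theorem solves_imp_sys:
  assumes "solves f"
  shows "sys f (quasi_deriv f)"
proof -
  obtain F where F: "qd_rel a b \<rho> \<sigma> chi c f F"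
    using assms by (auto simp: tau_solves_def Dtau_def)
  have qF: "quasiF a b \<rho> \<sigma> chi c f = F" by (rule quasiF_eq[OF F])
  obtain H where H: "is_rn_deriv a b \<rho> c F H" and He: "AE x in cvar \<rho>. H x - z * f x = g x"
    using assms by (auto simp: tau_solves_def qF)
  obtain h where h: "is_rn_deriv a b \<sigma> c f h" and he: "AE x in cvar \<sigma>. F x = - h x + cint chi c x f"
    using F by (auto simp: qd_rel_def)
  have qd: "quasi_deriv f x = cint chi c x f - F x" for x by (simp add: qd1_def qF)
  have f_bdd: "loc_bdd a b f" by (rule is_rn_deriv_loc_bdd[OF lfcms(2) c h])
  have F_bdd: "loc_bdd a b F" by (rule is_rn_deriv_loc_bdd[OF lfcms(1) c H])
  have L: "locL1 a b chi f" by (rule loc_bdd_locL1[OF f_bdd lfcms(3)])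
  have lp: "loc_bdd a b (quasi_deriv f)"
    unfolding qd[abs_def] by (intro loc_bdd_diff loc_bdd_cint F_bdd lfcms(3) L c)
  show ?thesis
    unfolding isys_def
  proof (intro conjI ballI impI f_bdd lp)
    fix x y assume xy: "x \<in> D" "y \<in> D" "x \<le> y"
    have i: "set_integrable (cvar \<mu>) {x..<y} k" if "locL1 a b \<mu> k" "lfcm a b \<mu>" for \<mu> k
      by (rule locL1_subset[OF that xy(1,2)]) auto
    have "cmint \<sigma> {x..<y} h = cmint \<sigma> {x..<y} (quasi_deriv f)"
      by (rule cmint_cong_AE[OF lfcms(2) i[OF _ lfcms(2)] i[OF loc_bdd_locL1[OF lp lfcms(2)] lfcms(2)]])
        (use h he in \<open>auto simp: is_rn_deriv_def qd elim!: eventually_mono\<close>)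
    then show "f y - f x = cmint \<sigma> {x..<y} (quasi_deriv f)"
      using is_rn_deriv_diff[OF lfcms(2) c h xy] by simp
    have "cmint \<rho> {x..<y} H = cmint \<rho> {x..<y} (\<lambda>t. z * f t + g t)"
      by (rule cmint_cong_AE[OF lfcms(1) i[OF _ lfcms(1)] i[OF isys_rhs_locL1[OF f_bdd g_loc lfcms(1)] lfcms(1)]])
        (use H He in \<open>auto simp: is_rn_deriv_def algebra_simps elim!: eventually_mono\<close>)
    then show "quasi_deriv f y - quasi_deriv f x = cmint chi {x..<y} f - cmint \<rho> {x..<y} (\<lambda>t. z * f t + g t)"
      using is_rn_deriv_diff[OF lfcms(1) c H xy] cint_diff[OF lfcms(3) L c xy] by (simp add: qd algebra_simps)
  qed
qed

theorem sys_imp_solves: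
  assumes s: "sys f p"
  shows "solves f" "x \<in> D \<Longrightarrow> quasi_deriv f x = p x"
proof -
  have lb: "loc_bdd a b f" "loc_bdd a b p" using s by (simp_all add: isys_def)
  have L: "locL1 a b chi f" by (rule loc_bdd_locL1[OF lb(1) lfcms(3)])
  have e: "f y - f x = cmint \<sigma> {x..<y} p"
    "p y - p x = cmint chi {x..<y} f - cmint \<rho> {x..<y} (\<lambda>t. z * f t + g t)"
    if "x \<in> D" "y \<in> D" "x \<le> y" for x y
    using s that unfolding isys_def by blast+
  \<comment> \<open>The definition of the quasi-derivative solved for \<open>F\<close>, with the
    value 0 outside that \<open>qd_rel\<close> demands. The terms with \<open>chi\<close> cancel in
    its increments, leaving \<open>z * f t + g t\<close> as density against
    \<open>\<rho>\<close>.\<close>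
  define F where "F x = (if x \<in> D then cint chi c x f - p x else 0)" for x
  have h: "is_rn_deriv a b \<sigma> c f p"
    by (rule is_rn_derivI[OF lfcms(2) c loc_bdd_locL1[OF lb(2) lfcms(2)] e(1)])
  have H: "is_rn_deriv a b \<rho> c F (\<lambda>t. z * f t + g t)"
  proof (rule is_rn_derivI[OF lfcms(1) c isys_rhs_locL1[OF lb(1) g_loc lfcms(1)]])
    fix x y assume xy: "x \<in> D" "y \<in> D" "x \<le> y"
    show "F y - F x = cmint \<rho> {x..<y} (\<lambda>t. z * f t + g t)"
      using e(2)[OF xy] cint_diff[OF lfcms(3) L c xy] xy by (simp add: F_def algebra_simps)
  qed
  have rel: "qd_rel a b \<rho> \<sigma> chi c f F"
    unfolding qd_rel_def ACloc_def
  proof (intro conjI exI)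
    show "AE x in cvar \<sigma>. F x = - p x + cint chi c x f"
      using lfcm_AE_ival[OF lfcms(2)] by eventually_elim (simp add: F_def)
  qed (use h H in \<open>auto simp: F_def\<close>)
  have qF: "quasiF a b \<rho> \<sigma> chi c f = F" by (rule quasiF_eq[OF rel])
  show "solves f"
    unfolding tau_solves_def Dtau_def qF using rel H by auto
  show "quasi_deriv f x = p x" if "x \<in> D" using that by (simp add: qd1_def qF F_def)
qed

text \<open>Formulated for a filter \<open>E\<close> so that both endpoints are instances; all that
  enters is the theory of the system along \<open>E\<close>.\<close>

theorem boundary_value_problem:
  fixes E :: "real filter"
  assumes ev: "eventually (\<lambda>x. x \<in> D) E"
    and lim: "\<And>f p. sys f p \<Longrightarrow> (\<exists>L. (f \<longlongrightarrow> L) E) \<and> (\<exists>L. (p \<longlongrightarrow> L) E)"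
    and ex: "\<And>d1 d2. \<exists>f p. sys f p \<and> (f \<longlongrightarrow> d1) E \<and> (p \<longlongrightarrow> d2) E"
    and uniq: "\<And>f p f' p' d1 d2 x. \<lbrakk>sys f p; (f \<longlongrightarrow> d1) E; (p \<longlongrightarrow> d2) E;
        sys f' p'; (f' \<longlongrightarrow> d1) E; (p' \<longlongrightarrow> d2) E; x \<in> D\<rbrakk> \<Longrightarrow> f x = f' x"
    and re: "\<And>f p d1 d2 x. \<lbrakk>sys f p; (f \<longlongrightarrow> d1) E; (p \<longlongrightarrow> d2) E;
        real_data \<rho> \<sigma> chi z g; d1 \<in> \<real>; d2 \<in> \<real>; x \<in> D\<rbrakk> \<Longrightarrow> f x \<in> \<real>"
  shows "(\<forall>f. solves f \<longrightarrow> (\<exists>L. (f \<longlongrightarrow> L) E) \<and> (\<exists>L. (quasi_deriv f \<longlongrightarrow> L) E))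
    \<and> (\<forall>d1 d2. \<exists>f. solves f \<and> (f \<longlongrightarrow> d1) E \<and> (quasi_deriv f \<longlongrightarrow> d2) E
        \<and> (\<forall>f'. solves f' \<and> (f' \<longlongrightarrow> d1) E \<and> (quasi_deriv f' \<longlongrightarrow> d2) E \<longrightarrow> (\<forall>x\<in>D. f' x = f x)))
    \<and> (real_cm a b \<rho> \<and> real_cm a b \<sigma> \<and> real_cm a b chi \<and> (AE x in cvar \<rho>. g x \<in> \<real>) \<and> z \<in> \<real> \<longrightarrow>
        (\<forall>d1 d2 f. d1 \<in> \<real> \<and> d2 \<in> \<real> \<and> solves f \<and> (f \<longlongrightarrow> d1) E \<and> (quasi_deriv f \<longlongrightarrow> d2) E
           \<longrightarrow> (\<forall>x\<in>D. f x \<in> \<real>)))"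
proof (intro conjI allI impI)
  fix d1 d2
  obtain f p where fp: "sys f p" "(f \<longlongrightarrow> d1) E" "(p \<longlongrightarrow> d2) E" using ex by blast
  note f = sys_imp_solves[OF fp(1)]
  \<comment> \<open>\<open>quasi_deriv f\<close> is known to equal \<open>p\<close> on
    \<open>D\<close> only, which suffices because \<open>E\<close> is eventually in
    \<open>D\<close>.\<close>
  have qf: "(quasi_deriv f \<longlongrightarrow> d2) E"
    by (rule Lim_transform_eventually[OF fp(3)]) (use ev f(2) in \<open>auto elim: eventually_mono\<close>)
  have "f' x = f x" if "solves f'" "(f' \<longlongrightarrow> d1) E" "(quasi_deriv f' \<longlongrightarrow> d2) E" "x \<in> D" for f' x
    by (rule uniq[OF solves_imp_sys[OF that(1)] that(2,3) fp that(4)])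
  then show "\<exists>f. solves f \<and> (f \<longlongrightarrow> d1) E \<and> (quasi_deriv f \<longlongrightarrow> d2) E
        \<and> (\<forall>f'. solves f' \<and> (f' \<longlongrightarrow> d1) E \<and> (quasi_deriv f' \<longlongrightarrow> d2) E \<longrightarrow> (\<forall>x\<in>D. f' x = f x))"
    using f(1) fp(2) qf by blast
next
  fix d1 d2 f
  assume r: "real_cm a b \<rho> \<and> real_cm a b \<sigma> \<and> real_cm a b chi \<and> (AE x in cvar \<rho>. g x \<in> \<real>) \<and> z \<in> \<real>"
    and f: "d1 \<in> \<real> \<and> d2 \<in> \<real> \<and> solves f \<and> (f \<longlongrightarrow> d1) E \<and> (quasi_deriv f \<longlongrightarrow> d2) E"
  have "real_data \<rho> \<sigma> chi z g"
    using r lfcms ab real_cm_AE_phase unfolding real_data_def by blast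
  with f show "\<forall>x\<in>D. f x \<in> \<real>" using re[OF solves_imp_sys] by blast
qed (use lim solves_imp_sys in blast)+

end

section \<open>From the regularity hypotheses to the locales\<close>

lemma left_part_eq: "d \<in> ival a b \<Longrightarrow> left_part a b d = {x. a < ereal x \<and> x < d}"
  by (auto simp: left_part_def ival_def intro: less_trans[of _ "ereal d"])

text \<open>\<open>(a, d)\<close> is covered by \<open>(a, c0]\<close> and the compact
  \<open>[c0, d]\<close>, on which local finiteness suffices.\<close>

lemma regular_left_lfin:
  assumes \<mu>: "lfcm a b \<mu>" and c0: "c0 \<in> ival a b" "emeasure (cvar \<mu>) {x. a < ereal x \<and> x \<le> c0} < \<infinity>"
  shows "lfin a b \<mu>"
  unfolding lfin_def
proof (intro conjI ballI \<mu>)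
  fix d assume d: "d \<in> ival a b"
  note s = lfcm_sets[OF \<mu>]
  have b: "{x. a < ereal x \<and> x \<le> c0} \<in> sets borel" by measurable
  have "emeasure (cvar \<mu>) (left_part a b d) \<le> emeasure (cvar \<mu>) ({x. a < ereal x \<and> x \<le> c0} \<union> {c0..d})"
    by (rule emeasure_mono) (use b in \<open>auto simp: s left_part_def ival_def\<close>)
  also have "\<dots> \<le> emeasure (cvar \<mu>) {x. a < ereal x \<and> x \<le> c0} + emeasure (cvar \<mu>) {c0..d}"
    by (rule emeasure_subadditive) (use b in \<open>auto simp: s\<close>)
  also have "\<dots> < \<infinity>"
    using c0(2) lfcm_finite_Icc[OF \<mu> ival_Icc_subset[OF c0(1) d]] by simp
  finally show "emeasure (cvar \<mu>) (left_part a b d) < \<infinity>" .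
qed

lemma uminus_image_left:
  fixes b :: ereal
  shows "uminus ` {x. - b < ereal x \<and> x \<le> - c0} = {x. c0 \<le> x \<and> ereal x < b}"
    "uminus ` {x. - b < ereal x \<and> x < - c0} = {x. c0 < x \<and> ereal x < b}"
    "uminus ` {x. c0 < x \<and> ereal x < b} = {x. - b < ereal x \<and> x < - c0}"
proof -
  have "x \<in> uminus ` S \<longleftrightarrow> - x \<in> S" for x :: real and S by force
  moreover have "- b < - ereal x \<longleftrightarrow> ereal x < b" "- b < ereal x \<longleftrightarrow> - ereal x < b" for x
    by (cases b; auto)+
  ultimately show "uminus ` {x. - b < ereal x \<and> x \<le> - c0} = {x. c0 \<le> x \<and> ereal x < b}"
    "uminus ` {x. - b < ereal x \<and> x < - c0} = {x. c0 < x \<and> ereal x < b}"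
    "uminus ` {x. c0 < x \<and> ereal x < b} = {x. - b < ereal x \<and> x < - c0}"
    by auto
qed

lemma regular_right_lfin:
  assumes \<mu>: "lfcm a b \<mu>" and c0: "c0 \<in> ival a b" "emeasure (cvar \<mu>) {x. c0 \<le> x \<and> ereal x < b} < \<infinity>"
  shows "lfin (- b) (- a) (mirror \<mu>)"
proof (rule regular_left_lfin[OF lfcm_mirror[OF \<mu>]])
  show "- c0 \<in> ival (- b) (- a)" using c0(1) uminus_mem_ival[of "- c0"] by simp
  have "{x. - b < ereal x \<and> x \<le> - c0} \<in> sets borel" by measurable
  then show "emeasure (cvar (mirror \<mu>)) {x. - b < ereal x \<and> x \<le> - c0} < \<infinity>"
    using c0(2) by (simp add: emeasure_mirror[OF \<mu>] uminus_image_left)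
qed

text \<open>The phase has modulus 1, so complex atoms and atoms of the variation vanish together;
  products of atoms become a dichotomy on the variations.\<close>

lemma cmeas_singleton_eq_0:
  assumes "lfcm a b \<mu>" "x \<in> ival a b"
  shows "cmeas \<mu> {x} = 0 \<longleftrightarrow> measure (cvar \<mu>) {x} = 0"
  using lfcm_norm_phase[OF assms(1), of x] by (auto simp: cmeas_eq_cmint cmint_singleton[OF assms])

theorem theorem3p5:
  fixes a b :: ereal and \<rho> \<sigma> chi :: cmeasure and c :: real and z :: complex
    and g :: "real \<Rightarrow> complex"
  assumes "a < b"
    and "lfcm a b \<rho>" and "lfcm a b \<sigma>" and "lfcm a b chi"
    and "csupp a b \<sigma> = ival a b"
    and "\<forall>x \<in> ival a b. cmeas \<sigma> {x} * cmeas \<rho> {x} = 0 \<and> cmeas \<sigma> {x} * cmeas chi {x} = 0"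
    and "c \<in> ival a b"
    and "locL1 a b \<rho> g"
  shows
   "(regular_left a b \<rho> \<sigma> chi
       \<and> (\<forall>d \<in> ival a b. set_integrable (cvar \<rho>) {x. a < ereal x \<and> x < d} g)
     \<longrightarrow>
       (\<forall>f. tau_solves a b \<rho> \<sigma> chi c z g f \<longrightarrow>
            (\<exists>L. (f \<longlongrightarrow> L) (left_end a))
          \<and> (\<exists>L. (qd1 a b \<rho> \<sigma> chi c f \<longlongrightarrow> L) (left_end a)))
     \<and> (\<forall>d1 d2. \<exists>f. tau_solves a b \<rho> \<sigma> chi c z g f
            \<and> (f \<longlongrightarrow> d1) (left_end a) \<and> (qd1 a b \<rho> \<sigma> chi c f \<longlongrightarrow> d2) (left_end a)
            \<and> (\<forall>f'. tau_solves a b \<rho> \<sigma> chi c z g f'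
                  \<and> (f' \<longlongrightarrow> d1) (left_end a) \<and> (qd1 a b \<rho> \<sigma> chi c f' \<longlongrightarrow> d2) (left_end a)
                  \<longrightarrow> (\<forall>x \<in> ival a b. f' x = f x)))
     \<and> (real_cm a b \<rho> \<and> real_cm a b \<sigma> \<and> real_cm a b chi
          \<and> (AE x in cvar \<rho>. g x \<in> \<real>) \<and> z \<in> \<real> \<longrightarrow>
          (\<forall>d1 d2 f. d1 \<in> \<real> \<and> d2 \<in> \<real> \<and> tau_solves a b \<rho> \<sigma> chi c z g f
              \<and> (f \<longlongrightarrow> d1) (left_end a) \<and> (qd1 a b \<rho> \<sigma> chi c f \<longlongrightarrow> d2) (left_end a)
              \<longrightarrow> (\<forall>x \<in> ival a b. f x \<in> \<real>))))
  \<and> (regular_right a b \<rho> \<sigma> chi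
       \<and> (\<forall>d \<in> ival a b. set_integrable (cvar \<rho>) {x. d < x \<and> ereal x < b} g)
     \<longrightarrow>
       (\<forall>f. tau_solves a b \<rho> \<sigma> chi c z g f \<longrightarrow>
            (\<exists>L. (f \<longlongrightarrow> L) (right_end b))
          \<and> (\<exists>L. (qd1 a b \<rho> \<sigma> chi c f \<longlongrightarrow> L) (right_end b)))
     \<and> (\<forall>d1 d2. \<exists>f. tau_solves a b \<rho> \<sigma> chi c z g f
            \<and> (f \<longlongrightarrow> d1) (right_end b) \<and> (qd1 a b \<rho> \<sigma> chi c f \<longlongrightarrow> d2) (right_end b)
            \<and> (\<forall>f'. tau_solves a b \<rho> \<sigma> chi c z g f'
                  \<and> (f' \<longlongrightarrow> d1) (right_end b) \<and> (qd1 a b \<rho> \<sigma> chi c f' \<longlongrightarrow> d2) (right_end b)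
                  \<longrightarrow> (\<forall>x \<in> ival a b. f' x = f x)))
     \<and> (real_cm a b \<rho> \<and> real_cm a b \<sigma> \<and> real_cm a b chi
          \<and> (AE x in cvar \<rho>. g x \<in> \<real>) \<and> z \<in> \<real> \<longrightarrow>
          (\<forall>d1 d2 f. d1 \<in> \<real> \<and> d2 \<in> \<real> \<and> tau_solves a b \<rho> \<sigma> chi c z g f
              \<and> (f \<longlongrightarrow> d1) (right_end b) \<and> (qd1 a b \<rho> \<sigma> chi c f \<longlongrightarrow> d2) (right_end b)
              \<longrightarrow> (\<forall>x \<in> ival a b. f x \<in> \<real>))))"
proof ((rule conjI; rule impI), goal_cases)
  have "measure (cvar \<sigma>) {x} = 0 \<or> measure (cvar \<rho>) {x} = 0 \<and> measure (cvar chi) {x} = 0" if "x \<in> ival a b" for x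
    using assms(6) that by (auto simp: cmeas_singleton_eq_0[OF assms(2) that]
        cmeas_singleton_eq_0[OF assms(3) that] cmeas_singleton_eq_0[OF assms(4) that])
  then interpret sl_tau a b \<rho> \<sigma> chi z g c
    by unfold_locales (use assms in auto)
  {
    case 1
    have "left_regular a b \<rho> \<sigma> chi g"
    proof
      show "lfin a b \<rho>" "lfin a b \<sigma>" "lfin a b chi"
        using 1 regular_left_lfin[OF assms(2)] regular_left_lfin[OF assms(3)] regular_left_lfin[OF assms(4)]
        unfolding regular_left_def by blast+
      fix d assume d: "d \<in> ival a b"
      then show "set_integrable (cvar \<rho>) (left_part a b d) g"
        using 1 unfolding left_part_eq[OF d] by blast
    qed (use assms in auto)
    then interpret left: left_regular a b \<rho> \<sigma> chi z g .
    show ?case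
    proof (rule boundary_value_problem)
      show "eventually (\<lambda>x. x \<in> ival a b) (left_end a)"
        by (rule eventually_mono[OF eventually_left_end[OF assms(7)]]) simp
    qed (rule left.isys_limits left.isys_exists left.isys_unique left.isys_real conjI; assumption?)+
  next
    case 2
    have "left_regular (- b) (- a) (mirror \<rho>) (mirror \<sigma>) (mirror chi) (\<lambda>t. g (- t))"
    proof
      show "- b < - a" using assms(1) by simp
      show "lfin (- b) (- a) (mirror \<rho>)" "lfin (- b) (- a) (mirror \<sigma>)" "lfin (- b) (- a) (mirror chi)"
        using 2 regular_right_lfin[OF assms(2)] regular_right_lfin[OF assms(3)] regular_right_lfin[OF assms(4)]
        unfolding regular_right_def by blast+
      show "locL1 (- b) (- a) (mirror \<rho>) (\<lambda>t. g (- t))"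
        by (rule locL1_mirror[OF assms(2,8)])
      fix d assume d: "d \<in> ival (- b) (- a)"
      \<comment> \<open>The hypothesis on \<open>g\<close> near \<open>b\<close> is taken at the
        point \<open>- d\<close>, which reflection carries to \<open>d\<close>.\<close>
      then have "set_integrable (cvar \<rho>) {x. - d < x \<and> ereal x < b} g"
        using 2 uminus_mem_ival[of d a b] by blast
      from set_integrable_mirror[OF assms(2) this]
      show "set_integrable (cvar (mirror \<rho>)) (left_part (- b) (- a) d) (\<lambda>t. g (- t))"
        by (simp add: uminus_image_left left_part_eq[OF d])
    qed
    then interpret right: right_regular a b \<rho> \<sigma> chi z g
      by (intro right_regular.intro sl_data_axioms)
    show ?case
    proof (rule boundary_value_problem)
      have "- c \<in> ival (- b) (- a)" using assms(7) uminus_mem_ival[of "- c"] by simp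
      from eventually_left_end[OF this]
      show "eventually (\<lambda>x. x \<in> ival a b) (right_end b)"
        unfolding right_end_eq eventually_filtermap by eventually_elim (simp add: uminus_mem_ival)
    qed (rule right.right_limits right.right_exists right.right_unique right.right_real conjI; assumption?)+
  }
qed

end
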